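(* Let $p$ be a prime, $b>0$, $P_0\in(0,1)$ and $D>0$, and put $$\alpha(P_0)=\frac{(1-P_0)(p^{b+1}-1)}{p^b(p-1)},\qquad \lambda(m)=Dp^{mb}\quad(m\in\mathbb N_0).$$ Let $(S_n)_{n\ge 0}$ be the random walk on $\mathbb Q_p/\mathbb Z_p$ described in the context, and for each $m\in\mathbb N_0$ let $\mathbb P^m$ be the law on the Skorokhod space $D([0,\infty)\colon\mathbb Q_p)$ of the rescaled embedded process $t\mapsto \Gamma_m\big(S_{\lfloor\lambda(m)t\rfloor}\big)$. Then the sequence $(\mathbb P^m)$ converges weakly in $D([0,\infty)\colon\mathbb Q_p)$ to the law $\mathbb P$ of the $p$-adic Brownian motion with Vladimirov exponent $b$ and diffusion constant $$\sigma=D\,\alpha(P_0)=\frac{D(1-P_0)(p^{b+1}-1)}{p^b(p-1)}.$$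
   Context: The random walk: $G=\mathbb Q_p/\mathbb Z_p$ (discrete), $[x]=x+\mathbb Z_p$, with $|[x]|=|x|_p$ if $x\notin\mathbb Z_p$ and $|[x]|=0$ if $x\in\mathbb Z_p$. For $k\ge1$ let $\mathbb S(k)=\{g\in G\colon |g|=p^k\}$, which has $p^k(1-1/p)$ elements. The random variable $X$ has $\mathrm{Prob}(X=[0])=P_0$ and, for $k\ge 1$ and $g\in\mathbb S(k)$, $\mathrm{Prob}(X=g)=\frac{(1-P_0)(p^b-1)}{p^{kb}}\cdot\frac1{\#\mathbb S(k)}$. Then $S_0=[0]$ and $S_n=X_1+\cdots+X_n$, with $X_i$ i.i.d. copies of $X$. The embeddings: every $x\in\mathbb Q_p$ is uniquely $x=\sum_{k\in\mathbb Z}a_x(k)p^k$ with $a_x(k)\in\{0,\dots,p-1\}$ and $a_x(k)=0$ for all sufficiently negative $k$. The map $\Gamma_m\colon G\to\mathbb Q_p$ is $\Gamma_m([x])=\sum_{k<m}a_{p^mx}(k)p^k$ (well defined). The limit: let $\chi(x)=\exp(2\pi\sqrt{-1}\{x\}_p)$, where $\{x\}_p=\sum_{k<0}a_x(k)p^k$, and let $dy$ be Haar measure on $\mathbb Q_p$ with $\mathbb Z_p$ of mass $1$. The $p$-adic Brownian motion with Vladimirov exponent $b$ and diffusion constant $\sigma>0$ is the process with càdlàg paths in $\mathbb Q_p$, started at $0$, with stationary independent increments whose increments over time $t>0$ have density $\rho(t,x)=\int_{\mathbb Q_p}\chi(xy)e^{-\sigma t|y|_p^b}\,dy$; this is the fundamental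 solution of $\partial_t\rho=-\sigma\Delta_b\rho$, $\rho(0,\cdot)=\delta_0$, where $\Delta_b$ is the Fourier multiplier operator with symbol $|y|_p^b$. $D([0,\infty)\colon\mathbb Q_p)$ is the space of càdlàg paths with the $J_1$ topology. *)

theory Defs
  imports "HOL-Probability.Probability" "Berlekamp_Zassenhaus.Finite_Field"
begin

section \<open>The field of \<open>p\<close>-adic numbers\<close>

text \<open>
  The prime is carried by the type: throughout, \<open>p = CARD('p)\<close> for a type variable \<open>'p\<close> of class
  \<^class>\<open>prime_card\<close>, and \<open>'p padic\<close> is the completion of the rationals for the \<open>p\<close>-adic absolute
  value, i.e. Cauchy sequences modulo null sequences.
\<close>

text \<open>For \<open>r = a / b\<close> in lowest terms, \<open>\<bar>r\<bar>\<^sub>p = p powi (v\<^sub>p b - v\<^sub>p a)\<close>.\<close>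

definition rat_padic_abs :: "nat \<Rightarrow> rat \<Rightarrow> real" where
  "rat_padic_abs p r =
    (if r = 0 then 0
     else real p powi (int (multiplicity (int p) (snd (quotient_of r)))
                     - int (multiplicity (int p) (fst (quotient_of r)))))"

lemma rat_padic_abs_0 [simp]: "rat_padic_abs p 0 = 0"
  by (simp add: rat_padic_abs_def)

lemma rat_padic_abs_divide:
  assumes p: "prime p" and a: "a \<noteq> 0" and b: "b \<noteq> 0"
  shows "rat_padic_abs p (of_int a / of_int b)
       = real p powi (int (multiplicity (int p) b) - int (multiplicity (int p) a))"
proof -
  let ?r = "of_int a / of_int b :: rat"
  obtain n d where nd: "quotient_of ?r = (n, d)" by fastforce
  have d: "d > 0" using quotient_of_denom_pos[OF nd] .
  have r: "?r = of_int n / of_int d" using quotient_of_div[OF nd] .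
  have "of_int (a * d) = (of_int (n * b) :: rat)"
    using r a b d by (simp add: field_simps)
  hence eq: "a * d = n * b" by (simp only: of_int_eq_iff)
  hence n: "n \<noteq> 0" using a b d by auto
  have pe: "prime_elem (int p)" using p by simp
  have "multiplicity (int p) a + multiplicity (int p) d = multiplicity (int p) n + multiplicity (int p) b"
    using arg_cong[OF eq, of "multiplicity (int p)"] a b d n
    by (simp add: prime_elem_multiplicity_mult_distrib[OF pe])
  hence "int (multiplicity (int p) d) - int (multiplicity (int p) n)
    = int (multiplicity (int p) b) - int (multiplicity (int p) a)" by linarith
  moreover have "?r \<noteq> 0" using a b by simp
  ultimately show ?thesis using nd by (simp add: rat_padic_abs_def)
qed

lemma rat_ex_divide: obtains a b where "r = (of_int a / of_int b :: rat)" "b \<noteq> 0" "r \<noteq> 0 \<Longrightarrow> a \<noteq> 0"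
proof -
  obtain n d where nd: "quotient_of r = (n, d)" by fastforce
  show ?thesis
    using that[of n d] quotient_of_denom_pos[OF nd] quotient_of_div[OF nd] by auto
qed

lemma rat_padic_abs_nonneg [simp]: "rat_padic_abs p r \<ge> 0"
  by (simp add: rat_padic_abs_def)

lemma rat_padic_abs_eq_0_iff: "prime p \<Longrightarrow> rat_padic_abs p r = 0 \<longleftrightarrow> r = 0"
  by (auto simp: rat_padic_abs_def dest: prime_gt_0_nat)

lemma rat_padic_abs_mult:
  assumes p: "prime p"
  shows "rat_padic_abs p (r * s) = rat_padic_abs p r * rat_padic_abs p s"
proof (cases "r = 0 \<or> s = 0")
  case False
  obtain a b where r: "r = of_int a / of_int b" "a \<noteq> 0" "b \<noteq> 0" using rat_ex_divide False by metis
  obtain c d where s: "s = of_int c / of_int d" "c \<noteq> 0" "d \<noteq> 0" using rat_ex_divide False by metis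
  have pe: "prime_elem (int p)" using p by simp
  have p0: "real p \<noteq> 0" using p by (auto dest: prime_gt_0_nat)
  have "r * s = of_int (a * c) / of_int (b * d)" using r s by simp
  hence "rat_padic_abs p (r * s) = real p powi (int (multiplicity (int p) (b * d)) - int (multiplicity (int p) (a * c)))"
    using r s by (simp del: of_int_mult add: rat_padic_abs_divide[OF p])
  also have "\<dots> = real p powi ((int (multiplicity (int p) b) - int (multiplicity (int p) a))
      + (int (multiplicity (int p) d) - int (multiplicity (int p) c)))"
    using r s by (simp add: prime_elem_multiplicity_mult_distrib[OF pe] algebra_simps)
  also have "\<dots> = rat_padic_abs p r * rat_padic_abs p s"
    using r s p0 by (subst power_int_add) (simp_all add: rat_padic_abs_divide[OF p])
  finally show ?thesis .
qed auto

lemma rat_padic_abs_1 [simp]: "prime p \<Longrightarrow> rat_padic_abs p 1 = 1"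
  by (simp add: rat_padic_abs_def)

lemma rat_padic_abs_minus [simp]: "prime p \<Longrightarrow> rat_padic_abs p (- r) = rat_padic_abs p r"
proof -
  assume p: "prime p"
  have "rat_padic_abs p (-1) * rat_padic_abs p (-1) = 1"
    using rat_padic_abs_mult[OF p, of "-1" "-1"] p by simp
  hence "rat_padic_abs p (-1) = 1"
    using rat_padic_abs_nonneg[of p "-1"] square_eq_1_iff[of "rat_padic_abs p (-1)"] by linarith
  thus ?thesis using rat_padic_abs_mult[OF p, of "-1" r] by simp
qed

lemma rat_padic_abs_ultra:
  assumes p: "prime p"
  shows "rat_padic_abs p (r + s) \<le> max (rat_padic_abs p r) (rat_padic_abs p s)"
proof (cases "r = 0 \<or> s = 0 \<or> r + s = 0")
  case False
  obtain a b where r: "r = of_int a / of_int b" "a \<noteq> 0" "b \<noteq> 0" using rat_ex_divide False by metis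
  obtain c d where s: "s = of_int c / of_int d" "c \<noteq> 0" "d \<noteq> 0" using rat_ex_divide False by metis
  let ?m = "multiplicity (int p)"
  have p1: "real p > 1" using p by (auto dest: prime_gt_1_nat)
  have r': "r = of_int (a * d) / of_int (b * d)" and s': "s = of_int (c * b) / of_int (b * d)"
    using r s by auto
  have rs: "r + s = of_int (a * d + c * b) / of_int (b * d)"
    using r s by (simp add: field_simps)
  have n0: "a * d + c * b \<noteq> 0" using False rs by (metis divide_eq_0_iff of_int_0)
  have "int p ^ min (?m (a*d)) (?m (c*b)) dvd a * d + c * b"
    by (intro dvd_add) (auto intro: multiplicity_dvd')
  hence "?m (a * d + c * b) \<ge> min (?m (a*d)) (?m (c*b))"
    using n0 p by (intro multiplicity_geI) (auto dest: prime_gt_1_nat)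
  hence ge: "?m (a * d + c * b) \<ge> ?m (a*d) \<or> ?m (a * d + c * b) \<ge> ?m (c*b)" by linarith
  have mono: "real p powi (int m - int k) \<le> real p powi (int m - int l)" if "l \<le> k" for m k l :: nat
    using p1 that by (intro power_int_increasing) auto
  show ?thesis
    using ge mono r s n0 unfolding rs
    by (subst r', subst s') (auto simp add: rat_padic_abs_divide[OF p] le_max_iff_disj simp del: of_int_mult of_int_add)
qed (auto simp: max_def)

lemma rat_padic_abs_diff_le:
  assumes "prime p"
  shows "\<bar>rat_padic_abs p r - rat_padic_abs p s\<bar> \<le> rat_padic_abs p (r - s)"
  using rat_padic_abs_ultra[OF assms, of "r - s" s] rat_padic_abs_ultra[OF assms, of "s - r" r]
    rat_padic_abs_minus[OF assms, of "r - s"] rat_padic_abs_nonneg[of p s] rat_padic_abs_nonneg[of p r]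
    rat_padic_abs_nonneg[of p "r - s"]
  unfolding le_max_iff_disj diff_add_cancel minus_diff_eq by linarith

lemma rat_padic_abs_triangle:
  assumes "prime p"
  shows "rat_padic_abs p (r + s) \<le> rat_padic_abs p r + rat_padic_abs p s"
  using rat_padic_abs_ultra[OF assms, of r s] rat_padic_abs_nonneg[of p s] rat_padic_abs_nonneg[of p r]
  unfolding le_max_iff_disj diff_add_cancel minus_diff_eq by linarith

lemma rat_padic_abs_eq_of_lt:
  assumes "prime p" "rat_padic_abs p (r - s) < rat_padic_abs p s"
  shows "rat_padic_abs p r = rat_padic_abs p s"
  using rat_padic_abs_ultra[OF assms(1), of "r - s" s] rat_padic_abs_ultra[OF assms(1), of "s - r" r]
    rat_padic_abs_minus[OF assms(1), of "r - s"] assms(2)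
  unfolding le_max_iff_disj diff_add_cancel minus_diff_eq by linarith

definition padic_cauchy :: "nat \<Rightarrow> (nat \<Rightarrow> rat) \<Rightarrow> bool" where
  "padic_cauchy p X \<longleftrightarrow> (\<forall>e>0. \<exists>M. \<forall>m\<ge>M. \<forall>n\<ge>M. rat_padic_abs p (X m - X n) < e)"

definition padic_null :: "nat \<Rightarrow> (nat \<Rightarrow> rat) \<Rightarrow> bool" where
  "padic_null p X \<longleftrightarrow> (\<lambda>n. rat_padic_abs p (X n)) \<longlonglongrightarrow> 0"

definition padic_rel :: "nat \<Rightarrow> (nat \<Rightarrow> rat) \<Rightarrow> (nat \<Rightarrow> rat) \<Rightarrow> bool" where
  "padic_rel p X Y \<longleftrightarrow> padic_cauchy p X \<and> padic_cauchy p Y \<and> padic_null p (\<lambda>n. X n - Y n)"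

context
  fixes p :: nat
  assumes p: "prime p"
begin

lemma padic_cauchy_const [simp]: "padic_cauchy p (\<lambda>_. r)"
  by (simp add: padic_cauchy_def)

lemma padic_null_0 [simp]: "padic_null p (\<lambda>_. 0)"
  by (simp add: padic_null_def)

lemma padic_null_le:
  assumes "padic_null p X" "\<And>n. rat_padic_abs p (Y n) \<le> C * rat_padic_abs p (X n)"
  shows "padic_null p Y"
proof -
  have "(\<lambda>n. C * rat_padic_abs p (X n)) \<longlonglongrightarrow> 0"
    using tendsto_mult_left[OF assms(1)[unfolded padic_null_def], of C] by simp
  thus ?thesis unfolding padic_null_def
    by (rule tendsto_sandwich[OF _ _ tendsto_const, rotated 2]) (auto simp: assms(2))
qed

lemma padic_null_minus: "padic_null p X \<Longrightarrow> padic_null p (\<lambda>n. - X n)"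
  by (simp add: padic_null_def p)

lemma padic_null_add:
  assumes "padic_null p X" "padic_null p Y" shows "padic_null p (\<lambda>n. X n + Y n)"
proof -
  have "(\<lambda>n. rat_padic_abs p (X n) + rat_padic_abs p (Y n)) \<longlonglongrightarrow> 0"
    using tendsto_add[OF assms[unfolded padic_null_def]] by simp
  thus ?thesis unfolding padic_null_def
    by (rule tendsto_sandwich[OF _ _ tendsto_const, rotated 2]) (auto simp: rat_padic_abs_triangle[OF p])
qed

lemma padic_null_diff:
  assumes "padic_null p X" "padic_null p Y" shows "padic_null p (\<lambda>n. X n - Y n)"
  using padic_null_add[OF assms(1) padic_null_minus[OF assms(2)]] by simp

lemma padic_cauchy_add:
  assumes "padic_cauchy p X" "padic_cauchy p Y" shows "padic_cauchy p (\<lambda>n. X n + Y n)"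
  unfolding padic_cauchy_def
proof safe
  fix e :: real assume e: "e > 0"
  obtain M where M: "\<And>m n. m \<ge> M \<Longrightarrow> n \<ge> M \<Longrightarrow> rat_padic_abs p (X m - X n) < e"
    using assms(1) e unfolding padic_cauchy_def by meson
  obtain L where L: "\<And>m n. m \<ge> L \<Longrightarrow> n \<ge> L \<Longrightarrow> rat_padic_abs p (Y m - Y n) < e"
    using assms(2) e unfolding padic_cauchy_def by meson
  have "rat_padic_abs p (X m + Y m - (X n + Y n)) < e" if "m \<ge> max M L" "n \<ge> max M L" for m n
    using rat_padic_abs_ultra[OF p, of "X m - X n" "Y m - Y n"] M[of m n] L[of m n] that
    by (auto simp: algebra_simps max_def split: if_splits)
  thus "\<exists>M. \<forall>m\<ge>M. \<forall>n\<ge>M. rat_padic_abs p (X m + Y m - (X n + Y n)) < e" by blast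
qed

lemma padic_cauchy_minus:
  assumes "padic_cauchy p X" shows "padic_cauchy p (\<lambda>n. - X n)"
proof -
  have "rat_padic_abs p (- X m - - X n) = rat_padic_abs p (X m - X n)" for m n
    using rat_padic_abs_minus[OF p, of "X m - X n"] by (simp add: algebra_simps)
  thus ?thesis using assms by (simp add: padic_cauchy_def)
qed

lemma padic_cauchy_bounded:
  assumes "padic_cauchy p X"
  obtains B where "B > 0" "\<And>n. rat_padic_abs p (X n) \<le> B"
proof -
  obtain M where M: "\<And>m n. m \<ge> M \<Longrightarrow> n \<ge> M \<Longrightarrow> rat_padic_abs p (X m - X n) < 1"
    using assms unfolding padic_cauchy_def by (meson zero_less_one)
  define B where "B = 1 + (\<Sum>n\<le>M. rat_padic_abs p (X n))"
  have S: "rat_padic_abs p (X n) \<le> (\<Sum>n\<le>M. rat_padic_abs p (X n))" if "n \<le> M" for n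
    using that by (intro member_le_sum) auto
  have "rat_padic_abs p (X n) \<le> B" for n
  proof (cases "n \<le> M")
    case False
    hence "rat_padic_abs p (X n - X M) < 1" using M[of n M] by simp
    thus ?thesis
      using S[of M] rat_padic_abs_triangle[OF p, of "X n - X M" "X M"] by (simp add: B_def)
  qed (use S[of n] in \<open>simp add: B_def\<close>)
  moreover have "B > 0" by (simp add: B_def add_pos_nonneg sum_nonneg)
  ultimately show ?thesis using that by blast
qed

lemma padic_cauchy_mult:
  assumes "padic_cauchy p X" "padic_cauchy p Y" shows "padic_cauchy p (\<lambda>n. X n * Y n)"
  unfolding padic_cauchy_def
proof safe
  fix e :: real assume e: "e > 0"
  obtain A where A: "A > 0" "\<And>n. rat_padic_abs p (X n) \<le> A" using padic_cauchy_bounded[OF assms(1)] by metis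
  obtain B where B: "B > 0" "\<And>n. rat_padic_abs p (Y n) \<le> B" using padic_cauchy_bounded[OF assms(2)] by metis
  obtain M where M: "\<And>m n. m \<ge> M \<Longrightarrow> n \<ge> M \<Longrightarrow> rat_padic_abs p (X m - X n) < e / B"
    using assms(1) e B unfolding padic_cauchy_def by (meson divide_pos_pos)
  obtain L where L: "\<And>m n. m \<ge> L \<Longrightarrow> n \<ge> L \<Longrightarrow> rat_padic_abs p (Y m - Y n) < e / A"
    using assms(2) e A unfolding padic_cauchy_def by (meson divide_pos_pos)
  have "rat_padic_abs p (X m * Y m - X n * Y n) < e" if mn: "m \<ge> max M L" "n \<ge> max M L" for m n
  proof -
    have "rat_padic_abs p (X m * (Y m - Y n)) \<le> A * rat_padic_abs p (Y m - Y n)"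
      using A by (simp add: rat_padic_abs_mult[OF p] mult_right_mono)
    also have "\<dots> < e" using L[of m n] mn A by (simp add: field_simps)
    finally have 1: "rat_padic_abs p (X m * (Y m - Y n)) < e" .
    have "rat_padic_abs p ((X m - X n) * Y n) \<le> rat_padic_abs p (X m - X n) * B"
      using B by (simp add: rat_padic_abs_mult[OF p] mult_left_mono)
    also have "\<dots> < e" using M[of m n] mn B by (simp add: field_simps)
    finally have 2: "rat_padic_abs p ((X m - X n) * Y n) < e" .
    have "X m * Y m - X n * Y n = X m * (Y m - Y n) + (X m - X n) * Y n" by (simp add: algebra_simps)
    thus ?thesis using rat_padic_abs_ultra[OF p, of "X m * (Y m - Y n)" "(X m - X n) * Y n"] 1 2 by simp
  qed
  thus "\<exists>M. \<forall>m\<ge>M. \<forall>n\<ge>M. rat_padic_abs p (X m * Y m - X n * Y n) < e" by blast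
qed

lemma padic_null_mult:
  assumes "padic_null p X" "padic_cauchy p Y" shows "padic_null p (\<lambda>n. X n * Y n)"
proof -
  obtain B where B: "B > 0" "\<And>n. rat_padic_abs p (Y n) \<le> B" using padic_cauchy_bounded[OF assms(2)] by metis
  show ?thesis
    by (rule padic_null_le[OF assms(1), of _ B])
       (simp add: rat_padic_abs_mult[OF p] B mult.commute[of B] mult_left_mono)
qed

lemma padic_cauchy_eventually_const:
  assumes "padic_cauchy p X" "\<not> padic_null p X"
  obtains c M where "c > 0" "\<And>n. n \<ge> M \<Longrightarrow> rat_padic_abs p (X n) = c"
proof -
  obtain e where e: "e > 0" "\<And>M. \<exists>n\<ge>M. rat_padic_abs p (X n) \<ge> e"
    using assms(2) unfolding padic_null_def LIMSEQ_iff by (auto simp: not_less)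
  obtain M where M: "\<And>m n. m \<ge> M \<Longrightarrow> n \<ge> M \<Longrightarrow> rat_padic_abs p (X m - X n) < e"
    using assms(1) e(1) unfolding padic_cauchy_def by meson
  obtain k where k: "k \<ge> M" "rat_padic_abs p (X k) \<ge> e" using e(2) by blast
  have c: "rat_padic_abs p (X n) = rat_padic_abs p (X k)" if "n \<ge> M" for n
    using rat_padic_abs_eq_of_lt[OF p, of "X n" "X k"] M[of n k] that k by simp
  show ?thesis by (rule that[OF _ c]) (use k e(1) in auto)
qed

lemma padic_cauchy_inverse:
  assumes "padic_cauchy p X" "\<not> padic_null p X"
  shows "padic_cauchy p (\<lambda>n. inverse (X n))"
  unfolding padic_cauchy_def
proof safe
  fix e :: real assume e: "e > 0"
  obtain c M where c: "c > 0" "\<And>n. n \<ge> M \<Longrightarrow> rat_padic_abs p (X n) = c"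
    using padic_cauchy_eventually_const[OF assms] by blast
  have "e * c * c > 0" using e c by simp
  then obtain L where L: "\<And>m n. m \<ge> L \<Longrightarrow> n \<ge> L \<Longrightarrow> rat_padic_abs p (X m - X n) < e * c * c"
    using assms(1) unfolding padic_cauchy_def by meson
  have "rat_padic_abs p (inverse (X m) - inverse (X n)) < e" if mn: "m \<ge> max M L" "n \<ge> max M L" for m n
  proof -
    have nz: "X m \<noteq> 0" "X n \<noteq> 0" using c(2)[of m] c(2)[of n] c(1) mn by auto
    have "(inverse (X m) - inverse (X n)) * (X m * X n) = X n - X m"
      using nz by (simp add: field_simps)
    hence "rat_padic_abs p (inverse (X m) - inverse (X n)) * (c * c) = rat_padic_abs p (X n - X m)"
      using c(2)[of m] c(2)[of n] mn by (metis max.boundedE rat_padic_abs_mult[OF p])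
    hence "rat_padic_abs p (inverse (X m) - inverse (X n)) * (c * c) < e * (c * c)"
      using L[of n m] mn by (simp add: mult.assoc)
    thus ?thesis using c(1) by (simp add: mult_less_cancel_right)
  qed
  thus "\<exists>M. \<forall>m\<ge>M. \<forall>n\<ge>M. rat_padic_abs p (inverse (X m) - inverse (X n)) < e" by blast
qed

lemma padic_rel_part_equivp: "part_equivp (padic_rel p)"
proof (rule part_equivpI)
  show "\<exists>x. padic_rel p x x" by (auto simp: padic_rel_def intro!: exI[of _ "\<lambda>_. 0"])
  show "symp (padic_rel p)"
  proof (rule sympI)
    fix X Y assume "padic_rel p X Y"
    thus "padic_rel p Y X" using padic_null_minus[of "\<lambda>n. X n - Y n"] by (simp add: padic_rel_def)
  qed
  show "transp (padic_rel p)"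
  proof (rule transpI)
    fix X Y Z assume "padic_rel p X Y" "padic_rel p Y Z"
    thus "padic_rel p X Z" using padic_null_add[of "\<lambda>n. X n - Y n" "\<lambda>n. Y n - Z n"]
      by (simp add: padic_rel_def)
  qed
qed

end

context
  fixes p :: nat
  assumes p: "prime p"
begin

lemma padic_cauchy_diff:
  assumes "padic_cauchy p X" "padic_cauchy p Y" shows "padic_cauchy p (\<lambda>n. X n - Y n)"
  using padic_cauchy_add[OF p assms(1) padic_cauchy_minus[OF p assms(2)]] by simp

lemma padic_rel_null_iff: "padic_rel p X Y \<Longrightarrow> padic_null p X \<longleftrightarrow> padic_null p Y"
  using padic_null_diff[OF p, of X "\<lambda>n. X n - Y n"] padic_null_add[OF p, of "\<lambda>n. X n - Y n" Y]
  by (auto simp: padic_rel_def)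

lemma padic_rel_add:
  assumes "padic_rel p X X'" "padic_rel p Y Y'"
  shows "padic_rel p (\<lambda>n. X n + Y n) (\<lambda>n. X' n + Y' n)"
proof -
  have "(\<lambda>n. X n + Y n - (X' n + Y' n)) = (\<lambda>n. (X n - X' n) + (Y n - Y' n))" by auto
  thus ?thesis using assms by (simp add: padic_rel_def padic_cauchy_add p padic_null_add)
qed

lemma padic_rel_minus:
  assumes "padic_rel p X X'"
  shows "padic_rel p (\<lambda>n. - X n) (\<lambda>n. - X' n)"
  using assms padic_null_minus[OF p, of "\<lambda>n. X n - X' n"]
  by (simp add: padic_rel_def padic_cauchy_minus p)

lemma padic_rel_diff:
  assumes "padic_rel p X X'" "padic_rel p Y Y'"
  shows "padic_rel p (\<lambda>n. X n - Y n) (\<lambda>n. X' n - Y' n)"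
  using padic_rel_add[OF assms(1) padic_rel_minus[OF assms(2)]] by simp

lemma padic_rel_mult:
  assumes "padic_rel p X X'" "padic_rel p Y Y'"
  shows "padic_rel p (\<lambda>n. X n * Y n) (\<lambda>n. X' n * Y' n)"
proof -
  have "(\<lambda>n. X n * Y n - (X' n * Y' n)) = (\<lambda>n. (X n - X' n) * Y n + (Y n - Y' n) * X' n)"
    by (auto simp: algebra_simps)
  thus ?thesis using assms by (simp add: padic_rel_def padic_cauchy_mult p padic_null_add padic_null_mult)
qed

lemma padic_rel_inverse:
  assumes "padic_rel p X X'" "\<not> padic_null p X"
  shows "padic_rel p (\<lambda>n. inverse (X n)) (\<lambda>n. inverse (X' n))"
proof -
  have c: "padic_cauchy p X" "padic_cauchy p X'" and n: "padic_null p (\<lambda>n. X n - X' n)"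
    using assms(1) by (auto simp: padic_rel_def)
  have nn: "\<not> padic_null p X'" using padic_rel_null_iff[OF assms(1)] assms(2) by simp
  note ci = padic_cauchy_inverse[OF p c(1) assms(2)] padic_cauchy_inverse[OF p c(2) nn]
  obtain a L where a: "a > 0" "\<And>n. n \<ge> L \<Longrightarrow> rat_padic_abs p (X n) = a"
    using padic_cauchy_eventually_const[OF p c(1) assms(2)] by blast
  obtain b M where b: "b > 0" "\<And>n. n \<ge> M \<Longrightarrow> rat_padic_abs p (X' n) = b"
    using padic_cauchy_eventually_const[OF p c(2) nn] by blast
  have "padic_null p (\<lambda>n. (- (X n - X' n)) * (inverse (X n) * inverse (X' n)))"
    by (intro padic_null_mult[OF p] padic_null_minus[OF p] n padic_cauchy_mult[OF p] ci)
  moreover have "\<forall>\<^sub>F n in sequentially. (- (X n - X' n)) * (inverse (X n) * inverse (X' n))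
      = inverse (X n) - inverse (X' n)"
    using eventually_ge_at_top[of "max L M"]
  proof eventually_elim
    case (elim n)
    hence "X n \<noteq> 0" "X' n \<noteq> 0" using a(1) a(2)[of n] b(1) b(2)[of n] by auto
    thus ?case by (simp add: field_simps)
  qed
  ultimately have "padic_null p (\<lambda>n. inverse (X n) - inverse (X' n))"
    unfolding padic_null_def
    by (elim Lim_transform_eventually) (auto elim!: eventually_mono simp del: minus_diff_eq)
  thus ?thesis using ci by (simp add: padic_rel_def)
qed

lemma padic_cauchy_abs_convergent:
  assumes "padic_cauchy p X" shows "convergent (\<lambda>n. rat_padic_abs p (X n))"
proof (cases "padic_null p X")
  case True
  thus ?thesis unfolding padic_null_def convergent_def by (rule exI)
next
  case False
  obtain a L where a: "a > 0" "\<And>n. n \<ge> L \<Longrightarrow> rat_padic_abs p (X n) = a"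
    using padic_cauchy_eventually_const[OF p assms False] by blast
  have "(\<lambda>n. rat_padic_abs p (X n)) \<longlonglongrightarrow> a"
    by (rule tendsto_eventually, rule eventually_sequentiallyI[of L], rule a(2))
  thus ?thesis unfolding convergent_def by (rule exI)
qed

lemma padic_rel_abs_eq:
  assumes "padic_rel p X Y"
  shows "lim (\<lambda>n. rat_padic_abs p (X n)) = lim (\<lambda>n. rat_padic_abs p (Y n))"
proof -
  have "(\<lambda>n. rat_padic_abs p (X n)) \<longlonglongrightarrow> lim (\<lambda>n. rat_padic_abs p (X n))"
    "(\<lambda>n. rat_padic_abs p (Y n)) \<longlonglongrightarrow> lim (\<lambda>n. rat_padic_abs p (Y n))"
    using assms padic_cauchy_abs_convergent[of X] padic_cauchy_abs_convergent[of Y]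
    by (simp_all add: padic_rel_def convergent_LIMSEQ_iff)
  from tendsto_diff[OF this]
  have 1: "(\<lambda>n. rat_padic_abs p (X n) - rat_padic_abs p (Y n)) \<longlonglongrightarrow>
    lim (\<lambda>n. rat_padic_abs p (X n)) - lim (\<lambda>n. rat_padic_abs p (Y n))" .
  have n: "(\<lambda>n. rat_padic_abs p (X n - Y n)) \<longlonglongrightarrow> 0"
    using assms unfolding padic_rel_def padic_null_def by blast
  have 2: "(\<lambda>n. rat_padic_abs p (X n) - rat_padic_abs p (Y n)) \<longlonglongrightarrow> 0"
    by (rule Lim_null_comparison[OF always_eventually n])
      (simp add: rat_padic_abs_diff_le[OF p])
  show ?thesis using LIMSEQ_unique[OF 1 2] by simp
qed

end

typedef (overloaded) 'p padic =
  "{C :: (nat \<Rightarrow> rat) set. \<exists>X. padic_rel CARD('p::prime_card) X X \<and> C = Collect (padic_rel CARD('p) X)}"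
  morphisms padic_seqs padic_of_seqs
proof -
  have "padic_rel CARD('p) (\<lambda>_. 0) (\<lambda>_. 0)" by (simp add: padic_rel_def prime_card)
  thus ?thesis by blast
qed

definition abs_padic :: "(nat \<Rightarrow> rat) \<Rightarrow> 'p::prime_card padic" where
  "abs_padic X = padic_of_seqs (Collect (padic_rel CARD('p) X))"

definition rep_padic :: "'p::prime_card padic \<Rightarrow> nat \<Rightarrow> rat" where
  "rep_padic x = (SOME X. X \<in> padic_seqs x)"

definition cr_padic :: "(nat \<Rightarrow> rat) \<Rightarrow> 'p::prime_card padic \<Rightarrow> bool" where
  "cr_padic = (\<lambda>X x. padic_rel CARD('p) X X \<and> abs_padic X = x)"

lemma Quotient_padic:
  "Quotient (padic_rel CARD('p)) abs_padic rep_padic (cr_padic :: _ \<Rightarrow> 'p::prime_card padic \<Rightarrow> bool)"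
proof -
  interpret quot_type "padic_rel CARD('p)" "padic_of_seqs :: _ \<Rightarrow> 'p padic" padic_seqs
  proof
    show "part_equivp (padic_rel CARD('p))" by (rule padic_rel_part_equivp[OF prime_card])
    show "\<exists>X. padic_rel CARD('p) X X \<and> padic_seqs y = Collect (padic_rel CARD('p) X)" for y :: "'p padic"
      using padic_seqs[of y] by (rule CollectD)
    show "padic_of_seqs (padic_seqs x) = x" for x :: "'p padic" by (rule padic_seqs_inverse)
    show "padic_seqs (padic_of_seqs C :: 'p padic) = C"
      if "\<exists>X. padic_rel CARD('p) X X \<and> C = Collect (padic_rel CARD('p) X)" for C
      by (rule padic_of_seqs_inverse, rule CollectI, rule that)
    show "(padic_seqs x = padic_seqs y) = (x = y)" for x y :: "'p padic" by (rule padic_seqs_inject)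
  qed
  have "abs = (abs_padic :: _ \<Rightarrow> 'p padic)" "rep = (rep_padic :: 'p padic \<Rightarrow> _)"
    by (auto simp: fun_eq_iff abs_def abs_padic_def rep_def rep_padic_def)
  with Quotient have "Quotient3 (padic_rel CARD('p)) abs_padic (rep_padic :: 'p padic \<Rightarrow> _)" by simp
  thus ?thesis by (rule Quotient3_to_Quotient) (simp add: cr_padic_def)
qed

setup_lifting Quotient_padic

instantiation padic :: (prime_card) field
begin

lift_definition zero_padic :: "'a padic" is "\<lambda>_. 0" 
  by (simp add: padic_rel_def prime_card)
lift_definition one_padic :: "'a padic" is "\<lambda>_. 1"
  by (simp add: padic_rel_def prime_card)
lift_definition plus_padic :: "'a padic \<Rightarrow> 'a padic \<Rightarrow> 'a padic" is "\<lambda>X Y n. X n + Y n"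
  by (rule padic_rel_add[OF prime_card])
lift_definition uminus_padic :: "'a padic \<Rightarrow> 'a padic" is "\<lambda>X n. - X n"
  by (rule padic_rel_minus[OF prime_card])
lift_definition minus_padic :: "'a padic \<Rightarrow> 'a padic \<Rightarrow> 'a padic" is "\<lambda>X Y n. X n - Y n"
  by (rule padic_rel_diff[OF prime_card])
lift_definition times_padic :: "'a padic \<Rightarrow> 'a padic \<Rightarrow> 'a padic" is "\<lambda>X Y n. X n * Y n"
  by (rule padic_rel_mult[OF prime_card])
lift_definition inverse_padic :: "'a padic \<Rightarrow> 'a padic"
  is "\<lambda>X. if padic_null CARD('a) X then (\<lambda>_. 0) else (\<lambda>n. inverse (X n))"
  using padic_rel_inverse[OF prime_card] padic_rel_null_iff[OF prime_card]
  by (auto simp: padic_rel_def prime_card)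
definition divide_padic :: "'a padic \<Rightarrow> 'a padic \<Rightarrow> 'a padic" where
  "divide_padic x y = x * inverse y"

instance
proof
  fix a b c :: "'a padic"
  have ext: "padic_rel CARD('a) X Y" if "padic_cauchy CARD('a) X" "\<And>n. X n = Y n" for X Y
  proof -
    from that(2) have "Y = X" by auto
    with that(1) show ?thesis by (simp add: padic_rel_def prime_card)
  qed
  note cauchy = padic_cauchy_add[OF prime_card[where 'a='a]] padic_cauchy_mult[OF prime_card[where 'a='a]]
    padic_cauchy_diff[OF prime_card[where 'a='a]] padic_cauchy_minus[OF prime_card[where 'a='a]]
  have D: "padic_rel CARD('a) X X \<Longrightarrow> padic_cauchy CARD('a) X" for X by (simp add: padic_rel_def)
  show "a * b * c = a * (b * c)"
    by transfer (rule ext, (intro cauchy; erule D), simp add: algebra_simps)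
  show "a * b = b * a"
    by transfer (rule ext, (intro cauchy; erule D), simp add: algebra_simps)
  show "1 * a = a"
    by transfer simp
  show "a + b + c = a + (b + c)"
    by transfer (rule ext, (intro cauchy; erule D), simp add: algebra_simps)
  show "a + b = b + a"
    by transfer (rule ext, (intro cauchy; erule D), simp add: algebra_simps)
  show "0 + a = a"
    by transfer simp
  show "- a + a = 0"
    by transfer (simp add: padic_rel_def prime_card)
  show "a - b = a + - b"
    by transfer (rule ext, (intro cauchy; erule D), simp)
  show "(a + b) * c = a * c + b * c"
    by transfer (rule ext, (intro cauchy; erule D), simp add: algebra_simps)
  show "(0::'a padic) \<noteq> 1"
    by transfer (simp add: padic_rel_def padic_null_def prime_card LIMSEQ_const_iff)
  show "a \<noteq> 0 \<Longrightarrow> inverse a * a = 1"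
  proof transfer
    fix X :: "nat \<Rightarrow> rat"
    assume X: "padic_rel CARD('a) X X" and nz: "\<not> padic_rel CARD('a) X (\<lambda>_. 0)"
    hence nn: "\<not> padic_null CARD('a) X" by (auto simp: padic_rel_def prime_card)
    have c: "padic_cauchy CARD('a) X" using X by (simp add: padic_rel_def)
    obtain e L where e: "e > 0" "\<And>n. n \<ge> L \<Longrightarrow> rat_padic_abs CARD('a) (X n) = e"
      using padic_cauchy_eventually_const[OF prime_card c nn] by blast
    have "\<forall>\<^sub>F n in sequentially. 0 = rat_padic_abs CARD('a) (inverse (X n) * X n - 1)"
      using eventually_ge_at_top[of L]
    proof eventually_elim
      case (elim n)
      hence "X n \<noteq> 0" using e(1) e(2)[of n] by auto
      thus ?case by simp
    qed
    hence "padic_null CARD('a) (\<lambda>n. inverse (X n) * X n - 1)"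
      unfolding padic_null_def by (rule Lim_transform_eventually[OF tendsto_const])
    thus "padic_rel CARD('a) (\<lambda>n. (if padic_null CARD('a) X then \<lambda>_. 0 else (\<lambda>n. inverse (X n))) n * X n) (\<lambda>_. 1)"
      using nn c by (simp add: padic_rel_def prime_card padic_cauchy_mult padic_cauchy_inverse)
  qed
  show "a div b = a * inverse b" by (rule divide_padic_def)
  show "inverse (0::'a padic) = 0"
    by transfer (simp add: padic_rel_def prime_card)
qed

end

lift_definition padic_abs :: "'p::prime_card padic \<Rightarrow> real" is "\<lambda>X. lim (\<lambda>n. rat_padic_abs CARD('p) (X n))"
  by (rule padic_rel_abs_eq[OF prime_card])

lemma padic_abs_LIMSEQ:
  "padic_rel CARD('p::prime_card) X X \<Longrightarrow>
    (\<lambda>n. rat_padic_abs CARD('p) (X n)) \<longlonglongrightarrow> lim (\<lambda>n. rat_padic_abs CARD('p) (X n))"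
  using padic_cauchy_abs_convergent[OF prime_card[where 'a='p], of X] by (simp add: padic_rel_def convergent_LIMSEQ_iff)

lemma padic_abs_nonneg [simp]: "padic_abs x \<ge> 0"
  by transfer (rule LIMSEQ_le_const[OF padic_abs_LIMSEQ], auto)

lemma padic_abs_eq_0_iff [simp]: "padic_abs x = 0 \<longleftrightarrow> x = 0"
proof transfer
  fix X assume X: "padic_rel CARD('a) X X"
  show "(lim (\<lambda>n. rat_padic_abs CARD('a) (X n)) = 0) = padic_rel CARD('a) X (\<lambda>_. 0)"
    using padic_abs_LIMSEQ[OF X] X by (auto simp: padic_rel_def padic_null_def prime_card dest: limI)
qed

lemma padic_abs_mult: "padic_abs (x * y) = padic_abs x * padic_abs y"
proof transfer
  fix X Y assume X: "padic_rel CARD('a) X X" and Y: "padic_rel CARD('a) Y Y"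
  show "lim (\<lambda>n. rat_padic_abs CARD('a) (X n * Y n)) =
    lim (\<lambda>n. rat_padic_abs CARD('a) (X n)) * lim (\<lambda>n. rat_padic_abs CARD('a) (Y n))"
    using tendsto_mult[OF padic_abs_LIMSEQ[OF X] padic_abs_LIMSEQ[OF Y]]
    by (intro limI) (simp add: rat_padic_abs_mult prime_card)
qed

lemma padic_abs_ultra: "padic_abs (x + y) \<le> max (padic_abs x) (padic_abs y)"
proof transfer
  fix X Y assume X: "padic_rel CARD('a) X X" and Y: "padic_rel CARD('a) Y Y"
  show "lim (\<lambda>n. rat_padic_abs CARD('a) (X n + Y n)) \<le>
    max (lim (\<lambda>n. rat_padic_abs CARD('a) (X n))) (lim (\<lambda>n. rat_padic_abs CARD('a) (Y n)))"
    by (rule LIMSEQ_le[OF padic_abs_LIMSEQ[OF padic_rel_add[OF prime_card X Y]]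
          tendsto_max[OF padic_abs_LIMSEQ[OF X] padic_abs_LIMSEQ[OF Y]]])
      (auto intro!: exI[of _ 0] rat_padic_abs_ultra prime_card)
qed

lemma padic_abs_minus [simp]: "padic_abs (- x) = padic_abs x"
  by transfer (simp add: prime_card)

lemma padic_abs_0 [simp]: "padic_abs 0 = 0" by simp

lemma padic_abs_1 [simp]: "padic_abs (1 :: 'p::prime_card padic) = 1"
  using padic_abs_mult[of 1 "1 :: 'p padic"] padic_abs_eq_0_iff[of "1 :: 'p padic"] by (auto simp del: padic_abs_eq_0_iff)

lemma padic_abs_diff_commute: "padic_abs (x - y) = padic_abs (y - x)"
  using padic_abs_minus[of "x - y"] by simp

lemma padic_abs_inverse: "padic_abs (inverse x) = inverse (padic_abs x)"
proof (cases "x = 0")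
  case False
  hence "padic_abs (inverse x) * padic_abs x = 1" by (simp flip: padic_abs_mult)
  thus ?thesis by (metis inverse_unique mult.commute)
qed simp

lemma padic_abs_power: "padic_abs (x ^ n) = padic_abs x ^ n"
  by (induction n) (simp_all add: padic_abs_mult)

lemma padic_abs_powi: "padic_abs (x powi k) = padic_abs x powi k"
  by (simp add: power_int_def padic_abs_power padic_abs_inverse)

lemma padic_abs_sum_le:
  assumes "\<And>i. i \<in> A \<Longrightarrow> padic_abs (f i) \<le> C" "C \<ge> 0"
  shows "padic_abs (sum f A) \<le> C"
  using assms
proof (induction A rule: infinite_finite_induct)
  case (insert i A)
  have "max (padic_abs (f i)) (padic_abs (sum f A)) \<le> C"
    using insert by (intro max.boundedI) auto
  with padic_abs_ultra[of "f i" "sum f A"] have "padic_abs (f i + sum f A) \<le> C"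
    by (rule order_trans)
  thus ?case using insert.hyps by simp
qed auto

lift_definition padic_of_rat :: "rat \<Rightarrow> 'p::prime_card padic" is "\<lambda>r _. r"
  using padic_null_0[OF prime_card[where 'a='p]] padic_cauchy_const[OF prime_card[where 'a='p]]
  by (simp add: padic_rel_def)

lemma padic_of_rat_add: "padic_of_rat (r + s) = padic_of_rat r + padic_of_rat s"
  by transfer (simp add: padic_rel_def prime_card padic_null_0[simplified])

lemma padic_of_rat_minus: "padic_of_rat (- r) = - padic_of_rat r"
  by transfer (simp add: padic_rel_def prime_card padic_null_0[simplified])

lemma padic_of_rat_diff: "padic_of_rat (r - s) = padic_of_rat r - padic_of_rat s"
  by transfer (simp add: padic_rel_def prime_card padic_null_0[simplified])

lemma padic_of_rat_mult: "padic_of_rat (r * s) = padic_of_rat r * padic_of_rat s"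
  by transfer (simp add: padic_rel_def prime_card padic_null_0[simplified])

lemma padic_of_rat_0 [simp]: "padic_of_rat 0 = 0"
  by transfer (simp add: padic_rel_def prime_card)

lemma padic_of_rat_1 [simp]: "padic_of_rat 1 = 1"
  by transfer (simp add: padic_rel_def prime_card padic_null_0[simplified])

lemma padic_abs_of_rat: "padic_abs (padic_of_rat r :: 'p::prime_card padic) = rat_padic_abs CARD('p) r"
  by transfer simp

lemma padic_of_rat_of_nat: "padic_of_rat (of_nat n) = of_nat n"
  by (induction n) (simp_all add: padic_of_rat_add)

lemma padic_of_rat_of_int: "padic_of_rat (of_int n) = of_int n"
  by (cases n) (simp_all add: padic_of_rat_diff padic_of_rat_minus padic_of_rat_add padic_of_rat_of_nat)

instance padic :: (prime_card) field_char_0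
proof
  show "inj (of_nat :: nat \<Rightarrow> 'a padic)"
  proof (rule injI)
    fix m n assume "of_nat m = (of_nat n :: 'a padic)"
    hence "padic_abs (padic_of_rat (of_nat m - of_nat n) :: 'a padic) = 0"
      by (simp add: padic_of_rat_diff padic_of_rat_of_nat)
    thus "m = n" by (simp add: padic_abs_of_rat rat_padic_abs_eq_0_iff prime_card)
  qed
qed

lemma padic_abs_of_int_le_1: "padic_abs (of_int n) \<le> 1"
proof -
  have N: "padic_abs (of_nat n :: 'b::prime_card padic) \<le> 1" for n
    using padic_abs_sum_le[of "{..<n}" "\<lambda>_. 1 :: 'b padic" 1] by simp
  show ?thesis
    by (cases n rule: int_cases2) (simp_all add: N)
qed

lemma padic_abs_of_nat_le_1: "padic_abs (of_nat n) \<le> 1"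
  using padic_abs_of_int_le_1[of "int n"] by simp

lemma padic_abs_p: "padic_abs (of_nat CARD('p) :: 'p::prime_card padic) = 1 / real CARD('p)"
proof -
  have "rat_padic_abs CARD('p) (of_int (int CARD('p)) / of_int 1) = 1 / real CARD('p)"
    by (subst rat_padic_abs_divide) (use prime_card[where 'a='p] prime_gt_1_nat[OF prime_card[where 'a='p]] in
       \<open>auto simp: power_int_minus inverse_eq_divide\<close>)
  thus ?thesis by (simp flip: padic_abs_of_rat add: padic_of_rat_of_nat)
qed

lemma padic_abs_p_powi:
  "padic_abs (of_nat CARD('p) powi k :: 'p::prime_card padic) = real CARD('p) powi (- k)"
  by (simp add: padic_abs_powi padic_abs_p power_int_divide_distrib power_int_minus inverse_eq_divide)

lemma padic_abs_of_int_less_1_iff: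
  "padic_abs (of_int n :: 'p::prime_card padic) < 1 \<longleftrightarrow> int CARD('p) dvd n"
proof (cases "n = 0")
  case False
  have p: "prime CARD('p)" by (rule prime_card)
  have "padic_abs (of_int n :: 'p padic) = rat_padic_abs CARD('p) (of_int n / of_int 1)"
    by (simp flip: padic_abs_of_rat add: padic_of_rat_of_int)
  also have "\<dots> = real CARD('p) powi (- int (multiplicity (int CARD('p)) n))"
    using False by (subst rat_padic_abs_divide) (auto simp: p)
  also have "\<dots> < 1 \<longleftrightarrow> multiplicity (int CARD('p)) n > 0"
    using prime_gt_1_nat[OF p] by (cases "multiplicity (int CARD('p)) n = 0")
      (auto simp: power_int_minus inverse_eq_divide one_less_power)
  also have "\<dots> \<longleftrightarrow> int CARD('p) dvd n"
    using False p by (intro prime_multiplicity_gt_zero_iff) auto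
  finally show ?thesis .
qed simp

lemma padic_abs_value:
  assumes "x \<noteq> (0 :: 'p::prime_card padic)"
  obtains k :: int where "padic_abs x = real CARD('p) powi k"
proof -
  have "\<exists>k. padic_abs x = real CARD('p) powi k" using assms
  proof transfer
    fix X assume X: "padic_rel CARD('p) X X" and nz: "\<not> padic_rel CARD('p) X (\<lambda>_. 0)"
    hence nn: "\<not> padic_null CARD('p) X" and c: "padic_cauchy CARD('p) X"
      by (auto simp: padic_rel_def prime_card)
    obtain e L where e: "e > 0" "\<And>n. n \<ge> L \<Longrightarrow> rat_padic_abs CARD('p) (X n) = e"
      using padic_cauchy_eventually_const[OF prime_card c nn] by blast
    have "(\<lambda>n. rat_padic_abs CARD('p) (X n)) \<longlonglongrightarrow> e"
      by (rule tendsto_eventually, rule eventually_sequentiallyI[of L], rule e(2))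
    hence "lim (\<lambda>n. rat_padic_abs CARD('p) (X n)) = rat_padic_abs CARD('p) (X L)"
      using e(2)[of L] by (simp add: limI)
    moreover have "X L \<noteq> 0" using e(1) e(2)[of L] by auto
    ultimately show "\<exists>k. lim (\<lambda>n. rat_padic_abs CARD('p) (X n)) = real CARD('p) powi k"
      unfolding rat_padic_abs_def by auto
  qed
  thus ?thesis using that by blast
qed

lemma padic_of_rat_dense:
  assumes "e > 0"
  obtains r where "padic_abs (x - padic_of_rat r) < e"
proof -
  have "\<exists>r. padic_abs (x - padic_of_rat r) < e"
  proof (transfer fixing: e)
    fix X assume X: "padic_rel CARD('a) X X"
    then obtain M where M: "\<And>m n. m \<ge> M \<Longrightarrow> n \<ge> M \<Longrightarrow> rat_padic_abs CARD('a) (X m - X n) < e / 2"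
      using assms unfolding padic_rel_def padic_cauchy_def by (meson half_gt_zero)
    have "padic_rel CARD('a) (\<lambda>_. X M) (\<lambda>_. X M)"
      by (simp add: padic_rel_def prime_card padic_null_0[simplified])
    from padic_abs_LIMSEQ[OF padic_rel_diff[OF prime_card X this]]
    have "lim (\<lambda>n. rat_padic_abs CARD('a) (X n - X M)) \<le> e / 2"
      by (rule LIMSEQ_le_const2) (use M[of _ M] in \<open>force intro: less_imp_le\<close>)
    thus "\<exists>r. lim (\<lambda>n. rat_padic_abs CARD('a) (X n - r)) < e" using assms by (intro exI[of _ "X M"]) simp
  qed
  thus ?thesis using that by blast
qed

instantiation padic :: (prime_card) metric_space
begin

definition dist_padic :: "'a padic \<Rightarrow> 'a padic \<Rightarrow> real" where
  "dist_padic x y = padic_abs (x - y)"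

definition uniformity_padic :: "('a padic \<times> 'a padic) filter" where
  "uniformity_padic = (INF e\<in>{0<..}. principal {(x, y). dist x y < e})"

definition open_padic :: "'a padic set \<Rightarrow> bool" where
  "open_padic U \<longleftrightarrow> (\<forall>x\<in>U. eventually (\<lambda>(x', y). x' = x \<longrightarrow> y \<in> U) uniformity)"

instance
proof
  fix x y z :: "'a padic"
  show "dist x y = 0 \<longleftrightarrow> x = y" by (simp add: dist_padic_def)
  show "dist x y \<le> dist x z + dist y z"
    using padic_abs_ultra[of "x - z" "z - y"] padic_abs_nonneg[of "x - z"] padic_abs_nonneg[of "y - z"]
      padic_abs_diff_commute[of z y] by (auto simp: dist_padic_def simp del: padic_abs_nonneg)
qed (simp_all add: uniformity_padic_def open_padic_def)

end

lemma padic_dist_ultra: "dist x z \<le> max (dist x y) (dist y (z :: 'p::prime_card padic))"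
  using padic_abs_ultra[of "x - y" "y - z"] by (simp add: dist_padic_def)

instance padic :: (prime_card) topological_ab_group_add
proof
  fix a b :: "'a padic"
  have A: "dist (x + y) (u + v) \<le> dist x u + dist y v" for x y u v :: "'a padic"
    using padic_abs_ultra[of "x - u" "y - v"] padic_abs_nonneg[of "x - u"] padic_abs_nonneg[of "y - v"]
    by (auto simp: dist_padic_def algebra_simps simp del: padic_abs_nonneg)
  show "((\<lambda>x. fst x + snd x) \<longlongrightarrow> a + b) (nhds a \<times>\<^sub>F nhds b)"
  proof (rule tendstoI)
    fix e :: real assume e: "e > 0"
    have "\<forall>\<^sub>F x in nhds a. dist x a < e / 2" "\<forall>\<^sub>F x in nhds b. dist x b < e / 2"
      by (rule tendstoD[OF filterlim_ident half_gt_zero[OF e]])+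
    hence "\<forall>\<^sub>F x in nhds a \<times>\<^sub>F nhds b. dist (fst x) a < e / 2 \<and> dist (snd x) b < e / 2"
      unfolding eventually_prod_filter by force
    thus "\<forall>\<^sub>F x in nhds a \<times>\<^sub>F nhds b. dist (fst x + snd x) (a + b) < e"
      by eventually_elim (use A[of _ _ a b] in \<open>smt (verit) field_sum_of_halves\<close>)
  qed
  show "(uminus \<longlongrightarrow> - a) (nhds a)"
  proof (rule tendstoI)
    fix e :: real assume e: "e > 0"
    have "dist (- x) (- a) = dist x a" for x
      using padic_abs_minus[of "x - a"] by (simp add: dist_padic_def del: padic_abs_minus)
    thus "\<forall>\<^sub>F x in nhds a. dist (- x) (- a) < e"
      using e tendstoD[OF filterlim_ident] by auto
  qed
qed

section \<open>Digits\<close>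

text \<open>\<open>x = (\<Sum>k\<in>\<int>. a k * p powi k)\<close> with digits \<open>a k\<close> in \<open>{0..p-1}\<close>, almost all of the negative ones zero.\<close>

definition padic_expansion :: "'p::prime_card padic \<Rightarrow> (int \<Rightarrow> nat) \<Rightarrow> bool" where
  "padic_expansion x a \<longleftrightarrow>
     (\<forall>k. a k < CARD('p)) \<and> (\<exists>N. \<forall>k<N. a k = 0) \<and>
     ((\<lambda>k. of_nat (a k) * of_nat CARD('p) powi k) has_sum x) UNIV"

lemma padic_abs_add_le: "padic_abs x \<le> C \<Longrightarrow> padic_abs y \<le> C \<Longrightarrow> padic_abs (x + y) \<le> C"
  using order_trans[OF padic_abs_ultra max.boundedI] .

lemma padic_abs_diff_le: "padic_abs x \<le> C \<Longrightarrow> padic_abs y \<le> C \<Longrightarrow> padic_abs (x - y) \<le> C"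
  using padic_abs_add_le[of x C "- y"] by simp

lemma padic_p_nz [simp]: "(of_nat CARD('p) :: 'p::prime_card padic) \<noteq> 0"
  using padic_abs_p[where 'p='p] prime_gt_0_nat[OF prime_card[where 'a='p]] by force

lemma padic_CARD_gt_1: "real CARD('p::prime_card) > 1"
  using prime_gt_1_nat[OF prime_card[where 'a='p]] by simp

lemma padic_abs_digit_term:
  "padic_abs (of_nat d * of_nat CARD('p) powi k :: 'p::prime_card padic) \<le> real CARD('p) powi (- k)"
  unfolding padic_abs_mult padic_abs_p_powi
  using mult_right_mono[OF padic_abs_of_nat_le_1[of d, where 'a='p], of "real CARD('p) powi (- k)"] by simp

lemma padic_expansion_truncate:
  fixes x :: "'p::prime_card padic"
  assumes x: "padic_expansion x a" and N: "\<And>k. k < N \<Longrightarrow> a k = 0"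
  shows "padic_abs (x - (\<Sum>k\<in>{N..<m}. of_nat (a k) * of_nat CARD('p) powi k)) \<le> real CARD('p) powi (- m)"
proof -
  let ?f = "\<lambda>k. of_nat (a k) * of_nat CARD('p) powi k :: 'p padic"
  let ?e = "real CARD('p) powi (- m)"
  have e: "?e > 0" using padic_CARD_gt_1[where 'p='p] by simp
  have "(?f has_sum x) UNIV" using x by (simp add: padic_expansion_def)
  hence "\<forall>\<^sub>F F in finite_subsets_at_top UNIV. dist (sum ?f F) x < ?e"
    unfolding has_sum_def using e by (rule tendstoD)
  then obtain F0 where F0: "finite F0" "\<And>F. finite F \<Longrightarrow> F0 \<subseteq> F \<Longrightarrow> dist (sum ?f F) x < ?e"
    unfolding eventually_finite_subsets_at_top by auto
  define F where "F = F0 \<union> {N..<m}"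
  have fin: "finite F" using F0 by (simp add: F_def)
  have 1: "padic_abs (x - sum ?f F) \<le> ?e"
    using F0(2)[OF fin] by (simp add: F_def dist_padic_def padic_abs_diff_commute[of x])
  have "padic_abs (sum ?f (F - {N..<m})) \<le> ?e"
  proof (rule padic_abs_sum_le)
    fix k assume k: "k \<in> F - {N..<m}"
    show "padic_abs (?f k) \<le> ?e"
    proof (cases "k < N")
      case False
      have "padic_abs (?f k) \<le> real CARD('p) powi (- k)" by (rule padic_abs_digit_term)
      also have "\<dots> \<le> ?e" using False k padic_CARD_gt_1[where 'p='p] by (intro power_int_increasing) auto
      finally show ?thesis .
    qed (use N e in simp)
  qed (use e in simp)
  from padic_abs_add_le[OF 1 this]
  have "padic_abs ((x - sum ?f F) + sum ?f (F - {N..<m})) \<le> ?e" .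
  moreover have "sum ?f F = sum ?f (F - {N..<m}) + sum ?f {N..<m}"
    using fin by (intro sum.subset_diff) (auto simp: F_def)
  hence "(x - sum ?f F) + sum ?f (F - {N..<m}) = x - sum ?f {N..<m}" by simp
  ultimately show ?thesis by (simp only:)
qed

lemma padic_expansion_agree:
  fixes x y :: "'p::prime_card padic"
  assumes x: "padic_expansion x a" and y: "padic_expansion y b"
    and xy: "padic_abs (x - y) \<le> real CARD('p) powi (- m)" and k: "k < m"
  shows "a k = b k"
proof -
  obtain Na where Na: "\<And>k. k < Na \<Longrightarrow> a k = 0" using x unfolding padic_expansion_def by blast
  obtain Nb where Nb: "\<And>k. k < Nb \<Longrightarrow> b k = 0" using y unfolding padic_expansion_def by blast
  define N where "N = min Na Nb"
  have N: "\<And>k. k < N \<Longrightarrow> a k = 0" "\<And>k. k < N \<Longrightarrow> b k = 0" using Na Nb by (auto simp: N_def)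
  let ?p = "of_nat CARD('p) :: 'p padic"
  let ?f = "\<lambda>a k. of_nat (a k) * ?p powi k"
  have p1: "real CARD('p) > 1" by (rule padic_CARD_gt_1)
  have "a (N + int n) = b (N + int n)" if "N + int n < m" for n
    using that
  proof (induction n rule: less_induct)
    case (less n)
    define k where "k = N + int n"
    have k: "N \<le> k" "k < m" using less.prems by (auto simp: k_def)
    have eq: "a j = b j" if "j \<in> {N..<k}" for j
      using less.IH[of "nat (j - N)"] that k by (auto simp: k_def)
    have split: "{N..<k+1} = insert k {N..<k}" using k by auto
    have S: "sum (?f a) {N..<k+1} - sum (?f b) {N..<k+1} = of_int (int (a k) - int (b k)) * ?p powi k"
    proof -
      have "sum (?f a) {N..<k} = sum (?f b) {N..<k}" by (rule sum.cong) (simp_all add: eq)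
      thus ?thesis unfolding split by (simp add: algebra_simps)
    qed
    let ?e = "real CARD('p) powi (- (k + 1))"
    have T: "padic_abs (x - sum (?f a) {N..<k+1}) \<le> ?e" "padic_abs (y - sum (?f b) {N..<k+1}) \<le> ?e"
      by (rule padic_expansion_truncate[OF x], rule N, assumption)
         (rule padic_expansion_truncate[OF y], rule N, assumption)
    have "padic_abs (x - y) \<le> ?e"
      using xy by (rule order_trans) (use k p1 in \<open>auto intro!: power_int_increasing\<close>)
    hence "padic_abs ((x - y) - (x - sum (?f a) {N..<k+1})) \<le> ?e"
      by (rule padic_abs_diff_le[OF _ T(1)])
    hence "padic_abs ((x - y) - (x - sum (?f a) {N..<k+1}) + (y - sum (?f b) {N..<k+1})) \<le> ?e"
      by (rule padic_abs_add_le[OF _ T(2)])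
    moreover have "(x - y) - (x - sum (?f a) {N..<k+1}) + (y - sum (?f b) {N..<k+1})
        = of_int (int (a k) - int (b k)) * ?p powi k"
      unfolding S[symmetric] by simp
    ultimately have "padic_abs (of_int (int (a k) - int (b k)) * ?p powi k) \<le> ?e" by simp
    moreover have "?e = real CARD('p) powi (-1) * real CARD('p) powi (- k)"
      using p1 by (subst power_int_add[symmetric]) (auto simp: algebra_simps)
    ultimately have "padic_abs (of_int (int (a k) - int (b k)) :: 'p padic) * real CARD('p) powi (- k)
        \<le> real CARD('p) powi (-1) * real CARD('p) powi (- k)"
      unfolding padic_abs_mult padic_abs_p_powi by (simp only:)
    hence "padic_abs (of_int (int (a k) - int (b k)) :: 'p padic) \<le> real CARD('p) powi (-1)"
      by (rule mult_right_le_imp_le) (use p1 in simp)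
    also have "\<dots> < 1" using p1 by (simp add: power_int_minus field_simps)
    finally have "int CARD('p) dvd int (a k) - int (b k)"
      unfolding padic_abs_of_int_less_1_iff .
    moreover have "a k < CARD('p)" "b k < CARD('p)" using x y by (auto simp: padic_expansion_def)
    hence "\<bar>int (a k) - int (b k)\<bar> < int CARD('p)" by linarith
    ultimately have "int (a k) - int (b k) = 0" using zdvd_imp_le[of "int CARD('p)" "\<bar>int (a k) - int (b k)\<bar>"] by force
    thus ?case by (simp add: k_def)
  qed
  from this[of "nat (k - N)"] show ?thesis using k N[of k] by (cases "k < N") auto
qed

lemma padic_digit_step:
  fixes z :: "'p::prime_card padic"
  assumes z: "padic_abs z \<le> 1"
  shows "\<exists>d<CARD('p). padic_abs ((z - of_nat d) / of_nat CARD('p)) \<le> 1"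
proof -
  have p: "prime CARD('p)" and p1: "real CARD('p) > 1" by (rule prime_card, rule padic_CARD_gt_1)
  obtain r where r: "padic_abs (z - padic_of_rat r) < 1" using padic_of_rat_dense[of 1 z] by auto
  have "padic_abs (padic_of_rat r :: 'p padic) \<le> 1"
    using padic_abs_diff_le[OF z less_imp_le[OF r]] by simp
  hence r1: "rat_padic_abs CARD('p) r \<le> 1" by (simp add: padic_abs_of_rat)
  obtain n m where nm: "quotient_of r = (n, m)" by fastforce
  have m: "m > 0" "coprime n m" and rnm: "r = of_int n / of_int m"
    using quotient_of_denom_pos[OF nm] quotient_of_coprime[OF nm] quotient_of_div[OF nm] by auto
  have ndvd: "\<not> int CARD('p) dvd m"
  proof
    assume d: "int CARD('p) dvd m"
    hence nn: "\<not> int CARD('p) dvd n" using m p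
      by (metis coprime_common_divisor not_prime_unit prime_nat_int_transfer)
    hence n0: "n \<noteq> 0" by auto
    have "multiplicity (int CARD('p)) m > 0"
      using d m p by (subst prime_multiplicity_gt_zero_iff) auto
    moreover have "multiplicity (int CARD('p)) n = 0" using nn by (rule not_dvd_imp_multiplicity_0)
    ultimately have "rat_padic_abs CARD('p) r > 1"
      unfolding rnm using n0 m p1 by (subst rat_padic_abs_divide[OF p]) (auto simp: one_less_power)
    thus False using r1 by simp
  qed
  hence cop: "coprime m (int CARD('p))" using p
    by (metis coprime_commute prime_imp_coprime prime_nat_int_transfer)
  obtain u where u: "[m * u = 1] (mod int CARD('p))" using cong_solve_coprime_int[OF cop] by blast
  define d where "d = nat ((n * u) mod int CARD('p))"
  have d: "d < CARD('p)" and di: "int d = (n * u) mod int CARD('p)"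
    using p1 by (auto simp: d_def nat_less_iff)
  have "[int d * m = n * u * m] (mod int CARD('p))" unfolding di by (simp add: cong_def mod_mult_left_eq)
  also have "n * u * m = n * (m * u)" by simp
  also have "[n * (m * u) = n * 1] (mod int CARD('p))" by (intro cong_mult u) simp
  finally have "int CARD('p) dvd n - int d * m"
    by (simp add: cong_iff_dvd_diff dvd_diff_commute)
  hence "padic_abs (of_int (n - int d * m) :: 'p padic) < 1"
    unfolding padic_abs_of_int_less_1_iff .
  moreover have "padic_abs (of_int m :: 'p padic) = 1"
    using ndvd padic_abs_of_int_le_1[of m, where 'a='p] by (metis less_eq_real_def padic_abs_of_int_less_1_iff)
  moreover have "padic_of_rat r - of_nat d = (of_int (n - int d * m) / of_int m :: 'p padic)"
  proof -
    have "padic_of_rat r * of_int m = (of_int n :: 'p padic)"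
      using m by (simp add: rnm flip: padic_of_rat_of_int padic_of_rat_mult)
    thus ?thesis using m by (simp add: field_simps)
  qed
  ultimately have "padic_abs (padic_of_rat r - of_nat d :: 'p padic) < 1"
    by (simp add: divide_inverse padic_abs_mult padic_abs_inverse)
  with r have "padic_abs (z - of_nat d) < 1"
    using padic_abs_ultra[of "z - padic_of_rat r" "padic_of_rat r - of_nat d"] by simp
  hence "padic_abs (z - of_nat d) \<le> 1 / real CARD('p)"
  proof (cases "z - of_nat d = 0")
    case False
    then obtain k where k: "padic_abs (z - of_nat d) = real CARD('p) powi k" by (rule padic_abs_value)
    with \<open>padic_abs (z - of_nat d) < 1\<close> p1 have "k < 0"
      by (metis linorder_not_le one_le_power_int less_eq_real_def)
    hence "real CARD('p) powi k \<le> real CARD('p) powi (-1)" using p1 by (intro power_int_increasing) auto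
    thus ?thesis using k by (simp add: power_int_minus inverse_eq_divide)
  qed auto
  hence "padic_abs (z - of_nat d) * real CARD('p) \<le> 1"
    using p1 by (simp only: pos_le_divide_eq)
  hence "padic_abs ((z - of_nat d) / of_nat CARD('p)) \<le> 1"
    by (simp only: divide_inverse padic_abs_mult padic_abs_inverse padic_abs_p) simp
  thus ?thesis using d by blast
qed

lemma padic_expansionI:
  fixes x :: "'p::prime_card padic"
  assumes a: "\<And>k. a k < CARD('p)" and N: "\<And>k. k < N \<Longrightarrow> a k = 0"
    and x: "\<And>j::nat. padic_abs (x - (\<Sum>k\<in>{N..<N + int j}. of_nat (a k) * of_nat CARD('p) powi k))
              \<le> real CARD('p) powi (- (N + int j))"
  shows "padic_expansion x a"
proof -
  let ?p = "of_nat CARD('p) :: 'p padic"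
  have p1: "real CARD('p) > 1" by (rule padic_CARD_gt_1)
  let ?f = "\<lambda>k. of_nat (a k) * ?p powi k"
  have "(?f has_sum x) UNIV" unfolding has_sum_def
  proof (rule tendstoI)
    fix e :: real assume e: "e > 0"
    obtain j :: nat where j: "real CARD('p) powi (- N) / e < real CARD('p) ^ j"
      using real_arch_pow[OF p1] by blast
    hence je: "real CARD('p) powi (- (N + int j)) < e"
      using e p1 by (simp add: power_int_diff field_simps)
    have "dist (sum ?f F) x < e" if F: "finite F" "{N..<N + int j} \<subseteq> F" for F
    proof -
      let ?c = "real CARD('p) powi (- (N + int j))"
      have "padic_abs (sum ?f (F - {N..<N + int j})) \<le> ?c"
      proof (rule padic_abs_sum_le)
        fix k assume k: "k \<in> F - {N..<N + int j}"
        show "padic_abs (?f k) \<le> ?c"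
        proof (cases "k < N")
          case False
          have "padic_abs (?f k) \<le> real CARD('p) powi (- k)" by (rule padic_abs_digit_term)
          also have "\<dots> \<le> ?c" using False k p1 by (intro power_int_increasing) auto
          finally show ?thesis .
        qed (use p1 in \<open>simp add: N\<close>)
      qed (use p1 in simp)
      from padic_abs_diff_le[OF this x[of j]]
      have "padic_abs (sum ?f (F - {N..<N + int j}) - (x - sum ?f {N..<N + int j})) \<le> ?c" .
      moreover have "sum ?f (F - {N..<N + int j}) - (x - sum ?f {N..<N + int j}) = sum ?f F - x"
        using sum.subset_diff[OF F(2,1), of ?f] by simp
      ultimately show ?thesis using je by (simp only: dist_padic_def)
    qed
    thus "\<forall>\<^sub>F F in finite_subsets_at_top UNIV. dist (sum ?f F) x < e"
      unfolding eventually_finite_subsets_at_top by (intro exI[of _ "{N..<N + int j}"]) auto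
  qed
  moreover have "\<exists>N. \<forall>k<N. a k = 0" by (rule exI[of _ N]) (simp add: N)
  ultimately show ?thesis unfolding padic_expansion_def using a by (intro conjI allI)
qed

lemma padic_expansion_exists:
  fixes x :: "'p::prime_card padic"
  shows "\<exists>a. padic_expansion x a"
proof -
  let ?p = "of_nat CARD('p) :: 'p padic"
  have p1: "real CARD('p) > 1" by (rule padic_CARD_gt_1)
  obtain L :: nat where L: "padic_abs x \<le> real CARD('p) ^ L"
    using real_arch_pow[OF p1, of "padic_abs x"] by (auto intro: less_imp_le)
  obtain d where d: "\<And>z :: 'p padic. padic_abs z \<le> 1 \<Longrightarrow>
      d z < CARD('p) \<and> padic_abs ((z - of_nat (d z)) / ?p) \<le> 1"
    using padic_digit_step[where 'p='p] by metis
  define z where "z = rec_nat (?p ^ L * x) (\<lambda>_ z. (z - of_nat (d z)) / ?p)"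
  have z0: "z 0 = ?p ^ L * x" and zS: "z (Suc j) = (z j - of_nat (d (z j))) / ?p" for j
    by (simp_all add: z_def)
  have z1: "padic_abs (z j) \<le> 1" for j
  proof (induction j)
    case 0
    show ?case unfolding z0 padic_abs_mult padic_abs_power padic_abs_p
      using L p1 by (simp add: power_divide field_simps)
  qed (simp add: zS d)
  define a where "a = (\<lambda>k::int. if k < - int L then 0 else d (z (nat (k + int L))))"
  let ?f = "\<lambda>k. of_nat (a k) * ?p powi k"
  have partial: "x = sum ?f {- int L..<int j - int L} + ?p powi (int j - int L) * z j" for j
  proof (induction j)
    case 0
    show ?case by (simp add: z0 power_int_minus field_simps)
  next
    case (Suc j)
    let ?P = "?p powi (int j - int L)"
    have I: "{- int L..<int (Suc j) - int L} = insert (int j - int L) {- int L..<int j - int L}" by auto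
    have P: "?p powi (int (Suc j) - int L) = ?P * ?p"
      using power_int_add_1[of ?p "int j - int L"] by (simp add: algebra_simps)
    have a: "a (int j - int L) = d (z j)" by (simp add: a_def)
    have "?P * z j = ?P * (of_nat (d (z j)) + ?p * z (Suc j))" by (simp add: zS)
    also have "\<dots> = of_nat (d (z j)) * ?P + ?P * ?p * z (Suc j)" by (simp add: algebra_simps)
    finally have Z: "?P * z j = of_nat (d (z j)) * ?P + ?P * ?p * z (Suc j)" .
    have "x = sum ?f {- int L..<int j - int L} + ?P * z j" by (rule Suc.IH)
    also have "\<dots> = sum ?f {- int L..<int (Suc j) - int L} + ?P * ?p * z (Suc j)"
      unfolding Z I by (subst sum.insert) (simp_all add: a)
    finally show ?case unfolding P .
  qed
  have "padic_expansion x a"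
  proof (rule padic_expansionI)
    show "a k < CARD('p)" for k using d[OF z1] p1 by (simp add: a_def)
    show "a k = 0" if "k < - int L" for k using that by (simp add: a_def)
    fix j :: nat
    let ?c = "real CARD('p) powi (- (- int L + int j))"
    have "padic_abs (?p powi (int j - int L) * z j) \<le> ?c"
      unfolding padic_abs_mult padic_abs_p_powi
      using mult_left_mono[OF z1[of j], of ?c] p1 by simp
    moreover have "x - sum ?f {- int L..<- int L + int j} = ?p powi (int j - int L) * z j"
      using partial[of j] by (simp add: algebra_simps)
    ultimately show "padic_abs (x - sum ?f {- int L..<- int L + int j}) \<le> ?c" by (simp only:)
  qed
  show ?thesis by (rule exI[of _ a]) fact
qed

lemma padic_expansion_ex1:
  fixes x :: "'p::prime_card padic"
  shows "\<exists>!a. padic_expansion x a"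
proof (rule ex_ex1I[OF padic_expansion_exists])
  fix a b assume ab: "padic_expansion x a" "padic_expansion x b"
  have "a k = b k" for k
  proof (rule padic_expansion_agree[OF ab])
    show "padic_abs (x - x) \<le> real CARD('p) powi (- (k + 1))"
      unfolding diff_self padic_abs_0 by (rule zero_le_power_int) simp
    show "k < k + 1" by simp
  qed
  thus "a = b" by (rule ext)
qed

definition padic_digit :: "'p::prime_card padic \<Rightarrow> int \<Rightarrow> nat" where
  "padic_digit x = (THE a. padic_expansion x a)"

lemma padic_digit_expansion: "padic_expansion x (padic_digit x)"
  unfolding padic_digit_def by (rule theI'[OF padic_expansion_ex1])

lemma padic_digit_cong:
  fixes x y :: "'p::prime_card padic"
  assumes "padic_abs (x - y) \<le> real CARD('p) powi (- m)" "k < m"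
  shows "padic_digit x k = padic_digit y k"
  by (rule padic_expansion_agree[OF padic_digit_expansion padic_digit_expansion assms])

section \<open>Completeness and Haar measure\<close>

instance padic :: (prime_card) complete_space
proof
  fix X :: "nat \<Rightarrow> 'a padic"
  assume X: "Cauchy X"
  have "\<exists>r. padic_abs (X n - padic_of_rat r) < 1 / real (Suc n)" for n
    using padic_of_rat_dense[of "1 / real (Suc n)" "X n"] by auto
  then obtain r where r: "\<And>n. padic_abs (X n - padic_of_rat (r n)) < 1 / real (Suc n)" by metis
  have small: "\<exists>M. \<forall>n\<ge>M. padic_abs (X n - padic_of_rat (r n)) < e" if epos: "e > 0" for e
  proof -
    obtain M where M: "1 / real (Suc M) < e" using reals_Archimedean[OF epos] by (auto simp: inverse_eq_divide)
    have "padic_abs (X n - padic_of_rat (r n)) < e" if "n \<ge> M" for n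
      using r[of n] M frac_le[of 1 1 "real (Suc M)" "real (Suc n)"] that by simp
    thus ?thesis by blast
  qed
  have cauchy: "\<exists>M. \<forall>m\<ge>M. \<forall>n\<ge>M. padic_abs (padic_of_rat (r m) - padic_of_rat (r n) :: 'a padic) \<le> e" if e: "e > 0" for e
  proof -
    obtain M where M: "\<And>n. n \<ge> M \<Longrightarrow> padic_abs (X n - padic_of_rat (r n)) < e" using small[OF e] by blast
    obtain L where L: "\<And>m n. m \<ge> L \<Longrightarrow> n \<ge> L \<Longrightarrow> dist (X m) (X n) < e" using X e unfolding Cauchy_def by blast
    have "padic_abs (padic_of_rat (r m) - padic_of_rat (r n) :: 'a padic) \<le> e" if "m \<ge> max M L" "n \<ge> max M L" for m n
    proof -
      have "padic_abs ((X m - X n) - (X m - padic_of_rat (r m)) + (X n - padic_of_rat (r n))) \<le> e"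
        using M[of m] M[of n] L[of m n] that
        by (intro padic_abs_add_le[OF padic_abs_diff_le]) (simp_all add: dist_padic_def)
      thus ?thesis by (simp add: algebra_simps)
    qed
    thus ?thesis by blast
  qed
  have rc: "padic_cauchy CARD('a) r" unfolding padic_cauchy_def
  proof (intro allI impI)
    fix e :: real assume e: "e > 0"
    obtain M where M: "\<And>m n. m \<ge> M \<Longrightarrow> n \<ge> M \<Longrightarrow> padic_abs (padic_of_rat (r m) - padic_of_rat (r n) :: 'a padic) \<le> e / 2"
      using cauchy[OF half_gt_zero[OF e]] by blast
    have "rat_padic_abs CARD('a) (r m - r n) < e" if "m \<ge> M" "n \<ge> M" for m n
      using M[OF that] e by (simp flip: padic_of_rat_diff add: padic_abs_of_rat)
    thus "\<exists>M. \<forall>m\<ge>M. \<forall>n\<ge>M. rat_padic_abs CARD('a) (r m - r n) < e" by blast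
  qed
  define x where "x = (abs_padic r :: 'a padic)"
  have crx: "cr_padic r x" using rc by (simp add: cr_padic_def x_def padic_rel_def prime_card)
  have lim: "\<exists>M. \<forall>n\<ge>M. padic_abs (x - padic_of_rat (r n)) \<le> e" if e: "e > 0" for e
  proof -
    obtain M where M: "\<And>m n. m \<ge> M \<Longrightarrow> n \<ge> M \<Longrightarrow> padic_abs (padic_of_rat (r m) - padic_of_rat (r n) :: 'a padic) \<le> e"
      using cauchy[OF e] by blast
    have "padic_abs (x - padic_of_rat (r n)) \<le> e" if n: "n \<ge> M" for n
    proof -
      let ?Y = "\<lambda>_::nat. r n"
      have Y: "padic_rel CARD('a) r r" "padic_rel CARD('a) ?Y ?Y"
        using rc by (simp_all add: padic_rel_def prime_card padic_null_0[simplified])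
      have "padic_abs (x - padic_of_rat (r n)) = lim (\<lambda>m. rat_padic_abs CARD('a) (r m - r n))"
        unfolding x_def padic_of_rat_def map_fun_def
        by (simp add: minus_padic.abs_eq[OF Y] padic_abs.abs_eq[OF padic_rel_diff[OF prime_card Y]])
      also have "\<dots> \<le> e"
        by (rule LIMSEQ_le_const2[OF padic_abs_LIMSEQ[OF padic_rel_diff[OF prime_card Y]]])
          (use M[OF _ n] in \<open>auto intro!: exI[of _ M] simp flip: padic_of_rat_diff simp: padic_abs_of_rat\<close>)
      finally show ?thesis .
    qed
    thus ?thesis by blast
  qed
  have "X \<longlonglongrightarrow> x"
  proof (rule metric_LIMSEQ_I)
    fix e :: real assume e: "e > 0"
    obtain M where M: "\<And>n. n \<ge> M \<Longrightarrow> padic_abs (X n - padic_of_rat (r n)) < e / 2" using small[of "e / 2"] e by auto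
    obtain L where L: "\<And>n. n \<ge> L \<Longrightarrow> padic_abs (x - padic_of_rat (r n)) \<le> e / 2" using lim[of "e / 2"] e by auto
    have "dist (X n) x < e" if "n \<ge> max M L" for n
    proof -
      have "padic_abs ((X n - padic_of_rat (r n)) - (x - padic_of_rat (r n))) \<le> e / 2"
        by (rule padic_abs_diff_le) (use M[of n] L[of n] that in simp_all)
      thus ?thesis using e by (simp add: dist_padic_def)
    qed
    thus "\<exists>no. \<forall>n\<ge>no. dist (X n) x < e" by blast
  qed
  thus "convergent X" by (rule convergentI)
qed

definition padic_cball :: "int \<Rightarrow> 'p::prime_card padic \<Rightarrow> 'p padic set" where
  "padic_cball k x = {y. padic_abs (y - x) \<le> real CARD('p) powi k}"

lemma padic_powi_pos: "real CARD('p::prime_card) powi k > 0"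
  using padic_CARD_gt_1[where 'p='p] by simp

lemma padic_powi_le_iff: "real CARD('p::prime_card) powi k \<le> real CARD('p) powi l \<longleftrightarrow> k \<le> l"
proof
  assume "real CARD('p) powi k \<le> real CARD('p) powi l"
  thus "k \<le> l"
    using power_int_strict_increasing[of l k "real CARD('p)"] padic_CARD_gt_1[where 'p='p]
    by (meson linorder_not_le)
next
  assume "k \<le> l"
  thus "real CARD('p) powi k \<le> real CARD('p) powi l"
    using padic_CARD_gt_1[where 'p='p] by (intro power_int_increasing) auto
qed

lemma padic_powi_lt: "e > 0 \<Longrightarrow> \<exists>k. real CARD('p::prime_card) powi k < e"
proof -
  assume e: "e > 0"
  obtain j where "1 / e < real CARD('p) ^ j" using real_arch_pow[OF padic_CARD_gt_1[where 'p='p]] by blast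
  hence "real CARD('p) powi (- int j) < e"
    using e padic_CARD_gt_1[where 'p='p] by (simp add: power_int_minus field_simps)
  thus ?thesis by blast
qed

lemma padic_cball_self [simp]: "x \<in> padic_cball k x"
  using padic_powi_pos[where 'p='a] by (simp add: padic_cball_def less_imp_le)

lemma padic_cball_mono:
  assumes "z \<in> padic_cball k x" "z \<in> padic_cball l y" "k \<le> l"
  shows "padic_cball k x \<subseteq> padic_cball l (y :: 'p::prime_card padic)"
proof
  fix w assume w: "w \<in> padic_cball k x"
  have 1: "real CARD('p) powi k \<le> real CARD('p) powi l" using assms(3) by (simp add: padic_powi_le_iff)
  have "padic_abs ((w - x) - (z - x) + (z - y)) \<le> real CARD('p) powi l"
    using w assms(1,2) by (intro padic_abs_add_le[OF order_trans[OF padic_abs_diff_le 1]])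
      (simp_all add: padic_cball_def)
  thus "w \<in> padic_cball l y" by (simp add: padic_cball_def)
qed

lemma padic_open_cball [simp]: "open (padic_cball k x :: 'p::prime_card padic set)"
proof (rule openI)
  fix y assume y: "y \<in> padic_cball k x"
  have "ball y (real CARD('p) powi k) \<subseteq> padic_cball k y"
    by (auto simp: padic_cball_def dist_padic_def padic_abs_diff_commute)
  also have "\<dots> \<subseteq> padic_cball k x" by (rule padic_cball_mono[of y]) (use y in auto)
  finally show "\<exists>e>0. ball y e \<subseteq> padic_cball k x" using padic_powi_pos[where 'p='p] by blast
qed

lemma padic_open_ex_cball:
  fixes x :: "'p::prime_card padic"
  assumes U: "open U" and x: "x \<in> U"
  obtains k r where "x \<in> padic_cball k (padic_of_rat r)" "padic_cball k (padic_of_rat r) \<subseteq> U"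
proof -
  obtain e where e: "e > 0" "ball x e \<subseteq> U" using U x by (rule openE)
  obtain k where k: "real CARD('p) powi k < e" using padic_powi_lt[OF e(1)] by blast
  obtain r where r: "padic_abs (x - padic_of_rat r) < real CARD('p) powi k"
    using padic_of_rat_dense[OF padic_powi_pos] by blast
  have xr: "x \<in> padic_cball k (padic_of_rat r)" using r by (simp add: padic_cball_def)
  have "padic_cball k (padic_of_rat r) \<subseteq> padic_cball k x" by (rule padic_cball_mono[OF xr]) auto
  also have "\<dots> \<subseteq> ball x e" using k by (auto simp: padic_cball_def dist_padic_def padic_abs_diff_commute)
  finally show ?thesis using that[OF xr] e(2) by blast
qed

instance padic :: (prime_card) second_countable_topology
proof
  define B where "B = (\<lambda>(k, r). padic_cball k (padic_of_rat r :: 'a padic)) ` (UNIV :: (int \<times> rat) set)"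
  have "countable B" unfolding B_def by simp
  moreover have "topological_basis B"
  proof (rule topological_basisI)
    show "open U" if "U \<in> B" for U using that by (auto simp: B_def)
    fix U :: "'a padic set" and x assume "open U" "x \<in> U"
    then obtain k r where "x \<in> padic_cball k (padic_of_rat r)" "padic_cball k (padic_of_rat r) \<subseteq> U"
      by (rule padic_open_ex_cball)
    thus "\<exists>B'\<in>B. x \<in> B' \<and> B' \<subseteq> U" unfolding B_def by (intro bexI[of _ "padic_cball k (padic_of_rat r)"]) auto
  qed
  ultimately show "\<exists>B::'a padic set set. countable B \<and> open = generate_topology B"
    using topological_basis_imp_subbasis by blast
qed

instance padic :: (prime_card) polish_space ..

definition padic_balls :: "'p::prime_card padic set set" where
  "padic_balls = insert {} (range (\<lambda>(k, x). padic_cball k x))"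

lemma padic_balls_Int_stable: "Int_stable padic_balls"
proof (rule Int_stableI)
  fix A B :: "'a padic set" assume A: "A \<in> padic_balls" and B: "B \<in> padic_balls"
  show "A \<inter> B \<in> padic_balls"
  proof (cases "A \<inter> B = {}")
    case False
    then obtain z where z: "z \<in> A" "z \<in> B" by blast
    obtain k x where kx: "A = padic_cball k x" using A z by (auto simp: padic_balls_def)
    obtain l y where ly: "B = padic_cball l y" using B z by (auto simp: padic_balls_def)
    have "A \<subseteq> B \<or> B \<subseteq> A"
      using padic_cball_mono[of z k x l y] padic_cball_mono[of z l y k x] z kx ly by (cases "k \<le> l") auto
    thus ?thesis using A B by (metis inf.absorb1 inf.absorb2)
  qed (simp add: padic_balls_def)
qed

lemma padic_sets_borel: "sets (borel :: 'p::prime_card padic measure) = sigma_sets UNIV padic_balls"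
proof
  have "padic_balls \<subseteq> sets (borel :: 'p padic measure)" by (auto simp: padic_balls_def)
  from sets.sigma_sets_subset[OF this, unfolded space_borel]
  show "sigma_sets UNIV padic_balls \<subseteq> sets (borel :: 'p padic measure)" .
  have "U \<in> sigma_sets UNIV padic_balls" if U: "open U" for U :: "'p padic set"
  proof -
    define I where "I = {(k::int, r). padic_cball k (padic_of_rat r :: 'p padic) \<subseteq> U}"
    have "U = (\<Union>(k, r)\<in>I. padic_cball k (padic_of_rat r))"
    proof
      show "U \<subseteq> (\<Union>(k, r)\<in>I. padic_cball k (padic_of_rat r))"
      proof
        fix x assume "x \<in> U"
        with U obtain k r where "x \<in> padic_cball k (padic_of_rat r)" "padic_cball k (padic_of_rat r) \<subseteq> U"
          by (rule padic_open_ex_cball)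
        thus "x \<in> (\<Union>(k, r)\<in>I. padic_cball k (padic_of_rat r))" by (auto simp: I_def)
      qed
    qed (auto simp: I_def)
    moreover have "(\<Union>(k, r)\<in>I. padic_cball k (padic_of_rat r :: 'p padic)) \<in> sigma_sets UNIV padic_balls"
      by (rule sigma_sets_UNION) (auto simp: padic_balls_def intro!: sigma_sets.Basic)
    ultimately show ?thesis by simp
  qed
  thus "sets (borel :: 'p padic measure) \<subseteq> sigma_sets UNIV padic_balls"
    unfolding sets_borel by (intro sigma_sets_mono) auto
qed

lemma padic_measure_eqI:
  fixes \<mu> \<nu> :: "'p::prime_card padic measure"
  assumes s: "sets \<mu> = sets borel" "sets \<nu> = sets borel"
    and e: "\<And>k x. emeasure \<mu> (padic_cball k x) = ennreal (real CARD('p) powi k)"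
      "\<And>k x. emeasure \<nu> (padic_cball k x) = ennreal (real CARD('p) powi k)"
  shows "\<mu> = \<nu>"
proof (rule measure_eqI_generator_eq[where E = padic_balls and \<Omega> = UNIV and A = "\<lambda>n. padic_cball (int n) 0"])
  show "emeasure \<mu> X = emeasure \<nu> X" if "X \<in> padic_balls" for X
    using that e by (auto simp: padic_balls_def)
  show "(\<Union>n. padic_cball (int n) (0 :: 'p padic)) = UNIV"
  proof -
    have "\<exists>n. x \<in> padic_cball (int n) 0" for x :: "'p padic"
      using real_arch_pow[OF padic_CARD_gt_1[where 'p='p], of "padic_abs x"]
      by (auto simp: padic_cball_def intro: less_imp_le)
    thus ?thesis by auto
  qed
qed (auto simp: padic_balls_Int_stable s padic_sets_borel e, auto simp: padic_balls_def)

lemma padic_expansion_of_digits: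
  assumes a: "\<And>k. a k < CARD('p::prime_card)" and N: "\<And>k. k < N \<Longrightarrow> a k = 0"
  shows "\<exists>x :: 'p padic. padic_expansion x a"
proof -
  let ?f = "\<lambda>k. of_nat (a k) * of_nat CARD('p) powi k :: 'p padic"
  define s where "s = (\<lambda>n::nat. sum ?f {N..<N + int n})"
  have d: "padic_abs (s n - s m) \<le> real CARD('p) powi (- (N + int m))" if "m \<le> n" for m n
  proof -
    have "{N..<N + int n} = {N..<N + int m} \<union> {N + int m..<N + int n}" using that by auto
    hence "s n = s m + sum ?f {N + int m..<N + int n}"
      unfolding s_def by (simp add: sum.union_disjoint ivl_disj_int)
    hence "s n - s m = sum ?f {N + int m..<N + int n}" by simp
    moreover have "padic_abs (sum ?f {N + int m..<N + int n}) \<le> real CARD('p) powi (- (N + int m))"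
    proof (rule padic_abs_sum_le)
      fix k assume "k \<in> {N + int m..<N + int n}"
      hence "real CARD('p) powi (- k) \<le> real CARD('p) powi (- (N + int m))" by (simp add: padic_powi_le_iff)
      with padic_abs_digit_term show "padic_abs (?f k) \<le> real CARD('p) powi (- (N + int m))" by (rule order_trans)
    qed (use padic_powi_pos in \<open>rule less_imp_le\<close>)
    ultimately show ?thesis by simp
  qed
  have "Cauchy s"
  proof (rule metric_CauchyI)
    fix e :: real assume "e > 0"
    then obtain k where k: "real CARD('p) powi k < e" using padic_powi_lt by blast
    define M where "M = nat (- N - k)"
    have Mk: "real CARD('p) powi (- (N + int M)) \<le> real CARD('p) powi k"
      unfolding padic_powi_le_iff by (simp add: M_def)
    have "dist (s m) (s n) < e" if "m \<ge> M" "n \<ge> M" for m n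
    proof -
      have "padic_abs ((s m - s M) - (s n - s M)) \<le> real CARD('p) powi (- (N + int M))"
        by (rule padic_abs_diff_le[OF d[OF that(1)] d[OF that(2)]])
      thus ?thesis using Mk k by (simp add: dist_padic_def)
    qed
    thus "\<exists>M. \<forall>m\<ge>M. \<forall>n\<ge>M. dist (s m) (s n) < e" by blast
  qed
  then obtain x where x: "s \<longlonglongrightarrow> x" using Cauchy_convergent convergent_def by blast
  have "padic_expansion x a"
  proof (rule padic_expansionI[OF a N])
    fix j :: nat
    let ?c = "real CARD('p) powi (- (N + int j))"
    obtain M where M: "\<And>n. n \<ge> M \<Longrightarrow> dist (s n) x < ?c"
      using metric_LIMSEQ_D[OF x padic_powi_pos] by blast
    have "padic_abs (s (max M j) - x) \<le> ?c" using M[of "max M j"] by (simp add: dist_padic_def)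
    hence "padic_abs ((s (max M j) - s j) - (s (max M j) - x)) \<le> ?c"
      by (intro padic_abs_diff_le[OF d]) simp_all
    thus "padic_abs (x - sum ?f {N..<N + int j}) \<le> ?c" by (simp add: s_def)
  qed
  thus ?thesis by (rule exI[of _ x])
qed

lemma padic_digit_lt: "padic_digit x k < CARD('p)" for x :: "'p::prime_card padic"
  using padic_digit_expansion[of x] by (simp add: padic_expansion_def)

lemma padic_digit_eventually_0: "\<exists>N. \<forall>k<N. padic_digit x k = 0"
  using padic_digit_expansion[of x] by (simp add: padic_expansion_def)

lemma padic_abs_le_iff_digits:
  fixes x y :: "'p::prime_card padic"
  shows "padic_abs (x - y) \<le> real CARD('p) powi (- m) \<longleftrightarrow> (\<forall>k<m. padic_digit x k = padic_digit y k)"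
proof
  assume eq: "\<forall>k<m. padic_digit x k = padic_digit y k"
  obtain Nx where Nx: "\<And>k. k < Nx \<Longrightarrow> padic_digit x k = 0" using padic_digit_eventually_0 by blast
  obtain Ny where Ny: "\<And>k. k < Ny \<Longrightarrow> padic_digit y k = 0" using padic_digit_eventually_0 by blast
  define N where "N = min Nx Ny"
  let ?T = "\<lambda>x. \<Sum>k\<in>{N..<m}. of_nat (padic_digit x k) * of_nat CARD('p) powi k :: 'p padic"
  have "padic_abs (x - ?T x) \<le> real CARD('p) powi (- m)"
    by (rule padic_expansion_truncate[OF padic_digit_expansion]) (simp add: N_def Nx)
  moreover have "padic_abs (y - ?T y) \<le> real CARD('p) powi (- m)"
    by (rule padic_expansion_truncate[OF padic_digit_expansion]) (simp add: N_def Ny)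
  moreover have "?T x = ?T y" by (rule sum.cong) (simp_all add: eq)
  ultimately show "padic_abs (x - y) \<le> real CARD('p) powi (- m)"
    using padic_abs_diff_le[of "x - ?T x" _ "y - ?T y"] by simp
qed (use padic_digit_cong in blast)

text \<open>
  Haar measure is the image of Lebesgue measure on the half-line under the map that sends a real
  number with base-\<open>p\<close> expansion \<open>\<Sum>k. c\<^sub>k * p powi (-k-1)\<close> to the \<open>p\<close>-adic number with digits \<open>c\<^sub>k\<close>.
\<close>

definition real_digit :: "nat \<Rightarrow> real \<Rightarrow> int \<Rightarrow> nat" where
  "real_digit p t k = nat (\<lfloor>t * real p powi (k + 1)\<rfloor> mod int p)"

definition padic_monna :: "real \<Rightarrow> 'p::prime_card padic" where
  "padic_monna t = (THE x. padic_expansion x (real_digit CARD('p) t))"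

lemma real_digit_eventually_0:
  assumes p: "real p > 1" and t: "t \<ge> 0" "t * real p powi N < 1" and k: "k < N"
  shows "real_digit p t k = 0"
proof -
  have "real p powi (k + 1) \<le> real p powi N" using p k by (intro power_int_increasing) auto
  hence "t * real p powi (k + 1) < 1" using t by (meson mult_left_mono order_le_less_trans)
  moreover have "t * real p powi (k + 1) \<ge> 0" using t by simp
  ultimately have "\<lfloor>t * real p powi (k + 1)\<rfloor> = 0" by linarith
  thus ?thesis by (simp add: real_digit_def)
qed

lemma real_digit_small:
  assumes p: "real p > 1"
  obtains N where "N \<le> m" "t * real p powi N < 1"
proof -
  obtain j where j: "max t 1 * real p powi m < real p ^ j" using real_arch_pow[OF p] by blast
  have "t * real p powi m \<le> max t 1 * real p powi m" using p by (intro mult_right_mono) auto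
  also note j
  finally have "t * real p powi (m - int j) < 1" using p by (simp add: power_int_diff field_simps)
  thus ?thesis using that[of "m - int j"] by simp
qed

lemma padic_monna_expansion:
  assumes "t \<ge> 0"
  shows "padic_expansion (padic_monna t :: 'p::prime_card padic) (real_digit CARD('p) t)"
proof -
  have p: "real CARD('p) > 1" by (rule padic_CARD_gt_1)
  obtain N where N: "t * real CARD('p) powi N < 1" using real_digit_small[OF p, of 0 t] by blast
  have "\<exists>x :: 'p padic. padic_expansion x (real_digit CARD('p) t)"
  proof (rule padic_expansion_of_digits)
    show "real_digit CARD('p) t k < CARD('p)" for k
      using p by (simp add: real_digit_def nat_less_iff)
    show "real_digit CARD('p) t k = 0" if "k < N" for k by (rule real_digit_eventually_0[OF p assms N that])
  qed
  moreover have "x = y" if "padic_expansion x (real_digit CARD('p) t)" "padic_expansion y (real_digit CARD('p) t)"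
    for x y :: "'p padic"
    using that unfolding padic_expansion_def by (meson has_sum_unique)
  ultimately have "\<exists>!x :: 'p padic. padic_expansion x (real_digit CARD('p) t)" by (intro ex_ex1I)
  thus ?thesis unfolding padic_monna_def by (rule theI')
qed

lemma padic_digit_monna:
  assumes "t \<ge> 0"
  shows "padic_digit (padic_monna t :: 'p::prime_card padic) = real_digit CARD('p) t"
  unfolding padic_digit_def
  by (rule the1_equality, rule padic_expansion_ex1, rule padic_monna_expansion[OF assms])

lemma real_digits_iff_floor:
  assumes p: "p > 1" and a: "\<And>k. a k < p" and N: "\<And>k. k < N \<Longrightarrow> a k = 0" and Nm: "N \<le> m"
  shows "\<exists>U\<ge>0. \<forall>t\<ge>0. (\<forall>k<m. real_digit p t k = a k) \<longleftrightarrow> \<lfloor>t * real p powi m\<rfloor> = U"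
  using Nm
proof (induction m rule: int_ge_induct)
  case base
  have p1: "real p > 1" using p by simp
  have "(\<forall>k<N. real_digit p t k = a k) \<longleftrightarrow> \<lfloor>t * real p powi N\<rfloor> = 0" if t: "t \<ge> 0" for t
  proof
    assume "\<lfloor>t * real p powi N\<rfloor> = 0"
    hence "t * real p powi N < 1" by linarith
    thus "\<forall>k<N. real_digit p t k = a k" using real_digit_eventually_0[OF p1 t] N by simp
  next
    assume eq: "\<forall>k<N. real_digit p t k = a k"
    define P where "P = (\<lambda>j::nat. t * real p powi (N - int j) < 1)"
    obtain M where M: "M \<le> N" "t * real p powi M < 1" using real_digit_small[OF p1] by blast
    hence "P (nat (N - M))" by (simp add: P_def)
    hence L: "P (LEAST j. P j)" by (rule LeastI)
    have "(LEAST j. P j) = 0"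
    proof (rule ccontr)
      assume "(LEAST j. P j) \<noteq> 0"
      then obtain i where i: "(LEAST j. P j) = Suc i" by (auto simp: gr0_conv_Suc)
      define k where "k = N - int (Suc i)"
      have ge: "\<not> P i" using not_less_Least[of i P] i by simp
      have lt: "t * real p powi k < 1" using L i by (simp add: P_def k_def)
      have k1: "k + 1 = N - int i" by (simp add: k_def)
      have b1: "t * real p powi (k + 1) \<ge> 1" using ge by (simp add: P_def k1)
      have "t * real p powi (k + 1) = t * real p powi k * real p" using p by (simp add: power_int_add_1)
      also have "\<dots> < real p" using lt p by simp
      finally have b2: "t * real p powi (k + 1) < real p" .
      define f where "f = \<lfloor>t * real p powi (k + 1)\<rfloor>"
      have "f \<ge> 1" "f < int p" using b1 b2 unfolding f_def by linarith+
      hence "real_digit p t k \<noteq> 0" by (simp add: real_digit_def flip: f_def)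
      moreover have "k < N" by (simp add: k_def)
      ultimately show False using eq N by simp
    qed
    with L have "t * real p powi N < 1" by (simp add: P_def)
    moreover have "t * real p powi N \<ge> 0" using t by simp
    ultimately show "\<lfloor>t * real p powi N\<rfloor> = 0" by linarith
  qed
  thus ?case by blast
next
  case (step m)
  then obtain U where U: "U \<ge> 0" "\<And>t. t \<ge> 0 \<Longrightarrow> (\<forall>k<m. real_digit p t k = a k) \<longleftrightarrow> \<lfloor>t * real p powi m\<rfloor> = U"
    by blast
  have "(\<forall>k<m + 1. real_digit p t k = a k) \<longleftrightarrow> \<lfloor>t * real p powi (m + 1)\<rfloor> = int p * U + int (a m)"
    if t: "t \<ge> 0" for t
  proof -
    define F where "F = \<lfloor>t * real p powi (m + 1)\<rfloor>"
    have "t * real p powi m = t * real p powi (m + 1) / real_of_int (int p)"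
      using p by (simp add: power_int_add_1)
    hence f: "\<lfloor>t * real p powi m\<rfloor> = F div int p"
      unfolding F_def by (simp only: floor_divide_real_eq_div[of "int p"])
    have "(\<forall>k<m + 1. real_digit p t k = a k) \<longleftrightarrow> (\<forall>k<m. real_digit p t k = a k) \<and> real_digit p t m = a m"
      unfolding zless_add1_eq by blast
    also have "\<dots> \<longleftrightarrow> F div int p = U \<and> F mod int p = int (a m)"
    proof -
      have "F mod int p \<ge> 0" using p by simp
      hence "nat (F mod int p) = a m \<longleftrightarrow> F mod int p = int (a m)" by auto
      thus ?thesis unfolding U(2)[OF t] f by (simp only: real_digit_def F_def[symmetric])
    qed
    also have "\<dots> \<longleftrightarrow> F = int p * U + int (a m)"
    proof
      assume "F div int p = U \<and> F mod int p = int (a m)"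
      thus "F = int p * U + int (a m)" using mult_div_mod_eq[of "int p" F] by simp
    next
      assume "F = int p * U + int (a m)"
      thus "F div int p = U \<and> F mod int p = int (a m)" using p a[of m] by simp
    qed
    finally show ?thesis by (simp add: F_def)
  qed
  thus ?case using U(1) by (intro exI[of _ "int p * U + int (a m)"]) auto
qed

lemma padic_monna_vimage_cball:
  fixes x :: "'p::prime_card padic"
  shows "\<exists>u. padic_monna -` padic_cball k x \<inter> {0..} = {u..<u + real CARD('p) powi k}"
proof -
  have p: "CARD('p) > 1" using padic_CARD_gt_1[where 'p='p] by simp
  obtain N where N: "\<And>k. k < N \<Longrightarrow> padic_digit x k = 0" using padic_digit_eventually_0 by blast
  have "\<exists>U\<ge>0. \<forall>t\<ge>0. (\<forall>j < - k. real_digit CARD('p) t j = padic_digit x j) \<longleftrightarrow>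
      \<lfloor>t * real CARD('p) powi (- k)\<rfloor> = U"
  proof (rule real_digits_iff_floor[OF p padic_digit_lt])
    show "padic_digit x j = 0" if "j < min N (- k)" for j using N that by simp
  qed simp
  then obtain U where U: "U \<ge> 0" "\<And>t. t \<ge> 0 \<Longrightarrow>
      (\<forall>j < - k. real_digit CARD('p) t j = padic_digit x j) \<longleftrightarrow> \<lfloor>t * real CARD('p) powi (- k)\<rfloor> = U"
    by blast
  let ?q = "real CARD('p) powi k"
  have q: "?q > 0" by (rule padic_powi_pos)
  have fl: "\<lfloor>t * real CARD('p) powi (- k)\<rfloor> = U \<longleftrightarrow> t \<in> {real_of_int U * ?q..<real_of_int U * ?q + ?q}" for t
    using q by (simp add: floor_eq_iff power_int_minus field_simps)
  have "t \<in> padic_monna -` padic_cball k x \<inter> {0..} \<longleftrightarrow> t \<in> {real_of_int U * ?q..<real_of_int U * ?q + ?q}" for t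
  proof (cases "t \<ge> 0")
    case True
    have "padic_monna t \<in> padic_cball k x \<longleftrightarrow> padic_abs (padic_monna t - x) \<le> real CARD('p) powi (- (- k))"
      by (simp add: padic_cball_def)
    also have "\<dots> \<longleftrightarrow> (\<forall>j < - k. real_digit CARD('p) t j = padic_digit x j)"
      unfolding padic_abs_le_iff_digits padic_digit_monna[OF True] ..
    finally show ?thesis using U(2)[OF True] fl[of t] True by simp
  next
    case False
    moreover have "real_of_int U * ?q \<ge> 0" using U(1) q by simp
    ultimately show ?thesis by auto
  qed
  thus ?thesis by blast
qed

definition padic_ints :: "'p::prime_card padic set" where
  "padic_ints = {x. padic_abs x \<le> 1}"

definition is_padic_haar :: "'p::prime_card padic measure \<Rightarrow> bool" where
  "is_padic_haar \<mu> \<longleftrightarrow> sets \<mu> = sets borel \<and>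
     (\<forall>x. \<forall>A\<in>sets borel. emeasure \<mu> ((+) x ` A) = emeasure \<mu> A) \<and>
     emeasure \<mu> padic_ints = 1"

lemma padic_ints_cball: "padic_ints = padic_cball 0 0"
  by (simp add: padic_ints_def padic_cball_def)

lemma padic_cball_translate: "(+) x ` padic_cball k y = padic_cball k (x + y)"
proof -
  have "z \<in> padic_cball k (x + y) \<Longrightarrow> z \<in> (+) x ` padic_cball k y" for z
    by (rule image_eqI[of _ _ "z - x"]) (simp_all add: padic_cball_def algebra_simps)
  moreover have "(+) x ` padic_cball k y \<subseteq> padic_cball k (x + y)" by (auto simp: padic_cball_def)
  ultimately show ?thesis by blast
qed

lemma padic_haar_exists: "\<exists>\<mu> :: 'p::prime_card padic measure. is_padic_haar \<mu>"
proof -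
  let ?L = "restrict_space lborel {0::real..}"
  define \<mu> where "\<mu> = distr ?L borel (padic_monna :: real \<Rightarrow> 'p padic)"
  have meas: "(padic_monna :: real \<Rightarrow> 'p padic) \<in> measurable ?L borel"
  proof (rule measurable_sigma_sets[OF padic_sets_borel])
    fix A :: "'p padic set" assume A: "A \<in> padic_balls"
    show "padic_monna -` A \<inter> space ?L \<in> sets ?L"
    proof (cases "A = {}")
      case False
      then obtain k x where A: "A = padic_cball k x" using A by (auto simp: padic_balls_def)
      obtain u where u: "padic_monna -` A \<inter> {0..} = {u..<u + real CARD('p) powi k}"
        using padic_monna_vimage_cball[of k x] A by blast
      hence "{u..<u + real CARD('p) powi k} \<subseteq> {0..}" by blast
      thus ?thesis using u by (simp add: space_restrict_space sets_restrict_space_iff)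
    qed simp
  qed auto
  have s: "sets \<mu> = sets borel" by (simp add: \<mu>_def)
  have ball: "emeasure \<mu> (padic_cball k x) = ennreal (real CARD('p) powi k)" for k x
  proof -
    obtain u where u: "padic_monna -` padic_cball k x \<inter> {0..} = {u..<u + real CARD('p) powi k}"
      using padic_monna_vimage_cball[of k x] by blast
    hence sub: "{u..<u + real CARD('p) powi k} \<subseteq> {0..}" by blast
    have "emeasure \<mu> (padic_cball k x) = emeasure ?L (padic_monna -` padic_cball k x \<inter> space ?L)"
      unfolding \<mu>_def by (rule emeasure_distr[OF meas]) simp
    also have "\<dots> = emeasure ?L {u..<u + real CARD('p) powi k}" using u by (simp add: space_restrict_space)
    also have "\<dots> = emeasure lborel {u..<u + real CARD('p) powi k}"
      by (rule emeasure_restrict_space) (use sub in auto)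
    also have "\<dots> = ennreal (real CARD('p) powi k)"
      using padic_powi_pos[where 'p='p] by (simp add: less_imp_le)
    finally show ?thesis .
  qed
  have "emeasure \<mu> ((+) x ` A) = emeasure \<mu> A" if A: "A \<in> sets borel" for x A
  proof -
    define \<nu> where "\<nu> = distr \<mu> borel (\<lambda>y. y - x)"
    have m: "(\<lambda>y. y - x) \<in> measurable \<mu> borel"
      unfolding measurable_cong_sets[OF s refl] by (intro borel_measurable_continuous_onI continuous_intros)
    have v: "emeasure \<nu> B = emeasure \<mu> ((+) x ` B)" if "B \<in> sets borel" for B
    proof -
      have "(\<lambda>y. y - x) -` B = (+) x ` B"
        by (auto simp: image_iff) (metis add.commute diff_add_cancel)
      thus ?thesis unfolding \<nu>_def using emeasure_distr[OF m that] sets_eq_imp_space_eq[OF s] by simp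
    qed
    have "\<nu> = \<mu>"
      by (rule padic_measure_eqI) (simp_all add: s ball v padic_cball_translate, simp add: \<nu>_def)
    thus ?thesis using v[OF A] by simp
  qed
  thus ?thesis using s ball[of 0 0] unfolding is_padic_haar_def padic_ints_cball by (intro exI[of _ \<mu>]) simp
qed

lemma padic_haar_cball:
  fixes \<mu> :: "'p::prime_card padic measure"
  assumes h: "is_padic_haar \<mu>"
  shows "emeasure \<mu> (padic_cball k x) = ennreal (real CARD('p) powi k)"
proof -
  let ?q = "real CARD('p)"
  have p1: "?q > 1" by (rule padic_CARD_gt_1)
  have s: "sets \<mu> = sets borel" using h by (simp add: is_padic_haar_def)
  have tr: "emeasure \<mu> (padic_cball k x) = emeasure \<mu> (padic_cball k 0)" for k x
    using h padic_cball_translate[of x k 0] unfolding is_padic_haar_def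
    by (metis add.right_neutral borel_open padic_open_cball)
  have step: "emeasure \<mu> (padic_cball (k + 1) 0) = of_nat CARD('p) * emeasure \<mu> (padic_cball k 0)" for k
  proof -
    let ?c = "\<lambda>d::nat. of_nat d * of_nat CARD('p) powi (- (k + 1)) :: 'p padic"
    have c: "padic_abs (of_nat CARD('p) powi (- (k + 1)) :: 'p padic) = ?q powi (k + 1)"
      by (simp only: padic_abs_p_powi minus_minus)
    have U: "padic_cball (k + 1) 0 = (\<Union>d\<in>{..<CARD('p)}. padic_cball k (?c d))"
    proof
      show "padic_cball (k + 1) 0 \<subseteq> (\<Union>d\<in>{..<CARD('p)}. padic_cball k (?c d))"
      proof
        fix y :: "'p padic" assume y: "y \<in> padic_cball (k + 1) 0"
        define z where "z = y * of_nat CARD('p) powi (k + 1)"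
        have yz: "y = z * of_nat CARD('p) powi (- (k + 1))"
          unfolding z_def mult.assoc by (subst power_int_add[symmetric]) simp_all
        have "padic_abs z \<le> ?q powi (k + 1) * ?q powi (- (k + 1))"
          unfolding z_def padic_abs_mult padic_abs_p_powi
          using y p1 by (intro mult_right_mono) (simp_all add: padic_cball_def)
        also have "\<dots> = 1" using p1 by (subst power_int_add[symmetric]) auto
        finally obtain d where d: "d < CARD('p)" "padic_abs ((z - of_nat d) / of_nat CARD('p)) \<le> 1"
          using padic_digit_step[of z] by blast
        have "y - ?c d = (z - of_nat d) / of_nat CARD('p) * of_nat CARD('p) powi (- k)"
          unfolding yz by (simp add: power_int_diff power_int_minus field_simps)
        hence "padic_abs (y - ?c d) = padic_abs ((z - of_nat d) / of_nat CARD('p)) * ?q powi k"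
          by (simp only: padic_abs_mult padic_abs_p_powi minus_minus)
        also have "\<dots> \<le> 1 * ?q powi k" using d(2) p1 by (intro mult_right_mono) auto
        finally show "y \<in> (\<Union>d\<in>{..<CARD('p)}. padic_cball k (?c d))" using d(1) by (auto simp: padic_cball_def)
      qed
      show "(\<Union>d\<in>{..<CARD('p)}. padic_cball k (?c d)) \<subseteq> padic_cball (k + 1) 0"
      proof (rule UN_least)
        fix d
        have "padic_abs (?c d) \<le> 1 * ?q powi (k + 1)"
          unfolding padic_abs_mult c using p1 by (intro mult_right_mono padic_abs_of_nat_le_1) auto
        hence "?c d \<in> padic_cball (k + 1) 0" by (simp add: padic_cball_def)
        thus "padic_cball k (?c d) \<subseteq> padic_cball (k + 1) 0"
          by (intro padic_cball_mono[of "?c d"]) simp_all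
      qed
    qed
    have disj: "disjoint_family_on (\<lambda>d. padic_cball k (?c d)) {..<CARD('p)}"
      unfolding disjoint_family_on_def
    proof (intro ballI impI)
      fix d e assume de: "d \<in> {..<CARD('p)}" "e \<in> {..<CARD('p)}" "d \<noteq> e"
      show "padic_cball k (?c d) \<inter> padic_cball k (?c e) = {}"
      proof (rule ccontr)
        assume "padic_cball k (?c d) \<inter> padic_cball k (?c e) \<noteq> {}"
        then obtain y where y: "y \<in> padic_cball k (?c d)" "y \<in> padic_cball k (?c e)" by blast
        have "padic_abs ((y - ?c e) - (y - ?c d)) \<le> ?q powi k"
          by (rule padic_abs_diff_le) (use y in \<open>simp_all only: padic_cball_def mem_Collect_eq\<close>)
        moreover have "(y - ?c e) - (y - ?c d) = of_int (int d - int e) * of_nat CARD('p) powi (- (k + 1))"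
          by (simp add: algebra_simps)
        ultimately have "padic_abs (of_int (int d - int e) :: 'p padic) * ?q powi (k + 1) \<le> ?q powi k"
          by (simp only: padic_abs_mult c)
        also have "\<dots> < 1 * ?q powi (k + 1)" using p1 by (simp add: power_int_add_1)
        finally have "padic_abs (of_int (int d - int e) :: 'p padic) < 1"
          by (rule mult_right_less_imp_less) (use p1 in simp)
        hence "int CARD('p) dvd int d - int e" unfolding padic_abs_of_int_less_1_iff .
        moreover have "\<bar>int d - int e\<bar> < int CARD('p)" "int d - int e \<noteq> 0" using de by auto
        ultimately show False using zdvd_imp_le[of "int CARD('p)" "\<bar>int d - int e\<bar>"] by force
      qed
    qed
    have "emeasure \<mu> (padic_cball (k + 1) 0) = (\<Sum>d<CARD('p). emeasure \<mu> (padic_cball k (?c d)))"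
      unfolding U by (rule sum_emeasure[OF _ disj, symmetric]) (auto simp: s)
    also have "\<dots> = (\<Sum>d<CARD('p). emeasure \<mu> (padic_cball k 0))" by (rule sum.cong[OF refl tr])
    finally show ?thesis by simp
  qed
  have "emeasure \<mu> (padic_cball k 0) = ennreal (?q powi k)" for k
  proof (induction k rule: int_induct[where k = 0])
    case base
    show ?case using h by (simp add: is_padic_haar_def padic_ints_cball)
  next
    case (step1 i)
    have "of_nat CARD('p) * ennreal (?q powi i) = ennreal (?q * ?q powi i)"
      using p1 by (simp add: ennreal_mult ennreal_of_nat_eq_real_of_nat)
    thus ?case unfolding step step1 using p1 by (simp add: power_int_add_1 mult.commute)
  next
    case (step2 i)
    define a where "a = emeasure \<mu> (padic_cball (i - 1) 0)"
    have eq: "ennreal ?q * a = ennreal (?q powi i)"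
      using step[of "i - 1"] step2 by (simp add: a_def ennreal_of_nat_eq_real_of_nat)
    have "a \<noteq> \<top>" using eq p1 by (auto simp: ennreal_mult_top)
    then obtain r where r: "r \<ge> 0" "a = ennreal r" by (cases a) auto
    have "?q * r = ?q powi i"
      using eq r p1 by (simp add: ennreal_mult[symmetric])
    hence "r = ?q powi (i - 1)" using p1 by (simp add: power_int_diff field_simps)
    thus ?case using r by (simp add: a_def)
  qed
  thus ?thesis using tr[of k x] by (simp only:)
qed

lemma padic_haar_ex1: "\<exists>!\<mu> :: 'p::prime_card padic measure. is_padic_haar \<mu>"
proof (rule ex_ex1I[OF padic_haar_exists])
  fix \<mu> \<nu> :: "'p padic measure" assume "is_padic_haar \<mu>" "is_padic_haar \<nu>"
  thus "\<mu> = \<nu>"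
    by (intro padic_measure_eqI padic_haar_cball) (simp_all add: is_padic_haar_def)
qed

definition padic_haar :: "'p::prime_card padic measure" where
  "padic_haar = (THE \<mu>. is_padic_haar \<mu>)"

lemma is_padic_haar_padic_haar: "is_padic_haar padic_haar"
  unfolding padic_haar_def by (rule theI'[OF padic_haar_ex1])

section \<open>The Skorokhod space \<open>D([0,\<infinity>))\<close> with the \<open>J\<^sub>1\<close> topology\<close>

text \<open>
  Only the values on \<open>[0,\<infinity>)\<close> matter; a path is made unique as a function on the reals by the
  convention \<^const>\<open>extensional\<close>.
\<close>

definition cadlag :: "(real \<Rightarrow> 'a::topological_space) \<Rightarrow> bool" where
  "cadlag f \<longleftrightarrow> (\<forall>t\<ge>0. (f \<longlongrightarrow> f t) (at_right t)) \<and> (\<forall>t>0. \<exists>l. (f \<longlongrightarrow> l) (at_left t))"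

typedef (overloaded) 'a skorokhod = "{f :: real \<Rightarrow> 'a::metric_space. f \<in> extensional {0..} \<and> cadlag f}"
  morphisms skorokhod_path Abs_skorokhod
proof
  show "restrict (\<lambda>_. undefined) {0..} \<in> {f :: real \<Rightarrow> 'a. f \<in> extensional {0..} \<and> cadlag f}"
    by (auto simp: cadlag_def extensional_def restrict_def)
qed

definition skorokhod_of :: "(real \<Rightarrow> 'a::metric_space) \<Rightarrow> 'a skorokhod" where
  "skorokhod_of f = Abs_skorokhod (restrict f {0..})"

lemma cadlag_restrict: "cadlag (restrict f {0..}) \<longleftrightarrow> cadlag f"
proof -
  have R: "(restrict f {0..} \<longlongrightarrow> l) (at_right t) \<longleftrightarrow> (f \<longlongrightarrow> l) (at_right t)" if "t \<ge> 0" for t l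
    by (rule tendsto_cong, rule eventually_mono[OF eventually_at_right_less[of t]]) (use that in auto)
  have L: "(restrict f {0..} \<longlongrightarrow> l) (at_left t) \<longleftrightarrow> (f \<longlongrightarrow> l) (at_left t)" if "t > 0" for t l
    by (rule tendsto_cong, rule eventually_mono[OF eventually_at_left_real[OF that]]) auto
  show ?thesis unfolding cadlag_def using R L by (simp add: restrict_def)
qed

lemma skorokhod_path_of: "cadlag f \<Longrightarrow> t \<ge> 0 \<Longrightarrow> skorokhod_path (skorokhod_of f) t = f t"
  unfolding skorokhod_of_def by (subst Abs_skorokhod_inverse) (simp_all add: cadlag_restrict)

text \<open>
  \<open>J\<^sub>1\<close> neighbourhoods of a path \<open>x\<close>: after a time change \<open>l\<close> uniformly \<open>e\<close>-close to the identity, \<open>y\<close> is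
  \<open>e\<close>-close to \<open>x\<close> on \<open>[0,T]\<close>. That these are indeed neighbourhoods, and that the resulting convergence
  is the usual one (Jacod--Shiryaev, Theorem VI.1.14), is \<open>eventually_nhds_skorokhod\<close> and
  \<open>skorokhod_LIMSEQ_iff\<close> below. The topology is first countable, hence determined by its convergent
  sequences, and so it is the \<open>J\<^sub>1\<close> topology.
\<close>

definition time_changes :: "(real \<Rightarrow> real) set" where
  "time_changes = {l. l 0 = 0 \<and> strict_mono_on {0..} l \<and> continuous_on {0..} l \<and> filterlim l at_top at_top}"

definition skorokhod_nbhd :: "'a::metric_space skorokhod \<Rightarrow> real \<Rightarrow> real \<Rightarrow> 'a skorokhod set" where
  "skorokhod_nbhd x T e = {y. \<exists>l\<in>time_changes. (\<forall>s\<ge>0. \<bar>l s - s\<bar> < e) \<and>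
     (\<forall>s\<in>{0..T}. dist (skorokhod_path y (l s)) (skorokhod_path x s) < e)}"

lemma time_changes_nonneg:
  assumes l: "l \<in> time_changes" and s: "s \<ge> 0" shows "l s \<ge> 0"
proof (cases "s = 0")
  case False
  have "strict_mono_on {0..} l" "l 0 = 0" using l by (simp_all add: time_changes_def)
  with False s show ?thesis using strict_mono_onD[of "{0..}" l 0 s] by simp
qed (use l in \<open>simp add: time_changes_def\<close>)

lemma time_changes_id: "(\<lambda>s. s) \<in> time_changes"
  by (auto simp: time_changes_def strict_mono_on_def filterlim_ident)

lemma time_changes_comp:
  assumes l: "l \<in> time_changes" and m: "m \<in> time_changes"
  shows "(\<lambda>s. m (l s)) \<in> time_changes"
proof -
  have "continuous_on {0..} (m \<circ> l)"
    using l m time_changes_nonneg[OF l]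
    by (intro continuous_on_compose) (auto simp: time_changes_def intro: continuous_on_subset)
  moreover have "strict_mono_on {0..} (\<lambda>s. m (l s))"
    using l m time_changes_nonneg[OF l] unfolding time_changes_def strict_mono_on_def by auto
  moreover have "filterlim (\<lambda>s. m (l s)) at_top at_top"
    using l m unfolding time_changes_def by (auto intro: filterlim_compose)
  ultimately show ?thesis using l m by (simp add: time_changes_def o_def)
qed

lemma skorokhod_nbhd_refl: "e > 0 \<Longrightarrow> x \<in> skorokhod_nbhd x T e"
  unfolding skorokhod_nbhd_def by (rule CollectI, rule bexI[OF _ time_changes_id]) simp

lemma skorokhod_nbhd_mono:
  assumes "S \<le> T" "d \<le> e" shows "skorokhod_nbhd x T d \<subseteq> skorokhod_nbhd x S e"
proof
  fix y assume "y \<in> skorokhod_nbhd x T d"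
  then obtain l where l: "l \<in> time_changes" "\<And>s. s \<ge> 0 \<Longrightarrow> \<bar>l s - s\<bar> < d"
    "\<And>s. s \<in> {0..T} \<Longrightarrow> dist (skorokhod_path y (l s)) (skorokhod_path x s) < d"
    unfolding skorokhod_nbhd_def by blast
  have "\<bar>l s - s\<bar> < e" if "s \<ge> 0" for s using l(2)[OF that] assms by linarith
  moreover have "dist (skorokhod_path y (l s)) (skorokhod_path x s) < e" if "s \<in> {0..S}" for s
    using l(3)[of s] that assms by fastforce
  ultimately show "y \<in> skorokhod_nbhd x S e" unfolding skorokhod_nbhd_def using l(1) by blast
qed

lemma skorokhod_nbhd_trans:
  assumes y: "y \<in> skorokhod_nbhd x T d" and z: "z \<in> skorokhod_nbhd y (T + d) e"
  shows "z \<in> skorokhod_nbhd x T (d + e)"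
proof -
  obtain l where l: "l \<in> time_changes" "\<And>s. s \<ge> 0 \<Longrightarrow> \<bar>l s - s\<bar> < d"
    "\<And>s. s \<in> {0..T} \<Longrightarrow> dist (skorokhod_path y (l s)) (skorokhod_path x s) < d"
    using y unfolding skorokhod_nbhd_def by blast
  obtain m where m: "m \<in> time_changes" "\<And>s. s \<ge> 0 \<Longrightarrow> \<bar>m s - s\<bar> < e"
    "\<And>s. s \<in> {0..T + d} \<Longrightarrow> dist (skorokhod_path z (m s)) (skorokhod_path y s) < e"
    using z unfolding skorokhod_nbhd_def by blast
  have "\<bar>m (l s) - s\<bar> < d + e" if "s \<ge> 0" for s
    using l(2)[OF that] m(2)[OF time_changes_nonneg[OF l(1) that]] by linarith
  moreover have "dist (skorokhod_path z (m (l s))) (skorokhod_path x s) < d + e" if s: "s \<in> {0..T}" for s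
  proof -
    have "l s \<in> {0..T + d}" using l(2)[of s] time_changes_nonneg[OF l(1), of s] s by auto
    from m(3)[OF this] l(3)[OF s] show ?thesis
      using dist_triangle[of "skorokhod_path z (m (l s))" "skorokhod_path x s" "skorokhod_path y (l s)"] by linarith
  qed
  ultimately show ?thesis unfolding skorokhod_nbhd_def
    by (intro CollectI bexI[OF _ time_changes_comp[OF l(1) m(1)]] conjI allI ballI impI)
qed

instantiation skorokhod :: (metric_space) topological_space
begin

definition open_skorokhod :: "'a skorokhod set \<Rightarrow> bool" where
  "open_skorokhod U \<longleftrightarrow> (\<forall>x\<in>U. \<exists>T. \<exists>e>0. skorokhod_nbhd x T e \<subseteq> U)"

instance
proof
  show "open (UNIV :: 'a skorokhod set)" by (auto simp: open_skorokhod_def intro: exI[of _ 1])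
next
  fix U V :: "'a skorokhod set"
  assume U: "open U" and V: "open V"
  show "open (U \<inter> V)" unfolding open_skorokhod_def
  proof
    fix x assume x: "x \<in> U \<inter> V"
    obtain S d where S: "d > 0" "skorokhod_nbhd x S d \<subseteq> U" using U x unfolding open_skorokhod_def by blast
    obtain T e where T: "e > 0" "skorokhod_nbhd x T e \<subseteq> V" using V x unfolding open_skorokhod_def by blast
    have "skorokhod_nbhd x (max S T) (min d e) \<subseteq> U \<inter> V"
      using S T skorokhod_nbhd_mono[of S "max S T" "min d e" d x] skorokhod_nbhd_mono[of T "max S T" "min d e" e x]
      by auto
    thus "\<exists>T. \<exists>e>0. skorokhod_nbhd x T e \<subseteq> U \<inter> V"
      using S(1) T(1) by (intro exI[of _ "max S T"] exI[of _ "min d e"]) auto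
  qed
next
  fix K :: "'a skorokhod set set"
  assume K: "\<forall>U\<in>K. open U"
  show "open (\<Union>K)" unfolding open_skorokhod_def
  proof
    fix x assume "x \<in> \<Union>K"
    then obtain U where U: "U \<in> K" "x \<in> U" by blast
    then obtain T e where T: "e > 0" "skorokhod_nbhd x T e \<subseteq> U"
      using K unfolding open_skorokhod_def by blast
    moreover have "skorokhod_nbhd x T e \<subseteq> \<Union>K" using T(2) U(1) by blast
    ultimately show "\<exists>T. \<exists>e>0. skorokhod_nbhd x T e \<subseteq> \<Union>K" by blast
  qed
qed

end

lemma eventually_nhds_skorokhod:
  "eventually P (nhds x) \<longleftrightarrow> (\<exists>T. \<exists>e>0. \<forall>y\<in>skorokhod_nbhd x T e. P y)"
proof
  assume "eventually P (nhds x)"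
  then obtain U where "open U" "x \<in> U" "\<forall>y\<in>U. P y" by (auto simp: eventually_nhds)
  thus "\<exists>T. \<exists>e>0. \<forall>y\<in>skorokhod_nbhd x T e. P y" unfolding open_skorokhod_def by blast
next
  assume "\<exists>T. \<exists>e>0. \<forall>y\<in>skorokhod_nbhd x T e. P y"
  then obtain T e where e: "e > 0" "\<And>y. y \<in> skorokhod_nbhd x T e \<Longrightarrow> P y" by blast
  define U where "U = {y. \<exists>S. \<exists>d>0. skorokhod_nbhd y S d \<subseteq> skorokhod_nbhd x T e}"
  have "open U" unfolding open_skorokhod_def
  proof
    fix y assume "y \<in> U"
    then obtain S d where d: "d > 0" "skorokhod_nbhd y S d \<subseteq> skorokhod_nbhd x T e" by (auto simp: U_def)
    have "skorokhod_nbhd y S (d / 2) \<subseteq> U"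
    proof
      fix z assume z: "z \<in> skorokhod_nbhd y S (d / 2)"
      have "skorokhod_nbhd z (S + d / 2) (d / 2) \<subseteq> skorokhod_nbhd y S d"
        using skorokhod_nbhd_trans[OF z, of _ "d / 2"] by auto
      with d(2) have "skorokhod_nbhd z (S + d / 2) (d / 2) \<subseteq> skorokhod_nbhd x T e" by (rule order_trans[rotated])
      moreover have "d / 2 > 0" using d(1) by simp
      ultimately show "z \<in> U" unfolding U_def by blast
    qed
    thus "\<exists>S. \<exists>d>0. skorokhod_nbhd y S d \<subseteq> U" using d(1) half_gt_zero by blast
  qed
  moreover have "x \<in> U" using e(1) unfolding U_def by blast
  moreover have "P y" if y: "y \<in> U" for y
  proof -
    obtain S d where d: "d > 0" "skorokhod_nbhd y S d \<subseteq> skorokhod_nbhd x T e" using y unfolding U_def by blast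
    show "P y" by (rule e(2), rule subsetD[OF d(2)], rule skorokhod_nbhd_refl[OF d(1)])
  qed
  ultimately show "eventually P (nhds x)" unfolding eventually_nhds by blast
qed

lemma skorokhod_LIMSEQ_iff:
  "X \<longlonglongrightarrow> x \<longleftrightarrow>
    (\<exists>l. (\<forall>n. l n \<in> time_changes) \<and>
      (\<forall>e>0. \<forall>\<^sub>F n in sequentially. \<forall>s\<ge>0. \<bar>l n s - s\<bar> < e) \<and>
      (\<forall>T. \<forall>e>0. \<forall>\<^sub>F n in sequentially. \<forall>s\<in>{0..T}.
         dist (skorokhod_path (X n) (l n s)) (skorokhod_path x s) < e))" (is "?L \<longleftrightarrow> ?R")
proof
  assume ?R
  then obtain l where l: "\<And>n. l n \<in> time_changes"
     "\<And>e. e > 0 \<Longrightarrow> \<forall>\<^sub>F n in sequentially. \<forall>s\<ge>0. \<bar>l n s - s\<bar> < e"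
     "\<And>T e. e > 0 \<Longrightarrow> \<forall>\<^sub>F n in sequentially. \<forall>s\<in>{0..T}. dist (skorokhod_path (X n) (l n s)) (skorokhod_path x s) < e"
    by blast
  show ?L unfolding filterlim_iff
  proof (intro allI impI)
    fix P assume "eventually P (nhds x)"
    then obtain T e where e: "e > 0" "\<And>y. y \<in> skorokhod_nbhd x T e \<Longrightarrow> P y"
      unfolding eventually_nhds_skorokhod by blast
    show "\<forall>\<^sub>F n in sequentially. P (X n)"
      using l(2)[OF e(1)] l(3)[OF e(1), of T]
    proof eventually_elim
      case (elim n)
      show ?case by (rule e(2)) (use elim l(1)[of n] in \<open>auto simp: skorokhod_nbhd_def\<close>)
    qed
  qed
next
  assume L: ?L
  define c where "c = (\<lambda>j. 1 / real (Suc j))"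
  have c0: "c j > 0" for j by (simp add: c_def)
  have cm: "i \<le> j \<Longrightarrow> c j \<le> c i" for i j by (simp add: c_def frac_le)
  define V where "V = (\<lambda>j. skorokhod_nbhd x (real j) (c j))"
  have Vm: "V j \<subseteq> V i" if "i \<le> j" for i j unfolding V_def by (rule skorokhod_nbhd_mono) (use that cm in auto)
  have ev: "\<forall>\<^sub>F n in sequentially. X n \<in> V j" for j
  proof -
    have "\<forall>\<^sub>F y in nhds x. y \<in> V j" unfolding eventually_nhds_skorokhod V_def using c0 by blast
    with L show ?thesis unfolding filterlim_iff by blast
  qed
  define J where "J = (\<lambda>n. {j. j \<le> n \<and> X n \<in> V j})"
  have finJ: "finite (J n)" for n unfolding J_def by simp
  define w where "w = (\<lambda>n. \<lambda>l. l \<in> time_changes \<and> (J n \<noteq> {} \<longrightarrow> (\<forall>s\<ge>0. \<bar>l s - s\<bar> < c (Max (J n))) \<and>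
     (\<forall>s\<in>{0..real (Max (J n))}. dist (skorokhod_path (X n) (l s)) (skorokhod_path x s) < c (Max (J n)))))"
  have "\<exists>l. w n l" for n
  proof (cases "J n = {}")
    case True
    thus ?thesis using time_changes_id by (auto simp: w_def)
  next
    case False
    hence "Max (J n) \<in> J n" using finJ by (rule Max_in[rotated])
    hence "X n \<in> V (Max (J n))" by (simp add: J_def)
    thus ?thesis unfolding V_def skorokhod_nbhd_def w_def by blast
  qed
  hence "\<exists>l. \<forall>n. w n (l n)" by (intro choice allI)
  then obtain l where l: "\<And>n. w n (l n)" by blast
  have evJ: "\<forall>\<^sub>F n in sequentially. J n \<noteq> {} \<and> j \<le> Max (J n)" for j
    using ev[of j] eventually_ge_at_top[of j]
  proof eventually_elim
    case (elim n)
    hence "j \<in> J n" by (simp add: J_def)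
    thus ?case using finJ[of n] by auto
  qed
  show ?R
  proof (intro exI[of _ l] conjI allI impI)
    show "l n \<in> time_changes" for n using l[of n] by (simp add: w_def)
  next
    fix e :: real assume e: "e > 0"
    obtain j where j: "c j < e" using reals_Archimedean[OF e] by (auto simp: c_def inverse_eq_divide)
    show "\<forall>\<^sub>F n in sequentially. \<forall>s\<ge>0. \<bar>l n s - s\<bar> < e"
      using evJ[of j]
    proof eventually_elim
      case (elim n)
      have "c (Max (J n)) < e" using cm[of j "Max (J n)"] elim j by simp
      moreover have "\<forall>s\<ge>0. \<bar>l n s - s\<bar> < c (Max (J n))" using l[of n] elim unfolding w_def by blast
      ultimately show ?case by (meson less_trans)
    qed
  next
    fix T e :: real assume e: "e > 0"
    obtain j0 where j0: "c j0 < e" using reals_Archimedean[OF e] by (auto simp: c_def inverse_eq_divide)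
    obtain j1 :: nat where j1: "T \<le> real j1" using real_arch_simple by blast
    show "\<forall>\<^sub>F n in sequentially. \<forall>s\<in>{0..T}. dist (skorokhod_path (X n) (l n s)) (skorokhod_path x s) < e"
      using evJ[of "max j0 j1"]
    proof eventually_elim
      case (elim n)
      have "c (Max (J n)) < e" using cm[of j0 "Max (J n)"] elim j0 by simp
      moreover have "T \<le> real (Max (J n))" using elim j1 by linarith
      moreover have "\<forall>s\<in>{0..real (Max (J n))}. dist (skorokhod_path (X n) (l n s)) (skorokhod_path x s) < c (Max (J n))"
        using l[of n] elim unfolding w_def by blast
      ultimately show ?case by (meson atLeastAtMost_iff less_trans order_trans)
    qed
  qed
qed


section \<open>The additive character, and the group \<open>\<rat>\<^sub>p / \<int>\<^sub>p\<close>\<close>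

definition padic_frac :: "'p::prime_card padic \<Rightarrow> real" where
  "padic_frac x = (\<Sum>\<^sub>\<infinity>k\<in>{..<0}. real (padic_digit x k) * real CARD('p) powi k)"

definition padic_char :: "'p::prime_card padic \<Rightarrow> complex" where
  "padic_char x = exp (2 * of_real pi * \<i> * of_real (padic_frac x))"

lifting_forget padic.lifting

quotient_type (overloaded) 'p padic_quot = "'p::prime_card padic" / "\<lambda>x y. x - y \<in> padic_ints"
  morphisms padic_quot_rep padic_class
proof (rule equivpI)
  show "reflp (\<lambda>x y :: 'p padic. x - y \<in> padic_ints)" by (simp add: reflp_def padic_ints_def)
  show "symp (\<lambda>x y :: 'p padic. x - y \<in> padic_ints)" by (simp add: symp_def padic_ints_def padic_abs_diff_commute)
  show "transp (\<lambda>x y :: 'p padic. x - y \<in> padic_ints)"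
  proof (rule transpI)
    fix x y z :: "'p padic" assume "x - y \<in> padic_ints" "y - z \<in> padic_ints"
    thus "x - z \<in> padic_ints" using padic_abs_add_le[of "x - y" 1 "y - z"] by (simp add: padic_ints_def)
  qed
qed

instantiation padic_quot :: (prime_card) ab_group_add
begin

lift_definition zero_padic_quot :: "'a padic_quot" is 0 .
lift_definition plus_padic_quot :: "'a padic_quot \<Rightarrow> 'a padic_quot \<Rightarrow> 'a padic_quot" is "(+)"
proof -
  fix x y u v :: "'a padic" assume "x - y \<in> padic_ints" "u - v \<in> padic_ints"
  thus "x + u - (y + v) \<in> padic_ints"
    using padic_abs_add_le[of "x - y" 1 "u - v"] by (simp add: padic_ints_def algebra_simps)
qed
lift_definition minus_padic_quot :: "'a padic_quot \<Rightarrow> 'a padic_quot \<Rightarrow> 'a padic_quot" is "(-)"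
proof -
  fix x y u v :: "'a padic" assume "x - y \<in> padic_ints" "u - v \<in> padic_ints"
  thus "x - u - (y - v) \<in> padic_ints"
    using padic_abs_diff_le[of "x - y" 1 "u - v"] by (simp add: padic_ints_def algebra_simps)
qed
lift_definition uminus_padic_quot :: "'a padic_quot \<Rightarrow> 'a padic_quot" is uminus
proof -
  fix x y :: "'a padic" assume "x - y \<in> padic_ints"
  thus "- x - - y \<in> padic_ints" by (simp add: padic_ints_def padic_abs_diff_commute)
qed

instance
proof
  fix a b c :: "'a padic_quot"
  show "a + b + c = a + (b + c)" by transfer (simp add: padic_ints_def algebra_simps)
  show "a + b = b + a" by transfer (simp add: padic_ints_def algebra_simps)
  show "0 + a = a" by transfer (simp add: padic_ints_def)
  show "- a + a = 0" by transfer (simp add: padic_ints_def)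
  show "a - b = a + - b" by transfer (simp add: padic_ints_def)
qed

end

lift_definition padic_quot_abs :: "'p::prime_card padic_quot \<Rightarrow> real"
  is "\<lambda>x. if x \<in> padic_ints then 0 else padic_abs x"
proof -
  fix x y :: "'p padic" assume xy: "x - y \<in> padic_ints"
  have 1: "y \<in> padic_ints" if "x \<in> padic_ints"
    using padic_abs_diff_le[of x 1 "x - y"] that xy by (simp add: padic_ints_def)
  have 2: "x \<in> padic_ints" if "y \<in> padic_ints"
    using padic_abs_add_le[of "x - y" 1 y] that xy by (simp add: padic_ints_def)
  have 3: "padic_abs y = padic_abs x" if "x \<notin> padic_ints" "y \<notin> padic_ints"
  proof (rule antisym)
    show "padic_abs y \<le> padic_abs x"
      using padic_abs_diff_le[of x "padic_abs x" "x - y"] that xy by (simp add: padic_ints_def)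
    show "padic_abs x \<le> padic_abs y"
      using padic_abs_add_le[of "x - y" "padic_abs y" y] that xy by (simp add: padic_ints_def)
  qed
  show "(if x \<in> padic_ints then 0 else padic_abs x) = (if y \<in> padic_ints then 0 else padic_abs y)"
    using 1 2 3 by auto
qed

definition padic_quot_sphere :: "nat \<Rightarrow> 'p::prime_card padic_quot set" where
  "padic_quot_sphere k = {g. padic_quot_abs g = real CARD('p) ^ k}"

text \<open>
  The map \<open>\<Gamma>\<^sub>m\<close>, \<open>[x] \<mapsto> (\<Sum>k<m. a k * p powi k)\<close> with \<open>a\<close> the digits of \<open>p ^ m * x\<close>; only finitely many
  terms of the sum are nonzero.
\<close>

lift_definition padic_embed :: "nat \<Rightarrow> 'p::prime_card padic_quot \<Rightarrow> 'p padic"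
  is "\<lambda>m x. \<Sum>\<^sub>\<infinity>k\<in>{..<int m}.
        of_nat (padic_digit (of_nat CARD('p) ^ m * x) k) * of_nat CARD('p) powi k"
proof -
  fix m :: nat and x y :: "'p padic" assume xy: "x - y \<in> padic_ints"
  let ?p = "of_nat CARD('p) :: 'p padic"
  have "padic_abs (?p ^ m * x - ?p ^ m * y) = padic_abs (?p powi int m) * padic_abs (x - y)"
    by (simp flip: padic_abs_mult add: algebra_simps)
  also have "\<dots> \<le> real CARD('p) powi (- int m)"
    unfolding padic_abs_p_powi using xy by (intro mult_left_le) (simp_all add: padic_ints_def)
  finally have D: "padic_digit (?p ^ m * x) k = padic_digit (?p ^ m * y) k" if "k < int m" for k
    using padic_digit_cong that by blast
  show "(\<Sum>\<^sub>\<infinity>k\<in>{..<int m}. of_nat (padic_digit (?p ^ m * x) k) * ?p powi k)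
      = (\<Sum>\<^sub>\<infinity>k\<in>{..<int m}. of_nat (padic_digit (?p ^ m * y) k) * ?p powi k)"
    by (rule infsum_cong) (simp add: D)
qed

section \<open>The random walk, \<open>p\<close>-adic Brownian motion, and weak convergence of laws\<close>

text \<open>The steps \<open>X 1, X 2, \<dots>\<close> of the walk; \<open>X 0\<close> is not used.\<close>

definition padic_walk_increments ::
    "real \<Rightarrow> real \<Rightarrow> 'w measure \<Rightarrow> (nat \<Rightarrow> 'w \<Rightarrow> 'p::prime_card padic_quot) \<Rightarrow> bool" where
  "padic_walk_increments b P\<^sub>0 M X \<longleftrightarrow>
     prob_space M \<and>
     prob_space.indep_vars M (\<lambda>_. count_space UNIV) X {1..} \<and>
     (\<forall>i\<ge>1. measure M {\<omega>\<in>space M. X i \<omega> = 0} = P\<^sub>0 \<and>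
       (\<forall>k\<ge>1. \<forall>g\<in>padic_quot_sphere k. measure M {\<omega>\<in>space M. X i \<omega> = g} =
          (1 - P\<^sub>0) * (real CARD('p) powr b - 1) / real CARD('p) powr (real k * b)
            * (1 / real (card (padic_quot_sphere k :: 'p padic_quot set)))))"

definition random_walk :: "(nat \<Rightarrow> 'w \<Rightarrow> 'g::comm_monoid_add) \<Rightarrow> nat \<Rightarrow> 'w \<Rightarrow> 'g" where
  "random_walk X n \<omega> = (\<Sum>i=1..n. X i \<omega>)"

definition padic_heat_kernel :: "real \<Rightarrow> real \<Rightarrow> real \<Rightarrow> 'p::prime_card padic \<Rightarrow> complex" where
  "padic_heat_kernel b \<sigma> t x =
     (LINT y|padic_haar. padic_char (x * y) * of_real (exp (- \<sigma> * t * padic_abs y powr b)))"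

text \<open>
  The heat kernel is real and nonnegative (it is even in the integration variable up to complex
  conjugation); \<^const>\<open>Re\<close> only adjusts its type.
\<close>

definition padic_brownian_motion ::
    "real \<Rightarrow> real \<Rightarrow> 'w measure \<Rightarrow> (real \<Rightarrow> 'w \<Rightarrow> 'p::prime_card padic) \<Rightarrow> bool" where
  "padic_brownian_motion b \<sigma> N Y \<longleftrightarrow>
     prob_space N \<and>
     (\<forall>t\<ge>0. Y t \<in> borel_measurable N) \<and>
     (\<forall>\<omega>\<in>space N. cadlag (\<lambda>t. Y t \<omega>) \<and> Y 0 \<omega> = 0) \<and>
     (\<forall>(n::nat) \<tau>. 0 \<le> \<tau> 0 \<and> (\<forall>i<n. \<tau> i < \<tau> (Suc i)) \<longrightarrow>
        prob_space.indep_vars N (\<lambda>_. borel) (\<lambda>i \<omega>. Y (\<tau> (Suc i)) \<omega> - Y (\<tau> i) \<omega>) {..<n}) \<and>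
     (\<forall>s\<ge>0. \<forall>t>0. distributed N padic_haar (\<lambda>\<omega>. Y (s + t) \<omega> - Y s \<omega>)
        (\<lambda>x. ennreal (Re (padic_heat_kernel b \<sigma> t x))))"

definition skorokhod_law :: "'w measure \<Rightarrow> (real \<Rightarrow> 'w \<Rightarrow> 'a::metric_space) \<Rightarrow> 'a skorokhod measure" where
  "skorokhod_law M Z = distr M borel (\<lambda>\<omega>. skorokhod_of (\<lambda>t. Z t \<omega>))"

text \<open>
  Weak convergence of Borel probability measures. The first three conjuncts exclude the degenerate
  value that \<^const>\<open>distr\<close> takes on non-measurable maps.
\<close>

definition converges_weakly :: "(nat \<Rightarrow> 'a::topological_space measure) \<Rightarrow> 'a measure \<Rightarrow> bool" where
  "converges_weakly P Q \<longleftrightarrow>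
     (\<forall>n. prob_space (P n) \<and> sets (P n) = sets borel) \<and> prob_space Q \<and> sets Q = sets borel \<and>
     (\<forall>f::'a \<Rightarrow> real. continuous_on UNIV f \<and> bounded (range f) \<longrightarrow>
        (\<lambda>n. integral\<^sup>L (P n) f) \<longlonglongrightarrow> integral\<^sup>L Q f)"

end

theory Submission
  imports Defs
begin

text \<open>
  The convergence rests on an exact identity. A step of the walk is a mixture of uniform distributions
  on spheres, so its Fourier transform can be computed in closed form, and it turns out that
  \<open>E \<chi>(u X) = 1 - \<alpha> \<bar>u\<bar> powr b\<close> for every \<open>u\<close> in \<open>\<int>\<^sub>p\<close>, without error term (\<open>fourier_step_pmf\<close>). Hence
  the walk stopped at an independent Poisson time of mean \<open>lam m * t\<close> has at \<open>u = p ^ m * y\<close> the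
  Fourier transform \<open>exp (- \<sigma> * t * \<bar>y\<bar> powr b)\<close>. This is the Fourier transform of an increment of the
  Brownian motion over time \<open>t\<close>, and the characters with \<open>\<bar>y\<bar> \<le> p ^ m\<close> are those of
  \<open>\<rat>\<^sub>p / p ^ m \<int>\<^sub>p\<close>, which multiplication by \<open>p ^ (-m)\<close> identifies with \<open>\<rat>\<^sub>p / \<int>\<^sub>p\<close>. So the Brownian motion
  reduced modulo \<open>p ^ m \<int>\<^sub>p\<close> is, in law, the walk run by a Poisson clock of rate \<open>lam m\<close>
  (\<open>distr_scaled_class_heat\<close>).

  This turns weak convergence into a coupling argument.
  Let \<open>h m\<close> be a mesh with \<open>lam m ^ 2 * h m\<close> tending to \<open>0\<close>. Adjoin to the walk independent Poisson
  variables \<open>\<kappa> i\<close> of mean \<open>lam m * h m\<close>, let \<open>N i\<close> be the sum of the first \<open>i\<close> of them, and compare three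
  paths: the rescaled walk \<open>Z t = \<Gamma>\<^sub>m (S \<lfloor>lam m * t\<rfloor>)\<close>, the walk with a Poisson clock
  \<open>P t = \<Gamma>\<^sub>m (S (N \<lfloor>t / h m\<rfloor>))\<close>, and the sampled Brownian motion
  \<open>Q t = \<Gamma>\<^sub>m [p ^ (-m) * Y (h m * \<lfloor>t / h m\<rfloor>)]\<close>.

  \<^item> \<open>P\<close> and \<open>Q\<close> have the same law, because the increments of both on the grid are independent with
    the same compound Poisson law (\<open>distr_block_sums\<close>, \<open>distr_brownian_increments\<close>).
  \<^item> \<open>Q\<close> converges to \<open>Y\<close> for every single path (\<open>sampled_path_LIMSEQ\<close>), since \<open>\<Gamma>\<^sub>m [p ^ (-m) * x]\<close>
    is \<open>x\<close> up to an error \<open>p ^ (-m)\<close>.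
  \<^item> \<open>Z\<close> is \<open>J\<^sub>1\<close>-close to \<open>P\<close> with high probability (\<open>poissonised_walk_close\<close>): if no \<open>\<kappa> i\<close> exceeds \<open>1\<close>
    then both paths visit the same points in the same order, and the time change which matches them
    differs from the identity by \<open>\<bar>N i / lam m - h m * i\<bar>\<close>, which Chebyshev's inequality makes small.

  A bounded continuous \<open>f\<close> need not be uniformly continuous, so the closeness of \<open>Z\<close> to \<open>P\<close> does not by
  itself control \<open>f Z - f P\<close>. But the paths around which \<open>f\<close> varies little on a neighbourhood of a given
  size have interiors that increase to the whole space; since \<open>Q\<close> converges pathwise, it lies in one of
  them for all large \<open>m\<close> with probability close to \<open>1\<close>, and this is a property of the law of \<open>Q\<close>, that is
  of \<open>P\<close> (\<open>weak_limit_by_coupling\<close>).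
\<close>

section \<open>Time changes and neighbourhoods in the Skorokhod space\<close>

text \<open>
  Slope \<open>c\<close> on \<open>[a, a']\<close> and slope \<open>1\<close> elsewhere. Composing such maps produces all the time changes used
  below.
\<close>

lemma stretch_time_change:
  fixes a a' c :: real
  assumes a: "0 \<le> a" "a \<le> a'" and c: "c > 0"
  shows "(\<lambda>s. s + (c - 1) * min (max (s - a) 0) (a' - a)) \<in> time_changes"
proof -
  define k where "k s = min (max (s - a) 0) (a' - a)" for s
  have k: "0 \<le> k t - k s" "k t - k s \<le> t - s" if "s \<le> t" for s t
    using that a by (auto simp: k_def)
  have "strict_mono_on {0..} (\<lambda>s. s + (c - 1) * k s)"
  proof (rule strict_mono_onI)
    fix s t :: real assume st: "s < t"
    \<comment> \<open>Both \<open>k\<close> and \<open>\<lambda>s. s - k s\<close> are nondecreasing, and one of them increases from \<open>s\<close> to \<open>t\<close>.\<close>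
    have "0 < (t - s - (k t - k s)) + c * (k t - k s)"
    proof (cases "k t - k s = 0")
      case False
      hence "0 < c * (k t - k s)" using c k[of s t] st by simp
      thus ?thesis using k[of s t] st by simp
    qed (use st in simp)
    thus "s + (c - 1) * k s < t + (c - 1) * k t" by (simp add: algebra_simps)
  qed
  moreover have "continuous_on {0..} (\<lambda>s. s + (c - 1) * k s)"
    unfolding k_def by (intro continuous_intros)
  moreover have "filterlim (\<lambda>s. s + (c - 1) * k s) at_top at_top"
  proof (rule filterlim_at_top_mono)
    show "filterlim (\<lambda>s::real. - (a' - a) + s) at_top at_top"
      by (intro filterlim_tendsto_add_at_top[OF tendsto_const filterlim_ident])
    show "\<forall>\<^sub>F s in at_top. - (a' - a) + s \<le> s + (c - 1) * k s"
    proof (rule always_eventually, rule allI)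
      fix s
      have "- (a' - a) \<le> - k s" "0 \<le> c * k s" using a c by (auto simp: k_def)
      thus "- (a' - a) + s \<le> s + (c - 1) * k s" by (simp add: algebra_simps)
    qed
  qed
  moreover have "k 0 = 0" using a by (simp add: k_def)
  ultimately show ?thesis by (simp add: time_changes_def k_def)
qed

lemma strict_steps_mono:
  fixes a :: "nat \<Rightarrow> real"
  assumes "\<And>i. i < n \<Longrightarrow> a i < a (Suc i)" "i \<le> j" "j \<le> n"
  shows "a i \<le> a j"
  using assms(2,3)
proof (induction j)
  case (Suc j)
  thus ?case using assms(1)[of j] by (cases "i = Suc j") fastforce+
qed simp

text \<open>
  The last clause makes the induction work: beyond \<open>a n\<close> the time change constructed so far is a
  translation, so composing it with a stretch of \<open>[a n, a (Suc n)]\<close> moves only the next point. Between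
  two nodes the deviation from the identity is a convex combination of the deviations at the nodes.
\<close>

lemma time_change_through_points:
  fixes a b :: "nat \<Rightarrow> real"
  assumes "a 0 = 0" "b 0 = 0"
    and "\<And>i. i < n \<Longrightarrow> a i < a (Suc i)" "\<And>i. i < n \<Longrightarrow> b i < b (Suc i)"
    and "\<And>i. i \<le> n \<Longrightarrow> \<bar>b i - a i\<bar> \<le> d"
  shows "\<exists>l\<in>time_changes. (\<forall>i\<le>n. l (a i) = b i) \<and> (\<forall>s\<ge>0. \<bar>l s - s\<bar> \<le> d) \<and>
           (\<forall>s\<ge>a n. l s = b n + (s - a n))"
  using assms
proof (induction n)
  case 0
  thus ?case by (intro bexI[OF _ time_changes_id]) auto
next
  case (Suc n)
  have "\<exists>l\<in>time_changes. (\<forall>i\<le>n. l (a i) = b i) \<and> (\<forall>s\<ge>0. \<bar>l s - s\<bar> \<le> d) \<and>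
           (\<forall>s\<ge>a n. l s = b n + (s - a n))"
    by (rule Suc.IH) (use Suc.prems in auto)
  then obtain l where l: "l \<in> time_changes" "\<And>i. i \<le> n \<Longrightarrow> l (a i) = b i"
    "\<And>s. s \<ge> 0 \<Longrightarrow> \<bar>l s - s\<bar> \<le> d" "\<And>s. s \<ge> a n \<Longrightarrow> l s = b n + (s - a n)" by blast
  note mono = strict_steps_mono[of "Suc n" a, OF Suc.prems(3)]
  have a0: "0 \<le> a n" using mono[of 0 n] Suc.prems(1) by simp
  have an: "a n < a (Suc n)" "b n < b (Suc n)" using Suc.prems(3,4) by auto
  define c where "c = (b (Suc n) - b n) / (a (Suc n) - a n)"
  have c: "c > 0" using an by (simp add: c_def)
  define k where "k s = min (max (s - a n) 0) (a (Suc n) - a n)" for s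
  define g where "g = (\<lambda>s. s + (c - 1) * k s)"
  have g: "g \<in> time_changes" unfolding g_def k_def
    by (rule stretch_time_change) (use a0 an c in auto)
  have g1: "g s = s" if "s \<le> a n" for s using that an by (simp add: g_def k_def)
  have g2: "g s = a n + c * (s - a n)" if "a n \<le> s" "s \<le> a (Suc n)" for s
    using that by (simp add: g_def k_def algebra_simps)
  have g3: "l (g s) = b (Suc n) + (s - a (Suc n))" if "a (Suc n) \<le> s" for s
  proof -
    have ks: "k s = a (Suc n) - a n" using that an by (simp add: k_def)
    have ck: "c * (a (Suc n) - a n) = b (Suc n) - b n" using an by (simp add: c_def)
    have gs: "g s = s + (b (Suc n) - b n) - (a (Suc n) - a n)"
      unfolding g_def ks using ck by (simp add: algebra_simps)
    hence "g s \<ge> a n" using that an by simp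
    thus ?thesis using l(4) gs by simp
  qed
  have d1: "\<bar>b n - a n\<bar> \<le> d" "\<bar>b (Suc n) - a (Suc n)\<bar> \<le> d" using Suc.prems(5) by auto
  show ?case
  proof (intro bexI[OF _ time_changes_comp[OF g l(1)]] conjI allI impI)
    fix i assume i: "i \<le> Suc n"
    show "l (g (a i)) = b i"
    proof (cases "i = Suc n")
      case False
      hence "a i \<le> a n" using i mono by auto
      thus ?thesis using g1 l(2) False i by auto
    qed (use g3 in auto)
  next
    fix s :: real assume s: "s \<ge> 0"
    consider "s \<le> a n" | "a n \<le> s" "s \<le> a (Suc n)" | "a (Suc n) \<le> s" by linarith
    thus "\<bar>l (g s) - s\<bar> \<le> d"
    proof cases
      case 1
      thus ?thesis using g1 l(3) s by auto
    next
      case 2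
      define u where "u = (s - a n) / (a (Suc n) - a n)"
      have u: "0 \<le> u" "u \<le> 1" using 2 an by (auto simp: u_def)
      have su: "s - a n = u * (a (Suc n) - a n)" using an by (simp add: u_def)
      have "c * (s - a n) \<ge> 0" using c 2 by simp
      hence "l (g s) = b n + c * (s - a n)" using g2[OF 2] l(4) by simp
      also have "c * (s - a n) = u * (b (Suc n) - b n)"
        using an by (simp add: su c_def)
      finally have "l (g s) - s = (1 - u) * (b n - a n) + u * (b (Suc n) - a (Suc n))"
        using su by (simp add: algebra_simps)
      also have "\<bar>\<dots>\<bar> \<le> (1 - u) * \<bar>b n - a n\<bar> + u * \<bar>b (Suc n) - a (Suc n)\<bar>"
        using u by (intro order_trans[OF abs_triangle_ineq]) (simp add: abs_mult)
      also have "\<dots> \<le> (1 - u) * d + u * d"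
        using d1 u by (intro add_mono mult_left_mono) auto
      finally show ?thesis by (simp add: algebra_simps)
    next
      case 3
      thus ?thesis using g3 d1 by auto
    qed
  qed (use g3 in auto)
qed

lemma step_containing:
  fixes a :: "nat \<Rightarrow> real"
  assumes "a 0 \<le> t" "t < a n"
  obtains i where "i < n" "a i \<le> t" "t < a (Suc i)"
proof -
  have "\<exists>i<n. a i \<le> t \<and> t < a (Suc i)" using assms(2)
  proof (induction n)
    case (Suc n)
    show ?case
    proof (cases "t < a n")
      case True
      with Suc.IH show ?thesis by (auto intro: less_SucI)
    qed (use Suc.prems in \<open>auto intro!: exI[of _ n]\<close>)
  qed (use assms(1) in simp)
  thus ?thesis using that by blast
qed

text \<open>
  The only way in which closeness in \<open>J\<^sub>1\<close> is established below: a time change that carries the partition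
  \<open>a\<close> to the partition \<open>b\<close> carries each interval of the first onto the corresponding interval of the
  second. Exchanging \<open>a\<close> and \<open>b\<close> gives closeness in the other direction, without inverting a time change.
\<close>

lemma skorokhod_nbhd_of_partitions:
  fixes x y :: "real \<Rightarrow> 'a::metric_space"
  assumes x: "cadlag x" and y: "cadlag y"
    and 0: "a 0 = 0" "b 0 = 0"
    and a: "\<And>i. i < n \<Longrightarrow> a i < a (Suc i)" and b: "\<And>i. i < n \<Longrightarrow> b i < b (Suc i)"
    and d: "\<And>i. i \<le> n \<Longrightarrow> \<bar>b i - a i\<bar> \<le> d" "d < e" and T: "T < a n"
    and close: "\<And>i u v. i < n \<Longrightarrow> a i \<le> u \<Longrightarrow> u < a (Suc i) \<Longrightarrow> b i \<le> v \<Longrightarrow> v < b (Suc i)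
        \<Longrightarrow> dist (y v) (x u) < e"
  shows "skorokhod_of y \<in> skorokhod_nbhd (skorokhod_of x) T e"
proof -
  obtain l where l: "l \<in> time_changes" "\<And>i. i \<le> n \<Longrightarrow> l (a i) = b i" "\<And>s. s \<ge> 0 \<Longrightarrow> \<bar>l s - s\<bar> \<le> d"
    using time_change_through_points[OF 0 a b d(1)] by blast
  have sm: "strict_mono_on {0..} l" using l(1) by (simp add: time_changes_def)
  have "dist (skorokhod_path (skorokhod_of y) (l s)) (skorokhod_path (skorokhod_of x) s) < e"
    if s: "s \<in> {0..T}" for s
  proof -
    obtain i where i: "i < n" "a i \<le> s" "s < a (Suc i)"
      using step_containing[of a s n] s T 0 by auto
    have ai: "a i \<ge> 0" using strict_steps_mono[of n a 0 i, OF a] 0 i by simp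
    have "l (a i) \<le> l s"
      using sm ai i(2) strict_mono_on_leD[OF sm, of "a i" s] by auto
    moreover have "l s < l (a (Suc i))"
      using ai i by (intro strict_mono_onD[OF sm]) auto
    ultimately have "dist (y (l s)) (x s) < e" using i l(2) by (intro close[of i]) auto
    thus ?thesis using s time_changes_nonneg[OF l(1), of s]
      by (simp add: skorokhod_path_of[OF x] skorokhod_path_of[OF y])
  qed
  moreover have "\<bar>l s - s\<bar> < e" if "s \<ge> 0" for s using l(3)[OF that] d(2) by simp
  ultimately show ?thesis unfolding skorokhod_nbhd_def using l(1) by blast
qed

lemma skorokhod_LIMSEQ_I:
  assumes "\<And>T e. e > 0 \<Longrightarrow> \<forall>\<^sub>F n in sequentially. X n \<in> skorokhod_nbhd x T e"
  shows "X \<longlonglongrightarrow> x"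
  unfolding filterlim_iff eventually_nhds_skorokhod
proof (intro allI impI)
  fix R assume "\<exists>T. \<exists>e>0. \<forall>y\<in>skorokhod_nbhd x T e. R y"
  then obtain T e where e: "e > 0" "\<And>y. y \<in> skorokhod_nbhd x T e \<Longrightarrow> R y" by blast
  from assms[OF e(1), of T] show "\<forall>\<^sub>F n in sequentially. R (X n)"
    by (rule eventually_mono) (rule e(2))
qed

text \<open>
  The paths whose neighbourhood with horizon \<open>k\<close> and precision \<open>1 / (k + 1)\<close>, called of size \<open>k\<close> below,
  lies in \<open>U\<close>. These sets replace the inner parallel sets of a
  metric space.
\<close>

definition skorokhod_inner :: "'a::metric_space skorokhod set \<Rightarrow> nat \<Rightarrow> 'a skorokhod set" where
  "skorokhod_inner U k = {x. skorokhod_nbhd x (real k) (1 / Suc k) \<subseteq> U}"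

lemma skorokhod_inner_nearby:
  assumes "skorokhod_nbhd x T e \<subseteq> U" "e > 0"
  obtains k where "skorokhod_nbhd x T (e / 2) \<subseteq> skorokhod_inner U k"
proof -
  obtain k0 :: nat where k0: "T + e \<le> real k0" using real_arch_simple by blast
  obtain k1 where k1: "1 / real (Suc k1) < e / 2"
    using reals_Archimedean[of "e / 2"] assms(2) by (auto simp: inverse_eq_divide)
  define k where "k = max k0 k1"
  have k: "T + e / 2 \<le> real k" "1 / real (Suc k) \<le> e / 2"
    using k0 k1 assms(2) frac_le[of 1 1 "real (Suc k1)" "real (Suc k)"] by (auto simp: k_def)
  have "skorokhod_nbhd y (real k) (1 / real (Suc k)) \<subseteq> U" if "y \<in> skorokhod_nbhd x T (e / 2)" for y
  proof
    fix z assume "z \<in> skorokhod_nbhd y (real k) (1 / real (Suc k))"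
    hence "z \<in> skorokhod_nbhd y (T + e / 2) (e / 2)" using skorokhod_nbhd_mono[OF k] by blast
    from skorokhod_nbhd_trans[OF that this] show "z \<in> U" using assms(1) by auto
  qed
  thus ?thesis using that unfolding skorokhod_inner_def by blast
qed

section \<open>Discretisation of cadlag paths\<close>

text \<open>
  The endpoints reachable by a partition with small oscillation have no finite supremum: a left limit
  allows the supremum to be reached, and right-continuity allows it to be passed.
\<close>

lemma cadlag_partition:
  fixes x :: "real \<Rightarrow> 'a::metric_space"
  assumes x: "cadlag x" and e: "e > 0"
  obtains n and a :: "nat \<Rightarrow> real" where "a 0 = 0" "\<And>i. i < n \<Longrightarrow> a i < a (Suc i)" "T < a n"
    "\<And>i u v. i < n \<Longrightarrow> a i \<le> u \<Longrightarrow> u < a (Suc i) \<Longrightarrow> a i \<le> v \<Longrightarrow> v < a (Suc i) \<Longrightarrow> dist (x u) (x v) < e"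
proof -
  define P where "P n a \<longleftrightarrow> a 0 = 0 \<and> (\<forall>i<n. a i < a (Suc i) \<and>
    (\<forall>u v. a i \<le> u \<and> u < a (Suc i) \<and> a i \<le> v \<and> v < a (Suc i) \<longrightarrow> dist (x u) (x v) < e))"
    for n :: nat and a :: "nat \<Rightarrow> real"
  define S where "S = {t. \<exists>n a. P n a \<and> a n = t}"
  have extend: "t \<in> S" if sS: "s \<in> S" and st: "s < t" and osc: "\<And>u. s \<le> u \<Longrightarrow> u < t \<Longrightarrow> dist (x u) z < e / 2" for s t z
  proof -
    obtain n a where na: "P n a" "a n = s" using sS unfolding S_def by blast
    have tri: "dist (x u) (x v) < e" if "dist (x u) z < e / 2" "dist (x v) z < e / 2" for u v
      using that dist_triangle2[of "x u" "x v" z] by simp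
    have "P (Suc n) (a(Suc n := t))"
      unfolding P_def
    proof (intro conjI allI impI)
      show "(a(Suc n := t)) 0 = 0" using na by (simp add: P_def)
      fix i assume i: "i < Suc n"
      show "(a(Suc n := t)) i < (a(Suc n := t)) (Suc i)" using i na st by (cases "i = n") (auto simp: P_def)
      fix u v assume uv: "(a(Suc n := t)) i \<le> u \<and> u < (a(Suc n := t)) (Suc i) \<and>
        (a(Suc n := t)) i \<le> v \<and> v < (a(Suc n := t)) (Suc i)"
      show "dist (x u) (x v) < e"
      proof (cases "i = n")
        case True
        thus ?thesis using uv na osc by (intro tri) auto
      next
        case False
        hence "i < n" using i by simp
        moreover have "(a(Suc n := t)) i = a i" "(a(Suc n := t)) (Suc i) = a (Suc i)" using False i by auto
        ultimately show ?thesis using uv na(1) unfolding P_def by metis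
      qed
    qed
    thus ?thesis unfolding S_def by (intro CollectI exI[of _ "Suc n"] exI[of _ "a(Suc n := t)"]) simp
  qed
  have S0: "0 \<in> S" unfolding S_def P_def by (intro CollectI exI[of _ 0] exI[of _ "\<lambda>_. 0"]) simp
  have right: "\<exists>t>s. t \<in> S" if s: "s \<in> S" "s \<ge> 0" for s
  proof -
    have "(x \<longlongrightarrow> x s) (at_right s)" using x s by (simp add: cadlag_def)
    hence "\<forall>\<^sub>F t in at_right s. dist (x t) (x s) < e / 2" using e by (intro tendstoD) auto
    then obtain t where t: "t > s" "\<And>u. u > s \<Longrightarrow> u < t \<Longrightarrow> dist (x u) (x s) < e / 2"
      unfolding eventually_at_right_field by auto
    have "t \<in> S"
    proof (rule extend[OF s(1) t(1)])
      fix u assume "s \<le> u" "u < t"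
      thus "dist (x u) (x s) < e / 2" using t(2)[of u] e by (cases "u = s") auto
    qed
    thus ?thesis using t(1) by blast
  qed
  have "\<exists>t\<in>S. T < t"
  proof (rule ccontr)
    assume "\<not> (\<exists>t\<in>S. T < t)"
    hence bdd: "bdd_above S" by (auto simp: bdd_above_def not_less)
    define s where "s = Sup S"
    have s0: "s > 0"
      using right[OF S0] cSup_upper[OF _ bdd] unfolding s_def by (metis order.refl less_le_trans)
    have "s \<in> S"
    proof -
      obtain z where "(x \<longlongrightarrow> z) (at_left s)" using x s0 by (auto simp: cadlag_def)
      hence "\<forall>\<^sub>F t in at_left s. dist (x t) z < e / 2" using e by (intro tendstoD) auto
      then obtain r where r: "r < s" "\<And>u. r < u \<Longrightarrow> u < s \<Longrightarrow> dist (x u) z < e / 2"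
        unfolding eventually_at_left_field by auto
      obtain t where t: "t \<in> S" "r < t" using less_cSupD[of S r] S0 r(1) unfolding s_def by blast
      have "t \<le> s" using cSup_upper[OF t(1) bdd] by (simp add: s_def)
      show ?thesis
      proof (cases "t = s")
        case False
        with \<open>t \<le> s\<close> have "t < s" by simp
        show ?thesis by (rule extend[OF t(1) \<open>t < s\<close>, of z]) (use r t in auto)
      qed (use t in simp)
    qed
    then obtain t where "t > s" "t \<in> S" using right s0 by force
    thus False using cSup_upper[OF _ bdd, of t] by (simp add: s_def)
  qed
  then obtain n a where "P n a" "T < a n" by (auto simp: S_def)
  thus ?thesis using that[of a n] unfolding P_def by blast
qed

lemma grid_floor_bounds:
  fixes h t :: real
  assumes "h > 0" "t \<ge> 0"
  shows "h * real (nat \<lfloor>t / h\<rfloor>) \<le> t" "t < h * (real (nat \<lfloor>t / h\<rfloor>) + 1)"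
proof -
  have "real (nat \<lfloor>t / h\<rfloor>) \<le> t / h" "t / h < real (nat \<lfloor>t / h\<rfloor>) + 1"
    using divide_nonneg_pos[OF assms(2,1)] by linarith+
  hence "real (nat \<lfloor>t / h\<rfloor>) * h \<le> t" "t < (real (nat \<lfloor>t / h\<rfloor>) + 1) * h"
    using assms(1) by (simp_all only: pos_le_divide_eq pos_divide_less_eq)
  thus "h * real (nat \<lfloor>t / h\<rfloor>) \<le> t" "t < h * (real (nat \<lfloor>t / h\<rfloor>) + 1)"
    by (simp_all only: mult.commute)
qed

text \<open>
  If the oscillation of \<open>x\<close> on the intervals \<open>[a i, a (Suc i))\<close> is small, shift each \<open>a i\<close> up to the next
  grid point \<open>b i\<close>. A time in \<open>[b i, b (Suc i))\<close> rounded down to the grid stays in \<open>[a i, a (Suc i))\<close>,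
  which is what \<open>skorokhod_nbhd_of_partitions\<close> asks for. Both directions are needed because the
  neighbourhoods are not symmetric.
\<close>

lemma discretisations_eventually_close:
  fixes x :: "real \<Rightarrow> 'a::metric_space"
  assumes x: "cadlag x" and e: "e > 0" and h0: "\<And>n. h n > 0" and h_lim: "h \<longlonglongrightarrow> 0" and r: "r \<longlonglongrightarrow> 0"
    and yc: "\<And>n. cadlag (y n)"
    and yx: "\<And>S. \<forall>\<^sub>F n in sequentially. \<forall>t\<in>{0..S}. dist (y n t) (x (h n * real (nat \<lfloor>t / h n\<rfloor>))) \<le> r n"
  shows "\<forall>\<^sub>F n in sequentially. skorokhod_of (y n) \<in> skorokhod_nbhd (skorokhod_of x) T e \<and>
     skorokhod_of x \<in> skorokhod_nbhd (skorokhod_of (y n)) T e"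
proof -
  obtain n and a :: "nat \<Rightarrow> real" where a: "a 0 = 0" "\<And>i. i < n \<Longrightarrow> a i < a (Suc i)" "T < a n"
    and osc: "\<And>i u v. i < n \<Longrightarrow> a i \<le> u \<Longrightarrow> u < a (Suc i) \<Longrightarrow> a i \<le> v \<Longrightarrow> v < a (Suc i) \<Longrightarrow> dist (x u) (x v) < e / 2"
    by (rule cadlag_partition[OF x half_gt_zero[OF e], of T]) blast
  \<comment> \<open>At most half the shortest interval, so that the shifted points \<open>b i\<close> still increase.\<close>
  define d where "d = Min (insert (e / 2) ((\<lambda>i. (a (Suc i) - a i) / 2) ` {..<n}))"
  have d0: "d > 0" unfolding d_def using e a(2) by (subst Min_gr_iff) auto
  have de: "d \<le> e / 2" unfolding d_def by (rule Min_le) auto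
  have da: "d \<le> (a (Suc i) - a i) / 2" if "i < n" for i unfolding d_def using that by (intro Min_le) auto
  have close: "skorokhod_of y \<in> skorokhod_nbhd (skorokhod_of x) T e \<and> skorokhod_of x \<in> skorokhod_nbhd (skorokhod_of y) T e"
    if h: "0 < h" "h < d" and y: "cadlag y"
      and yx: "\<And>t. 0 \<le> t \<Longrightarrow> t \<le> a n + d \<Longrightarrow> dist (y t) (x (h * real (nat \<lfloor>t / h\<rfloor>))) < e / 2" for h y
  proof -
    define k where "k = (\<lambda>i. nat \<lceil>a i / h\<rceil>)"
    define b where "b = (\<lambda>i. h * real (k i))"
    have a0: "a i \<ge> 0" if "i \<le> n" for i
      using strict_steps_mono[of n a 0 i, OF a(2)] a(1) that by simp
    have kb: "a i / h \<le> real (k i)" "real (k i) < a i / h + 1" if "i \<le> n" for i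
      using divide_nonneg_pos[OF a0[OF that] h(1)] unfolding k_def by linarith+
    have ab: "a i \<le> b i" "b i < a i + h" if "i \<le> n" for i
      using kb[OF that] h unfolding b_def by (simp_all add: field_simps)
    have b0: "b 0 = 0" by (simp add: b_def k_def a)
    have bm: "b i < b (Suc i)" if "i < n" for i
      using ab[of i] ab[of "Suc i"] da[OF that] h that by simp
    have ba: "\<bar>b i - a i\<bar> \<le> d" if "i \<le> n" for i using ab[OF that] h by simp
    have close: "dist (y v) (x u) < e" if i: "i < n" and u: "a i \<le> u" "u < a (Suc i)" and v: "b i \<le> v" "v < b (Suc i)"
      for i u v
    proof -
      define r where "r = nat \<lfloor>v / h\<rfloor>"
      have v0: "v \<ge> 0" using a0[of i] ab[of i] i v by simp
      note rv = grid_floor_bounds[OF h(1) v0, folded r_def]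
      have "h * real (k i) < h * (real r + 1)" using v(1) rv(2) by (simp add: b_def)
      hence "k i \<le> r" using h by simp
      hence 1: "a i \<le> h * real r" using ab(1)[of i] i h
        by (smt (verit) b_def mult_left_mono of_nat_le_iff less_imp_le)
      have "h * real r < h * real (k (Suc i))" using v(2) rv(1) by (simp add: b_def)
      hence "Suc r \<le> k (Suc i)" using h by simp
      hence "h * (real r + 1) \<le> b (Suc i)" using h unfolding b_def by (intro mult_left_mono) auto
      hence 2: "h * real r < a (Suc i)" using ab(2)[of "Suc i"] i by (simp add: algebra_simps)
      have "b (Suc i) \<le> b n" by (rule strict_steps_mono[of n b, OF bm]) (use i in auto)
      hence "v \<le> a n + d" using v(2) ab(2)[of n] h by simp
      hence "dist (y v) (x (h * real r)) < e / 2" unfolding r_def by (intro yx v0)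
      moreover have "dist (x (h * real r)) (x u) < e / 2" by (rule osc[OF i 1 2 u])
      ultimately show ?thesis using dist_triangle[of "y v" "x u" "x (h * real r)"] by simp
    qed
    have bT: "T < b n" using ab(1)[of n] a(3) by simp
    show "skorokhod_of y \<in> skorokhod_nbhd (skorokhod_of x) T e \<and>
       skorokhod_of x \<in> skorokhod_nbhd (skorokhod_of y) T e"
    proof
      show "skorokhod_of y \<in> skorokhod_nbhd (skorokhod_of x) T e"
        by (rule skorokhod_nbhd_of_partitions[OF x y a(1) b0 a(2) bm ba _ a(3)])
           (use close de e in auto)
      show "skorokhod_of x \<in> skorokhod_nbhd (skorokhod_of y) T e"
        by (rule skorokhod_nbhd_of_partitions[OF y x b0 a(1) bm a(2) _ _ bT, where d = d])
           (use close de e ba in \<open>auto simp: dist_commute abs_minus_commute\<close>)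
    qed
  qed
  have "\<forall>\<^sub>F k in sequentially. h k < d" by (rule order_tendstoD(2)[OF h_lim d0])
  moreover have "\<forall>\<^sub>F k in sequentially. r k < e / 2" by (rule order_tendstoD(2)[OF r half_gt_zero[OF e]])
  ultimately show ?thesis using yx[of "a n + d"]
  proof eventually_elim
    case (elim k)
    show ?case by (rule close[OF h0 elim(1) yc], rule order_le_less_trans[OF _ elim(2)]) (use elim(3) in simp)
  qed
qed

lemma cadlag_step_function:
  fixes s :: "nat \<Rightarrow> 'a::metric_space"
  assumes c: "c \<ge> 0"
  shows "cadlag (\<lambda>t. s (nat \<lfloor>c * t\<rfloor>))"
proof (cases "c = 0")
  case True
  thus ?thesis by (auto simp: cadlag_def)
next
  case False
  with c have c: "c > 0" by simp
  show ?thesis unfolding cadlag_def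
  proof safe
    fix t :: real assume t: "t \<ge> 0"
    define k where "k = \<lfloor>c * t\<rfloor>"
    have "t < (of_int k + 1) / c" using c unfolding k_def by (simp add: pos_less_divide_eq mult.commute)
    hence "\<forall>\<^sub>F u in at_right t. u < (of_int k + 1) / c" 
      by (auto simp: eventually_at_right_field)
    moreover have "\<forall>\<^sub>F u in at_right t. t < u" by (simp add: eventually_at_right_less)
    ultimately have "\<forall>\<^sub>F u in at_right t. s (nat \<lfloor>c * t\<rfloor>) = s (nat \<lfloor>c * u\<rfloor>)"
    proof eventually_elim
      case (elim u)
      have "c * u < of_int k + 1" using elim(1) c by (simp add: pos_less_divide_eq mult.commute)
      moreover have "of_int k \<le> c * t" unfolding k_def by simp
      moreover have "c * t \<le> c * u" using elim(2) c by simp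
      ultimately have "\<lfloor>c * u\<rfloor> = k" by linarith
      thus ?case by (simp add: k_def)
    qed
    thus "((\<lambda>t. s (nat \<lfloor>c * t\<rfloor>)) \<longlongrightarrow> s (nat \<lfloor>c * t\<rfloor>)) (at_right t)"
      by (rule Lim_transform_eventually[OF tendsto_const])
  next
    fix t :: real assume t: "t > 0"
    define k where "k = \<lceil>c * t\<rceil> - 1"
    have kk: "of_int k < c * t" "c * t \<le> of_int k + 1" unfolding k_def by linarith+
    have "of_int k / c < t" using kk c by (simp add: pos_divide_less_eq mult.commute)
    hence "\<forall>\<^sub>F u in at_left t. of_int k / c < u" 
      by (auto simp: eventually_at_left_field)
    moreover have "\<forall>\<^sub>F u in at_left t. u < t" by (auto simp: eventually_at_left_field intro: exI[of _ "t - 1"])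
    ultimately have "\<forall>\<^sub>F u in at_left t. s (nat k) = s (nat \<lfloor>c * u\<rfloor>)"
    proof eventually_elim
      case (elim u)
      have "of_int k < c * u" using elim(1) c by (simp add: pos_divide_less_eq mult.commute)
      moreover have "c * u < c * t" using elim(2) c by simp
      ultimately have "\<lfloor>c * u\<rfloor> = k" using kk by linarith
      thus ?case by simp
    qed
    thus "\<exists>l. ((\<lambda>t. s (nat \<lfloor>c * t\<rfloor>)) \<longlongrightarrow> l) (at_left t)"
      by (intro exI, rule Lim_transform_eventually[OF tendsto_const])
  qed
qed

lemma cadlag_grid_step:
  fixes s :: "nat \<Rightarrow> 'a::metric_space"
  assumes "h > 0"
  shows "cadlag (\<lambda>t. s (nat \<lfloor>t / h\<rfloor>))"
  using cadlag_step_function[of "1 / h" s] assms by simp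

section \<open>The group \<open>\<rat>\<^sub>p / \<int>\<^sub>p\<close> and its embeddings\<close>

text \<open>
  The rationals are dense and cosets of \<open>\<int>\<^sub>p\<close> are open.
\<close>

lemma countable_padic_quot: "countable (UNIV :: 'p::prime_card padic_quot set)"
proof -
  have "g \<in> range (\<lambda>r. padic_class (padic_of_rat r))" for g :: "'p padic_quot"
  proof -
    obtain x where x: "g = padic_class x" by (metis Quotient3_abs_rep Quotient3_padic_quot)
    obtain r where "padic_abs (x - padic_of_rat r) < 1" by (rule padic_of_rat_dense[of 1 x]) auto
    hence "padic_class x = padic_class (padic_of_rat r)"
      by (simp add: padic_quot.abs_eq_iff padic_ints_def)
    thus ?thesis using x by simp
  qed
  hence "UNIV = range (\<lambda>r. padic_class (padic_of_rat r) :: 'p padic_quot)" by blast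
  thus ?thesis by (metis countable_image uncountable_def countableI_type)
qed

lemma padic_class_rep [simp]: "padic_class (padic_quot_rep g) = g"
  by (metis Quotient3_abs_rep Quotient3_padic_quot)

lemma padic_class_eq_iff: "padic_class x = padic_class y \<longleftrightarrow> padic_abs (x - y) \<le> 1"
  by (simp add: padic_quot.abs_eq_iff padic_ints_def)

lemma padic_class_add: "padic_class (x + y) = padic_class x + padic_class y"
  by (simp add: plus_padic_quot.abs_eq)

lemma padic_class_diff: "padic_class (x - y) = padic_class x - padic_class y"
  by (simp add: minus_padic_quot.abs_eq)

lemma padic_class_0: "padic_class 0 = 0"
  by (simp add: zero_padic_quot_def)

text \<open>
  The reduction modulo \<open>p ^ m \<int>\<^sub>p\<close>, read in \<open>\<rat>\<^sub>p / \<int>\<^sub>p\<close>. Its section up to an error \<open>p ^ (-m)\<close> is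
  \<^const>\<open>padic_embed\<close> (see \<open>dist_padic_embed_scaled_class\<close>).
\<close>

definition padic_scaled_class :: "nat \<Rightarrow> 'p::prime_card padic \<Rightarrow> 'p padic_quot" where
  "padic_scaled_class m x = padic_class (x / of_nat CARD('p) ^ m)"

lemma padic_scaled_class_diff: "padic_scaled_class m (x - y) = padic_scaled_class m x - padic_scaled_class m y"
  by (simp add: padic_scaled_class_def diff_divide_distrib padic_class_diff)

lemma padic_scaled_class_vimage:
  "padic_scaled_class m -` {g} = padic_cball (- int m) (of_nat CARD('p) ^ m * padic_quot_rep g :: 'p::prime_card padic)"
proof -
  let ?P = "of_nat CARD('p) ^ m :: 'p padic"
  have "padic_scaled_class m x = g \<longleftrightarrow> x \<in> padic_cball (- int m) (?P * padic_quot_rep g)" for x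
  proof -
    have "padic_scaled_class m x = g \<longleftrightarrow> padic_abs (x / ?P - padic_quot_rep g) \<le> 1"
      unfolding padic_scaled_class_def using padic_class_eq_iff[of "x / ?P" "padic_quot_rep g"] by simp
    also have "x / ?P - padic_quot_rep g = (x - ?P * padic_quot_rep g) / ?P" by (simp add: field_simps)
    also have "padic_abs \<dots> = padic_abs (x - ?P * padic_quot_rep g) * real CARD('p) ^ m"
      by (simp add: divide_inverse padic_abs_mult padic_abs_inverse padic_abs_power padic_abs_p power_mult_distrib power_inverse)
    also have "\<dots> \<le> 1 \<longleftrightarrow> padic_abs (x - ?P * padic_quot_rep g) \<le> real CARD('p) powi (- int m)"
      using padic_CARD_gt_1[where 'p='p] by (simp add: power_int_minus field_simps)
    finally show ?thesis by (simp add: padic_cball_def)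
  qed
  thus ?thesis by auto
qed

lemma measurable_padic_quot_iff:
  fixes f :: "'w \<Rightarrow> 'p::prime_card padic_quot"
  assumes "\<And>g. f -` {g} \<inter> space M \<in> sets M"
  shows "f \<in> measurable M (count_space UNIV)"
  using assms by (subst measurable_count_space_eq_countable) (auto simp: countable_padic_quot)

lemma measurable_padic_scaled_class [measurable]:
  "padic_scaled_class m \<in> measurable borel (count_space (UNIV :: 'p::prime_card padic_quot set))"
  by (rule measurable_padic_quot_iff) (simp add: padic_scaled_class_vimage)

lemma measurable_quot_add:
  fixes f g :: "'w \<Rightarrow> 'p::prime_card padic_quot"
  assumes "f \<in> measurable M (count_space UNIV)" "g \<in> measurable M (count_space UNIV)"
  shows "(\<lambda>\<omega>. f \<omega> + g \<omega>) \<in> measurable M (count_space UNIV)"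
  by (rule measurable_compose_countable'[where f = "\<lambda>c \<omega>. c + g \<omega>" and g = f, OF _ assms(1) countable_padic_quot])
     (rule measurable_compose[OF assms(2)], simp)

lemma measurable_quot_sum:
  fixes f :: "'i \<Rightarrow> 'w \<Rightarrow> 'p::prime_card padic_quot"
  assumes "\<And>i. i \<in> A \<Longrightarrow> f i \<in> measurable M (count_space UNIV)"
  shows "(\<lambda>\<omega>. \<Sum>i\<in>A. f i \<omega>) \<in> measurable M (count_space UNIV)"
  using assms by (induction A rule: infinite_finite_induct) (auto intro!: measurable_quot_add)

text \<open>
  On a countable set every probability measure is discrete.
\<close>

lemma distr_countable_eq_pmf:
  fixes f :: "'w \<Rightarrow> 'p::prime_card padic_quot"
  assumes "prob_space M" "f \<in> measurable M (count_space UNIV)"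
  obtains r where "measure_pmf r = distr M (count_space UNIV) f"
proof -
  interpret M: prob_space M by fact
  interpret D: prob_space "distr M (count_space UNIV) f" by (rule M.prob_space_distr[OF assms(2)])
  have "AE g in distr M (count_space UNIV) f. measure (distr M (count_space UNIV) f) {g} \<noteq> 0"
    by (rule D.AE_support_countable[THEN iffD2]) (auto simp: countable_padic_quot intro!: exI[of _ UNIV])
  hence "measure_pmf (Abs_pmf (distr M (count_space UNIV) f)) = distr M (count_space UNIV) f"
    by (intro Abs_pmf_inverse) (use D.prob_space_axioms in auto)
  thus ?thesis by (rule that)
qed

lemma padic_embed_close:
  fixes x :: "'p::prime_card padic"
  shows "padic_abs (padic_embed m (padic_class x) - of_nat CARD('p) ^ m * x) \<le> real CARD('p) powi (- int m)"
proof -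
  define z where "z = of_nat CARD('p) ^ m * x"
  obtain N where N: "\<And>k. k < N \<Longrightarrow> padic_digit z k = 0" using padic_digit_eventually_0 by blast
  let ?f = "\<lambda>k. of_nat (padic_digit z k) * of_nat CARD('p) powi k :: 'p padic"
  have "padic_embed m (padic_class x) = (\<Sum>\<^sub>\<infinity>k\<in>{..<int m}. ?f k)"
    by (simp add: padic_embed.abs_eq z_def)
  also have "\<dots> = (\<Sum>\<^sub>\<infinity>k\<in>{N..<int m}. ?f k)" by (rule infsum_cong_neutral) (auto simp: N)
  also have "\<dots> = (\<Sum>k\<in>{N..<int m}. ?f k)" by simp
  finally show ?thesis
    using padic_expansion_truncate[where a = "padic_digit z" and N = N and m = "int m", OF padic_digit_expansion N]
    by (simp add: z_def padic_abs_diff_commute)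
qed

lemma dist_padic_embed_scaled_class:
  "dist (padic_embed m (padic_scaled_class m x)) x \<le> real CARD('p) powi (- int m)" for x :: "'p::prime_card padic"
  using padic_embed_close[of m "x / of_nat CARD('p) ^ m"] by (simp add: dist_padic_def padic_scaled_class_def)

lemma padic_powi_minus_tendsto_0: "(\<lambda>m. real CARD('p::prime_card) powi (- int m)) \<longlonglongrightarrow> 0"
  using LIMSEQ_inverse_realpow_zero[OF padic_CARD_gt_1[where 'p='p]] by (simp add: power_int_minus)

section \<open>Processes as random elements of the Skorokhod space\<close>

text \<open>
  The Borel sets of the Skorokhod space are generated by an uncountable topology, so evaluation maps alone
  do not obviously suffice. Rounding time and space gives approximations \<open>A n\<close> that depend on
  finitely many coordinates with countably many values, hence take countably many values and are
  measurable for any \<open>\<sigma>\<close>-algebra. Membership of the limit in an open set \<open>U\<close> is then expressed by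
  countably many conditions: for some \<open>k\<close>, almost all \<open>A n\<close> lie in \<^term>\<open>skorokhod_inner U k\<close>.
  This equivalence uses that the approximation is close to the limit and the limit close to it.
\<close>

lemma measurable_skorokhod_of:
  fixes Z :: "real \<Rightarrow> 'w \<Rightarrow> 'p::prime_card padic"
  assumes Z: "\<And>t. t \<ge> 0 \<Longrightarrow> Z t \<in> borel_measurable M"
    and cadlag: "\<And>\<omega>. \<omega> \<in> space M \<Longrightarrow> cadlag (\<lambda>t. Z t \<omega>)"
  shows "(\<lambda>\<omega>. skorokhod_of (\<lambda>t. Z t \<omega>)) \<in> borel_measurable M"
proof -
  \<comment> \<open>At mesh \<open>1 / Suc n\<close>, the index \<open>(Suc n) ^ 2\<close> corresponds to the time \<open>Suc n\<close>.\<close>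
  define c where "c n \<omega> = (\<lambda>j\<in>{..(Suc n)^2}. padic_scaled_class n (Z (1 / Suc n * real j) \<omega>))" for n :: nat and \<omega>
  define \<Psi> where "\<Psi> n v = skorokhod_of (\<lambda>t. padic_embed n (v (min (nat \<lfloor>real (Suc n) * t\<rfloor>) ((Suc n)^2))))"
    for n :: nat and v :: "nat \<Rightarrow> 'p padic_quot"
  define A where "A n \<omega> = \<Psi> n (c n \<omega>)" for n \<omega>
  have c_meas: "c n \<in> measurable M (count_space (PiE {..(Suc n)^2} (\<lambda>_. UNIV)))" for n
  proof -
    have "c n \<in> measurable M (PiM {..(Suc n)^2} (\<lambda>_. count_space (UNIV :: 'p padic_quot set)))"
      unfolding c_def
      by (intro measurable_restrict measurable_compose[OF Z measurable_padic_scaled_class]) simp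
    also have "PiM {..(Suc n)^2} (\<lambda>_. count_space (UNIV :: 'p padic_quot set)) = count_space (PiE {..(Suc n)^2} (\<lambda>_. UNIV))"
      by (intro count_space_PiM_finite) (auto simp: countable_padic_quot)
    finally show ?thesis .
  qed
  have A_meas: "{\<omega>\<in>space M. A n \<omega> \<in> V} \<in> sets M" for n V
  proof -
    have "{\<omega>\<in>space M. A n \<omega> \<in> V} = c n -` ({v. \<Psi> n v \<in> V} \<inter> PiE {..(Suc n)^2} (\<lambda>_. UNIV)) \<inter> space M"
      by (auto simp: A_def c_def)
    also have "\<dots> \<in> sets M" by (rule measurable_sets[OF c_meas]) auto
    finally show ?thesis .
  qed
  have A_conv: "\<forall>\<^sub>F n in sequentially. A n \<omega> \<in> skorokhod_nbhd (skorokhod_of (\<lambda>t. Z t \<omega>)) T e \<and>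
      skorokhod_of (\<lambda>t. Z t \<omega>) \<in> skorokhod_nbhd (A n \<omega>) T e"
    if \<omega>: "\<omega> \<in> space M" and e: "e > 0" for \<omega> T e
    unfolding A_def \<Psi>_def
  proof (rule discretisations_eventually_close[OF cadlag[OF \<omega>] e _ _ padic_powi_minus_tendsto_0])
    show "1 / real (Suc n) > 0" for n by simp
    show "(\<lambda>n. 1 / real (Suc n)) \<longlonglongrightarrow> 0" using LIMSEQ_inverse_real_of_nat by (simp add: inverse_eq_divide)
    let ?y = "\<lambda>n t. padic_embed n (c n \<omega> (min (nat \<lfloor>real (Suc n) * t\<rfloor>) ((Suc n)^2)))"
    show "cadlag (?y n)" for n
      by (rule cadlag_step_function[where s = "\<lambda>j. padic_embed n (c n \<omega> (min j ((Suc n)^2)))"]) simp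
    fix S :: real
    have "\<forall>\<^sub>F n in sequentially. S \<le> real n"
      using eventually_ge_at_top[of "nat \<lceil>S\<rceil>"] by eventually_elim linarith
    thus "\<forall>\<^sub>F n in sequentially. \<forall>t\<in>{0..S}.
        dist (?y n t) (Z (1 / real (Suc n) * real (nat \<lfloor>t / (1 / real (Suc n))\<rfloor>)) \<omega>) \<le> real CARD('p) powi (- int n)"
    proof (eventually_elim, intro ballI)
      fix n t assume n: "S \<le> real n" and t: "t \<in> {0..S}"
      have "real (Suc n) * t \<le> real (Suc n) * real (Suc n)" using t n by (intro mult_left_mono) auto
      hence "real (Suc n) * t \<le> real ((Suc n)^2)" by (simp only: power2_eq_square of_nat_mult)
      hence "\<lfloor>real (Suc n) * t\<rfloor> \<le> int ((Suc n)^2)" by linarith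
      hence m: "min (nat \<lfloor>real (Suc n) * t\<rfloor>) ((Suc n)^2) = nat \<lfloor>real (Suc n) * t\<rfloor>"
        and le: "nat \<lfloor>real (Suc n) * t\<rfloor> \<le> (Suc n)^2" by linarith+
      have yt: "?y n t = padic_embed n (padic_scaled_class n (Z (1 / Suc n * real (nat \<lfloor>real (Suc n) * t\<rfloor>)) \<omega>))"
        unfolding m using le by (simp add: c_def)
      have tn: "t / (1 / real (Suc n)) = real (Suc n) * t" by simp
      show "dist (?y n t) (Z (1 / real (Suc n) * real (nat \<lfloor>t / (1 / real (Suc n))\<rfloor>)) \<omega>) \<le> real CARD('p) powi (- int n)"
        unfolding yt tn by (rule dist_padic_embed_scaled_class)
    qed
  qed
  show ?thesis
  proof (rule borel_measurableI)
    fix U :: "'p padic skorokhod set" assume U: "open U"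
    have "skorokhod_of (\<lambda>t. Z t \<omega>) \<in> U \<longleftrightarrow> (\<exists>k. \<exists>N. \<forall>n\<ge>N. A n \<omega> \<in> skorokhod_inner U k)"
      if \<omega>: "\<omega> \<in> space M" for \<omega>
    proof
      assume "skorokhod_of (\<lambda>t. Z t \<omega>) \<in> U"
      then obtain T e where e: "e > 0" "skorokhod_nbhd (skorokhod_of (\<lambda>t. Z t \<omega>)) T e \<subseteq> U"
        using U unfolding open_skorokhod_def by blast
      obtain k where k: "skorokhod_nbhd (skorokhod_of (\<lambda>t. Z t \<omega>)) T (e / 2) \<subseteq> skorokhod_inner U k"
        by (rule skorokhod_inner_nearby[OF e(2,1)])
      have "\<forall>\<^sub>F n in sequentially. A n \<omega> \<in> skorokhod_inner U k"
        using A_conv[OF \<omega> half_gt_zero[OF e(1)], of T] by eventually_elim (use k in blast)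
      thus "\<exists>k. \<exists>N. \<forall>n\<ge>N. A n \<omega> \<in> skorokhod_inner U k" unfolding eventually_sequentially by blast
    next
      assume "\<exists>k. \<exists>N. \<forall>n\<ge>N. A n \<omega> \<in> skorokhod_inner U k"
      then obtain k N where kN: "\<And>n. n \<ge> N \<Longrightarrow> A n \<omega> \<in> skorokhod_inner U k" by blast
      have pos: "1 / real (Suc k) > 0" by simp
      have "\<forall>\<^sub>F n in sequentially. skorokhod_of (\<lambda>t. Z t \<omega>) \<in> U"
        using A_conv[OF \<omega> pos, of "real k"] eventually_ge_at_top[of N]
      proof eventually_elim
        case (elim n)
        thus ?case using kN[of n] unfolding skorokhod_inner_def by auto
      qed
      thus "skorokhod_of (\<lambda>t. Z t \<omega>) \<in> U" by simp
    qed
    hence "(\<lambda>\<omega>. skorokhod_of (\<lambda>t. Z t \<omega>)) -` U \<inter> space M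
      = (\<Union>k. \<Union>N. \<Inter>n\<in>{N..}. {\<omega>\<in>space M. A n \<omega> \<in> skorokhod_inner U k})"
      by fastforce
    also have "\<dots> \<in> sets M"
      by (intro sets.countable_UN sets.countable_INT'' subsetI) (auto intro!: A_meas sets.countable_INT')
    finally show "(\<lambda>\<omega>. skorokhod_of (\<lambda>t. Z t \<omega>)) -` U \<inter> space M \<in> sets M" .
  qed
qed

text \<open>
  The path that is built from its increments \<open>\<delta>\<close> over the cells of a grid of mesh \<open>h\<close>.
\<close>

definition grid_path :: "real \<Rightarrow> nat \<Rightarrow> (nat \<Rightarrow> 'p::prime_card padic_quot) \<Rightarrow> 'p padic skorokhod" where
  "grid_path h m \<delta> = skorokhod_of (\<lambda>t. padic_embed m (\<Sum>i<nat \<lfloor>t / h\<rfloor>. \<delta> i))"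

lemma measurable_grid_path:
  assumes "h > 0"
  shows "grid_path h m \<in> borel_measurable (PiM UNIV (\<lambda>_. count_space (UNIV :: 'p::prime_card padic_quot set)))"
  unfolding grid_path_def[abs_def]
proof (rule measurable_skorokhod_of)
  fix t :: real
  show "(\<lambda>\<delta>. padic_embed m (\<Sum>i<nat \<lfloor>t / h\<rfloor>. \<delta> i)) \<in> borel_measurable (PiM UNIV (\<lambda>_. count_space (UNIV :: 'p padic_quot set)))"
  proof -
    have "(\<lambda>\<delta>. \<Sum>i<nat \<lfloor>t / h\<rfloor>. \<delta> i) \<in> measurable (PiM UNIV (\<lambda>_. count_space UNIV)) (count_space (UNIV :: 'p padic_quot set))"
      by (rule measurable_quot_sum[where f = "\<lambda>i \<delta>. \<delta> i"]) (rule measurable_component_singleton, simp)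
    thus ?thesis by (rule measurable_compose) simp
  qed
  show "cadlag (\<lambda>t. padic_embed m (\<Sum>i<nat \<lfloor>t / h\<rfloor>. \<delta> i))" for \<delta> :: "nat \<Rightarrow> 'p padic_quot"
    by (rule cadlag_grid_step[OF assms])
qed

text \<open>
  Sampling a fixed cadlag path moves it little in \<open>J\<^sub>1\<close> once the mesh is small, and \<^const>\<open>padic_embed\<close>
  rounds its values by at most \<open>p ^ (-m)\<close>.
\<close>

lemma sampled_path_LIMSEQ:
  fixes Y :: "real \<Rightarrow> 'p::prime_card padic"
  assumes Y: "cadlag Y" and h0: "\<And>m. h m > 0" and h: "h \<longlonglongrightarrow> 0"
  shows "(\<lambda>m. skorokhod_of (\<lambda>t. padic_embed m (padic_scaled_class m (Y (h m * real (nat \<lfloor>t / h m\<rfloor>))))))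
    \<longlonglongrightarrow> skorokhod_of Y"
proof (rule skorokhod_LIMSEQ_I)
  fix T e :: real assume e: "e > 0"
  let ?y = "\<lambda>m t. padic_embed m (padic_scaled_class m (Y (h m * real (nat \<lfloor>t / h m\<rfloor>))))"
  have cad: "cadlag (?y m)" for m
    by (rule cadlag_grid_step[OF h0, where s = "\<lambda>r. padic_embed m (padic_scaled_class m (Y (h m * real r)))"])
  have "\<forall>\<^sub>F m in sequentially. skorokhod_of (?y m) \<in> skorokhod_nbhd (skorokhod_of Y) T e \<and>
      skorokhod_of Y \<in> skorokhod_nbhd (skorokhod_of (?y m)) T e"
    by (rule discretisations_eventually_close[OF Y e h0 h padic_powi_minus_tendsto_0[where 'p = 'p] cad])
       (simp add: dist_padic_embed_scaled_class)
  thus "\<forall>\<^sub>F m in sequentially. skorokhod_of (?y m) \<in> skorokhod_nbhd (skorokhod_of Y) T e"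
    by eventually_elim simp
qed

lemma grid_path_sampled:
  assumes "Y 0 = 0"
  shows "grid_path h m (\<lambda>i. padic_scaled_class m (Y (h * real (Suc i)) - Y (h * real i)))
    = skorokhod_of (\<lambda>t. padic_embed m (padic_scaled_class m (Y (h * real (nat \<lfloor>t / h\<rfloor>)))))"
proof -
  have "(\<Sum>i<n. padic_scaled_class m (Y (h * real (Suc i)) - Y (h * real i))) = padic_scaled_class m (Y (h * real n))" for n
    unfolding padic_scaled_class_diff
    by (subst sum_lessThan_telescope) (simp add: assms padic_scaled_class_def padic_class_0)
  thus ?thesis by (simp only: grid_path_def)
qed

section \<open>Weak limits by coupling\<close>

text \<open>
  The interior is taken because preimages of open sets are measurable.
\<close>

definition steady_paths :: "('a::metric_space skorokhod \<Rightarrow> real) \<Rightarrow> real \<Rightarrow> nat \<Rightarrow> 'a skorokhod set" where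
  "steady_paths f \<eta> k = interior {z. \<forall>y\<in>skorokhod_nbhd z (real k) (1 / Suc k). \<bar>f y - f z\<bar> \<le> \<eta>}"

text \<open>
  Continuity at \<open>x\<close> controls \<open>f\<close> on a whole neighbourhood of \<open>x\<close>, hence also its variation around every
  path near \<open>x\<close>.
\<close>

lemma continuous_uniform_on_nbhds:
  fixes f :: "'a::metric_space skorokhod \<Rightarrow> real"
  assumes f: "continuous_on UNIV f" and eta: "\<eta> > 0"
  obtains k where "x \<in> steady_paths f \<eta> k"
proof -
  have "(f \<longlongrightarrow> f x) (nhds x)"
    using continuous_on_tendsto_compose[OF f filterlim_ident[of "nhds x"]] by simp
  hence "\<forall>\<^sub>F z in nhds x. dist (f z) (f x) < \<eta> / 2" using eta by (intro tendstoD) auto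
  then obtain T e where e: "e > 0" "\<And>z. z \<in> skorokhod_nbhd x T e \<Longrightarrow> \<bar>f z - f x\<bar> < \<eta> / 2"
    unfolding eventually_nhds_skorokhod dist_real_def by blast
  obtain k where k: "skorokhod_nbhd x T (e / 2) \<subseteq> skorokhod_inner {z. \<bar>f z - f x\<bar> < \<eta> / 2} k"
    by (rule skorokhod_inner_nearby[OF _ e(1), of x T "{z. \<bar>f z - f x\<bar> < \<eta> / 2}"]) (use e(2) in auto)
  have "\<bar>f y - f z\<bar> \<le> \<eta>"
    if z: "z \<in> skorokhod_nbhd x T (e / 2)" and y: "y \<in> skorokhod_nbhd z (real k) (1 / Suc k)" for y z
  proof -
    have "skorokhod_nbhd z (real k) (1 / Suc k) \<subseteq> {z. \<bar>f z - f x\<bar> < \<eta> / 2}"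
      using k z by (auto simp: skorokhod_inner_def)
    moreover have "z \<in> skorokhod_nbhd z (real k) (1 / Suc k)" by (rule skorokhod_nbhd_refl) simp
    ultimately have "\<bar>f y - f x\<bar> < \<eta> / 2" "\<bar>f z - f x\<bar> < \<eta> / 2" using y by auto
    thus ?thesis by linarith
  qed
  hence "\<forall>\<^sub>F z in nhds x. \<forall>y\<in>skorokhod_nbhd z (real k) (1 / Suc k). \<bar>f y - f z\<bar> \<le> \<eta>"
    unfolding eventually_nhds_skorokhod using e(1) by (intro exI[of _ T] exI[of _ "e / 2"]) auto
  hence "x \<in> steady_paths f \<eta> k"
    unfolding steady_paths_def interior_def eventually_nhds by blast
  thus ?thesis by (rule that)
qed

text \<open>
  \<open>A k\<close> is the event that \<open>Q m\<close>, for all \<open>m \<ge> k\<close>, is a path around which \<open>f\<close> varies by at most \<open>\<eta>\<close> on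
  neighbourhoods of size \<open>k\<close> (see \<^const>\<open>skorokhod_inner\<close>). These events exhaust the space because \<open>Q m\<close> converges pathwise. One \<open>k\<close>
  therefore serves all large \<open>m\<close> up to probability \<open>\<eta>\<close>.
  The law of \<open>P m\<close> inherits it, and there \<open>Z m\<close> can be compared with \<open>P m\<close>.
\<close>

lemma weak_limit_by_coupling:
  fixes f :: "'a::metric_space skorokhod \<Rightarrow> real"
    and Z P :: "nat \<Rightarrow> 'm \<Rightarrow> 'a skorokhod" and Q :: "nat \<Rightarrow> 'w \<Rightarrow> 'a skorokhod"
  assumes M: "\<And>m. prob_space (M m)" and N: "prob_space N"
    and Z: "\<And>m. Z m \<in> borel_measurable (M m)" and P: "\<And>m. P m \<in> borel_measurable (M m)"
    and Q: "\<And>m. Q m \<in> borel_measurable N" and W: "W \<in> borel_measurable N"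
    and law: "\<And>m. distr (M m) borel (P m) = distr N borel (Q m)"
    and lim: "\<And>\<omega>. \<omega> \<in> space N \<Longrightarrow> (\<lambda>m. Q m \<omega>) \<longlonglongrightarrow> W \<omega>"
    and close: "\<And>T e \<eta>. e > 0 \<Longrightarrow> \<eta> > 0 \<Longrightarrow> \<forall>\<^sub>F m in sequentially. \<exists>G\<in>sets (M m).
       measure (M m) G \<ge> 1 - \<eta> \<and> (\<forall>z\<in>G. Z m z \<in> skorokhod_nbhd (P m z) T e)"
    and f: "continuous_on UNIV f" and B: "\<And>x. \<bar>f x\<bar> \<le> B"
  shows "(\<lambda>m. LINT z|M m. f (Z m z)) \<longlonglongrightarrow> (LINT \<omega>|N. f (W \<omega>))"
proof -
  interpret N: prob_space N by fact
  have fm: "f \<in> borel_measurable borel" using f by (rule borel_measurable_continuous_onI)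
  have B0: "B \<ge> 0" using B[of undefined] by linarith
  have "(\<lambda>m. LINT \<omega>|N. f (Q m \<omega>)) \<longlonglongrightarrow> (LINT \<omega>|N. f (W \<omega>))"
  proof (rule integral_dominated_convergence[where w = "\<lambda>_. B"])
    have "(\<lambda>m. f (Q m \<omega>)) \<longlonglongrightarrow> f (W \<omega>)" if "\<omega> \<in> space N" for \<omega>
      using continuous_on_tendsto_compose[OF f lim[OF that]] by simp
    thus "AE \<omega> in N. (\<lambda>m. f (Q m \<omega>)) \<longlonglongrightarrow> f (W \<omega>)" by auto
  qed (auto intro!: measurable_compose[OF Q fm] measurable_compose[OF W fm] simp: B)
  moreover have "(LINT z|M m. f (P m z)) = (LINT \<omega>|N. f (Q m \<omega>))" for m
    using integral_distr[OF P fm] integral_distr[OF Q fm] law by metis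
  ultimately have limP: "(\<lambda>m. LINT z|M m. f (P m z)) \<longlonglongrightarrow> (LINT \<omega>|N. f (W \<omega>))" by simp
  have diff: "\<forall>\<^sub>F m in sequentially. \<bar>(LINT z|M m. f (Z m z)) - (LINT z|M m. f (P m z))\<bar> \<le> \<eta> * (1 + 4 * B)"
    if eta: "\<eta> > 0" for \<eta>
  proof -
    let ?U = "steady_paths f \<eta>"
    have Um: "?U k \<subseteq> ?U l" if "k \<le> l" for k l
      using skorokhod_nbhd_mono[of "real k" "real l" "1 / Suc l" "1 / Suc k"] that
      unfolding steady_paths_def by (intro interior_mono) (force simp: frac_le)
    have [measurable]: "?U k \<in> sets borel" and U_open: "open (?U k)" for k by (simp_all add: steady_paths_def)
    define A where "A k = {\<omega>\<in>space N. \<forall>m\<ge>k. Q m \<omega> \<in> ?U k}" for k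
    have A: "A k \<in> sets N" for k
    proof -
      have "{\<omega>\<in>space N. Q m \<omega> \<in> ?U k} \<in> sets N" for m
        by (rule measurable_sets_Collect[OF Q]) simp
      thus ?thesis unfolding A_def by (intro sets.sets_Collect_countable_All sets.sets_Collect_imp) auto
    qed
    have "incseq A"
    proof (rule incseq_SucI, rule subsetI)
      fix k \<omega> assume "\<omega> \<in> A k"
      thus "\<omega> \<in> A (Suc k)" using Um[of k "Suc k"] by (auto simp: A_def)
    qed
    moreover have "(\<Union>k. A k) = space N"
    proof
      show "space N \<subseteq> (\<Union>k. A k)"
      proof
        fix \<omega> assume \<omega>: "\<omega> \<in> space N"
        obtain k where k: "W \<omega> \<in> ?U k"
          using continuous_uniform_on_nbhds[OF f eta, of "W \<omega>"] by blast
        have "\<forall>\<^sub>F m in sequentially. Q m \<omega> \<in> ?U k"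
          by (rule topological_tendstoD[OF lim[OF \<omega>] U_open k])
        then obtain m0 where m0: "\<And>m. m \<ge> m0 \<Longrightarrow> Q m \<omega> \<in> ?U k"
          unfolding eventually_sequentially by blast
        have "\<omega> \<in> A (max k m0)"
          using \<omega> m0 Um[of k "max k m0"] by (auto simp: A_def)
        thus "\<omega> \<in> (\<Union>k. A k)" by blast
      qed
    qed (auto simp: A_def)
    ultimately have "(\<lambda>k. N.prob (A k)) \<longlonglongrightarrow> 1"
      using N.finite_Lim_measure_incseq[of A] A by (auto simp: N.prob_space)
    hence "\<forall>\<^sub>F k in sequentially. 1 - \<eta> < N.prob (A k)" using eta by (intro order_tendstoD) auto
    then obtain k where k: "1 - \<eta> < N.prob (A k)" unfolding eventually_sequentially by blast
    have PU: "measure (M m) {z\<in>space (M m). P m z \<in> ?U k} \<ge> 1 - \<eta>" if "m \<ge> k" for m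
    proof -
      have "measure (M m) {z\<in>space (M m). P m z \<in> ?U k} = measure (distr (M m) borel (P m)) (?U k)"
        by (subst measure_distr[OF P]) (auto intro!: arg_cong2[where f = measure])
      also have "\<dots> = N.prob {\<omega>\<in>space N. Q m \<omega> \<in> ?U k}"
        unfolding law by (subst measure_distr[OF Q]) (auto intro!: arg_cong2[where f = measure])
      also have "\<dots> \<ge> N.prob (A k)"
        by (rule N.finite_measure_mono) (use that in \<open>auto simp: A_def intro!: measurable_sets_Collect[OF Q]\<close>)
      finally show ?thesis using k by simp
    qed
    have e: "1 / real (Suc k) > 0" by simp
    show ?thesis
      using close[OF e eta, of "real k"] eventually_ge_at_top[of k]
    proof eventually_elim
      case (elim m)
      interpret M: prob_space "M m" by (rule M)
      obtain G where G: "G \<in> sets (M m)" "M.prob G \<ge> 1 - \<eta>"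
        "\<And>z. z \<in> G \<Longrightarrow> Z m z \<in> skorokhod_nbhd (P m z) (real k) (1 / Suc k)" using elim(1) by blast
      let ?V = "{z\<in>space (M m). P m z \<in> ?U k}"
      have V: "?V \<in> sets (M m)" by (rule measurable_sets_Collect[OF P]) simp
      define H where "H = space (M m) - G \<inter> ?V"
      have H: "H \<in> sets (M m)" unfolding H_def using G(1) V by auto
      have "M.prob H \<le> M.prob (space (M m) - G) + M.prob (space (M m) - ?V)"
      proof -
        have "H = (space (M m) - G) \<union> (space (M m) - ?V)" by (auto simp: H_def)
        thus ?thesis using G(1) V by (simp add: measure_Un_le)
      qed
      also have "\<dots> \<le> 2 * \<eta>"
        using G(2) PU[OF elim(2)] by (simp add: M.prob_compl[OF G(1)] M.prob_compl[OF V])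
      finally have pH: "M.prob H \<le> 2 * \<eta>" .
      have int: "integrable (M m) (\<lambda>z. f (Z m z))" "integrable (M m) (\<lambda>z. f (P m z))"
        by (rule M.integrable_const_bound[where B = B];
            use measurable_compose[OF Z fm] measurable_compose[OF P fm] in \<open>simp add: B\<close>)+
      \<comment> \<open>Off \<open>H\<close> the difference is at most \<open>\<eta>\<close>, and on \<open>H\<close> at most \<open>2 * B\<close>.\<close>
      have intH: "integrable (M m) (\<lambda>z. \<eta> + 2 * B * indicator H z)"
        using H by (intro Bochner_Integration.integrable_add integrable_mult_right) (auto simp: M.emeasure_eq_measure)
      have "\<bar>(LINT z|M m. f (Z m z)) - (LINT z|M m. f (P m z))\<bar> = \<bar>LINT z|M m. f (Z m z) - f (P m z)\<bar>"
        using int by simp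
      also have "\<dots> \<le> (LINT z|M m. \<bar>f (Z m z) - f (P m z)\<bar>)" by (rule integral_abs_bound)
      also have "\<dots> \<le> (LINT z|M m. \<eta> + 2 * B * indicator H z)"
      proof (rule integral_mono)
        fix z assume z: "z \<in> space (M m)"
        show "\<bar>f (Z m z) - f (P m z)\<bar> \<le> \<eta> + 2 * B * indicator H z"
        proof (cases "z \<in> H")
          case True
          thus ?thesis using B[of "Z m z"] B[of "P m z"] eta by (simp add: indicator_def)
        next
          case False
          hence "z \<in> G" "P m z \<in> ?U k" using z by (auto simp: H_def)
          hence "\<bar>f (Z m z) - f (P m z)\<bar> \<le> \<eta>"
            using G(3) interior_subset unfolding steady_paths_def by blast
          thus ?thesis using False by simp
        qed
      qed (use int intH in auto)
      also have "\<dots> = \<eta> + 2 * B * M.prob H"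
        using H by (subst Bochner_Integration.integral_add) (auto simp: M.prob_space M.emeasure_eq_measure)
      also have "\<dots> \<le> \<eta> + 2 * B * (2 * \<eta>)" using pH B0 by (intro add_left_mono mult_left_mono) auto
      finally show ?case by (simp add: algebra_simps)
    qed
  qed
  have "(\<lambda>m. (LINT z|M m. f (Z m z)) - (LINT z|M m. f (P m z))) \<longlonglongrightarrow> 0"
  proof (rule tendstoI)
    fix r :: real assume r: "r > 0"
    define C where "C = 1 + 4 * B"
    have C: "C > 0" using B0 by (simp add: C_def)
    define \<eta> where "\<eta> = r / (2 * C)"
    have "\<eta> > 0" "\<eta> * C < r" using r C by (simp_all add: \<eta>_def)
    hence "\<eta> > 0" "\<eta> * (1 + 4 * B) < r" by (simp_all add: C_def)
    with diff[of \<eta>] show "\<forall>\<^sub>F m in sequentially. dist ((LINT z|M m. f (Z m z)) - (LINT z|M m. f (P m z))) 0 < r"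
      by (auto elim!: eventually_mono simp: dist_real_def)
  qed
  from tendsto_add[OF this limP] show ?thesis by simp
qed

section \<open>The additive character\<close>

lemma padic_powi_minus_nat: "real CARD('p::prime_card) powi (- int N) = (1 / real CARD('p)) ^ N"
  by (simp add: power_int_minus power_one_over inverse_eq_divide)

lemma padic_abs_of_int_le_imp_dvd:
  assumes "padic_abs (of_int n :: 'p::prime_card padic) \<le> real CARD('p) powi (- int N)"
  shows "int CARD('p) ^ N dvd n"
  using assms
proof (induction N)
  case (Suc N)
  have p1: "real CARD('p) > 1" by (rule padic_CARD_gt_1)
  have "real CARD('p) powi (- int (Suc N)) \<le> real CARD('p) powi (- int N)"
    by (simp only: padic_powi_le_iff)
  with Suc have "int CARD('p) ^ N dvd n" by (meson order_trans)
  then obtain k where k: "n = int CARD('p) ^ N * k" by blast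
  have "padic_abs (of_int n :: 'p padic) = (1 / real CARD('p)) ^ N * padic_abs (of_int k :: 'p padic)"
    by (simp add: k padic_abs_mult padic_abs_power padic_abs_p)
  with Suc.prems have "(1 / real CARD('p)) ^ N * padic_abs (of_int k :: 'p padic) \<le> (1 / real CARD('p)) ^ N * (1 / real CARD('p))"
    unfolding padic_powi_minus_nat by (simp only: power_Suc2)
  hence "padic_abs (of_int k :: 'p padic) \<le> 1 / real CARD('p)"
    by (rule mult_left_le_imp_le) (use p1 in simp)
  also have "\<dots> < 1" using p1 by simp
  finally have "int CARD('p) dvd k" by (simp add: padic_abs_of_int_less_1_iff)
  thus ?case by (simp add: k mult.commute mult_dvd_mono)
qed simp

lemma padic_frac_eq_rational:
  fixes x :: "'p::prime_card padic"
  obtains n N :: nat where "padic_frac x = real n / real CARD('p) ^ N"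
    "padic_abs (x - of_nat n / of_nat CARD('p) ^ N) \<le> 1"
proof -
  obtain L where L: "\<And>k. k < L \<Longrightarrow> padic_digit x k = 0" using padic_digit_eventually_0 by blast
  define N where "N = nat (- L)"
  have N: "padic_digit x k = 0" if "k < - int N" for k using that L by (cases "L \<le> 0") (auto simp: N_def)
  define n where "n = (\<Sum>j<N. padic_digit x (int j - int N) * CARD('p) ^ j)"
  have reindex: "(\<Sum>k\<in>{- int N..<0}. f k) = (\<Sum>j<N. f (int j - int N))" for f :: "int \<Rightarrow> 'c::comm_monoid_add"
    by (rule sum.reindex_bij_witness[of _ "\<lambda>j. int j - int N" "\<lambda>k. nat (k + int N)"]) auto
  have "padic_frac x = (\<Sum>\<^sub>\<infinity>k\<in>{- int N..<0}. real (padic_digit x k) * real CARD('p) powi k)"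
    unfolding padic_frac_def by (rule infsum_cong_neutral) (auto simp: N)
  also have "\<dots> = (\<Sum>j<N. real (padic_digit x (int j - int N)) * real CARD('p) powi (int j - int N))"
    by (simp add: reindex)
  also have "\<dots> = real n / real CARD('p) ^ N"
    by (simp add: n_def sum_divide_distrib power_int_diff)
  finally have 1: "padic_frac x = real n / real CARD('p) ^ N" .
  have "padic_abs (x - (\<Sum>k\<in>{- int N..<0}. of_nat (padic_digit x k) * of_nat CARD('p) powi k)) \<le> real CARD('p) powi (- 0)"
    by (rule padic_expansion_truncate[OF padic_digit_expansion N])
  also have "(\<Sum>k\<in>{- int N..<0}. of_nat (padic_digit x k) * of_nat CARD('p) powi k) = (of_nat n / of_nat CARD('p) ^ N :: 'p padic)"
    by (simp add: reindex n_def sum_divide_distrib power_int_diff)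
  finally show ?thesis using that[OF 1] by simp
qed

text \<open>
  The character may be computed from any rational with denominator a power of \<open>p\<close> that is congruent to \<open>x\<close>
  modulo \<open>\<int>\<^sub>p\<close>, because a rational of this kind which lies in \<open>\<int>\<^sub>p\<close> is an integer. All algebraic
  properties of the character follow from this freedom.
\<close>

lemma padic_char_eq_cis:
  fixes x :: "'p::prime_card padic"
  assumes "padic_abs (x - of_int n / of_nat CARD('p) ^ N) \<le> 1"
  shows "padic_char x = cis (2 * pi * (of_int n / real CARD('p) ^ N))"
proof -
  let ?p = "of_nat CARD('p) :: 'p padic"
  have p1: "real CARD('p) > 1" by (rule padic_CARD_gt_1)
  obtain n' N' :: nat where n': "padic_frac x = real n' / real CARD('p) ^ N'"
    "padic_abs (x - of_nat n' / ?p ^ N') \<le> 1" by (rule padic_frac_eq_rational)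
  define k where "k = int n' * int CARD('p) ^ N - n * int CARD('p) ^ N'"
  have "(x - of_int n / ?p ^ N) - (x - of_nat n' / ?p ^ N') = of_int k / ?p ^ (N + N')"
    by (simp add: k_def field_simps power_add)
  with padic_abs_diff_le[OF assms n'(2)] have "padic_abs (of_int k / ?p ^ (N + N')) \<le> 1" by (simp only:)
  hence "padic_abs (of_int k :: 'p padic) * real CARD('p) ^ (N + N') \<le> 1"
    by (simp add: divide_inverse padic_abs_mult padic_abs_inverse padic_abs_power padic_abs_p power_mult_distrib power_inverse power_one_over)
  hence "padic_abs (of_int k :: 'p padic) \<le> real CARD('p) powi (- int (N + N'))"
    unfolding padic_powi_minus_nat using p1 by (simp add: power_one_over field_simps)
  hence "int CARD('p) ^ (N + N') dvd k" by (rule padic_abs_of_int_le_imp_dvd)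
  then obtain j where j: "k = int CARD('p) ^ (N + N') * j" by blast
  have "real_of_int k = real CARD('p) ^ (N + N') * of_int j" by (simp add: j)
  hence "padic_frac x = of_int n / real CARD('p) ^ N + of_int j"
    using p1 unfolding n'(1) k_def by (simp add: field_simps power_add)
  hence "padic_char x = cis (2 * pi * (of_int n / real CARD('p) ^ N) + 2 * pi * of_int j)"
    by (simp add: padic_char_def cis_conv_exp algebra_simps)
  also have "\<dots> = cis (2 * pi * (of_int n / real CARD('p) ^ N)) * cis (2 * pi * of_int j)"
    by (rule cis_mult[symmetric])
  finally show ?thesis by (simp only: cis_multiple_2pi[OF Ints_of_int] mult_1_right)
qed

lemma padic_approx_rational:
  fixes x :: "'p::prime_card padic"
  obtains n :: int and N where "padic_abs (x - of_int n / of_nat CARD('p) ^ N) \<le> 1"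
  using padic_frac_eq_rational[of x] by (metis of_int_of_nat_eq)

lemma padic_char_add: "padic_char (x + y) = padic_char x * padic_char (y :: 'p::prime_card padic)"
proof -
  let ?p = "of_nat CARD('p) :: 'p padic"
  have p1: "real CARD('p) > 1" by (rule padic_CARD_gt_1)
  obtain n N where n: "padic_abs (x - of_int n / ?p ^ N) \<le> 1" by (rule padic_approx_rational)
  obtain k K where k: "padic_abs (y - of_int k / ?p ^ K) \<le> 1" by (rule padic_approx_rational)
  have "(x - of_int n / ?p ^ N) + (y - of_int k / ?p ^ K)
      = x + y - of_int (n * int CARD('p) ^ K + k * int CARD('p) ^ N) / ?p ^ (N + K)"
    by (simp add: field_simps power_add)
  with padic_abs_add_le[OF n k]
  have "padic_abs (x + y - of_int (n * int CARD('p) ^ K + k * int CARD('p) ^ N) / ?p ^ (N + K)) \<le> 1"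
    by (simp only:)
  from padic_char_eq_cis[OF this] show ?thesis
    using p1 by (simp add: padic_char_eq_cis[OF n] padic_char_eq_cis[OF k] cis_mult field_simps power_add)
qed

lemma padic_char_int: "padic_abs x \<le> 1 \<Longrightarrow> padic_char x = 1"
  using padic_char_eq_cis[of x 0 0] by simp

lemma norm_padic_char [simp]: "norm (padic_char x) = 1"
  by (simp add: padic_char_def norm_exp)

lemma padic_char_minus: "padic_char (- x) = cnj (padic_char x)"
proof -
  have "padic_char (- x) * padic_char x = 1"
    by (simp add: padic_char_int flip: padic_char_add)
  moreover have "cnj (padic_char x) * padic_char x = 1"
    using complex_norm_square[of "padic_char x"] by (simp add: mult.commute)
  ultimately show ?thesis by (metis mult_cancel_right mult_zero_right zero_neq_one)
qed

lemma padic_char_inverse_p: "padic_char (1 / of_nat CARD('p) :: 'p::prime_card padic) \<noteq> 1"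
proof
  have p1: "real CARD('p) > 1" by (rule padic_CARD_gt_1)
  assume "padic_char (1 / of_nat CARD('p) :: 'p padic) = 1"
  moreover have "padic_char (1 / of_nat CARD('p) :: 'p padic) = cis (2 * pi * (1 / real CARD('p)))"
    using padic_char_eq_cis[of "1 / of_nat CARD('p) :: 'p padic" 1 1] by simp
  ultimately have "cis (2 * pi * (1 / real CARD('p))) = 1" by simp
  hence "cos (2 * pi * (1 / real CARD('p))) = 1" by (metis cis.sel(1) one_complex.sel(1))
  then obtain k :: int where k: "2 * pi * (1 / real CARD('p)) = of_int k * 2 * pi"
    unfolding cos_one_2pi_int by blast
  hence "2 * pi * (1 / real CARD('p)) = 2 * pi * of_int k" by (simp only: mult.commute mult.left_commute)
  hence "of_int k = 1 / real CARD('p)" by (subst (asm) mult_cancel_left) auto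
  hence "0 < real_of_int k" "real_of_int k < 1" using p1 by auto
  hence "0 < k" "k < 1" by simp_all
  thus False by simp
qed

text \<open>
  The pairing is locally constant: in
  \<open>x * y = x0 * y0 + (x - x0) * y0 + (y - y0) * x0 + (x - x0) * (y - y0)\<close> the last three terms are
  \<open>p\<close>-adic integers when \<open>(x, y)\<close> is close to \<open>(x0, y0)\<close>.
\<close>

lemma padic_char_mult_tendsto:
  "((\<lambda>(x, y). padic_char (x * y :: 'p::prime_card padic)) \<longlongrightarrow> padic_char (x0 * y0)) (nhds x0 \<times>\<^sub>F nhds y0)"
proof (rule tendsto_eventually)
  have near: "\<forall>\<^sub>F x in nhds x0. padic_abs (x - x0) \<le> 1 \<and> padic_abs (x - x0) * c \<le> 1" if "c \<ge> 0" for x0 :: "'p padic" and c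
  proof -
    have pos: "1 / (c + 1) > 0" using that by simp
    have "\<forall>\<^sub>F x in nhds x0. dist x x0 < 1 / (c + 1)" by (rule tendstoD[OF filterlim_ident pos])
    thus ?thesis
    proof eventually_elim
      case (elim x)
      hence "padic_abs (x - x0) * (c + 1) \<le> 1" using that by (simp add: dist_padic_def field_simps)
      moreover have "padic_abs (x - x0) * c \<ge> 0" using that by simp
      moreover have "padic_abs (x - x0) \<ge> 0" by simp
      ultimately show ?case unfolding distrib_left by linarith
    qed
  qed
  have "\<forall>\<^sub>F z in nhds x0 \<times>\<^sub>F nhds y0.
      (padic_abs (fst z - x0) \<le> 1 \<and> padic_abs (fst z - x0) * padic_abs y0 \<le> 1) \<and>
      (padic_abs (snd z - y0) \<le> 1 \<and> padic_abs (snd z - y0) * padic_abs x0 \<le> 1)"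
    by (intro eventually_conj eventually_compose_filterlim[OF near filterlim_fst]
          eventually_compose_filterlim[OF near filterlim_snd]) simp_all
  thus "\<forall>\<^sub>F z in nhds x0 \<times>\<^sub>F nhds y0. (case z of (x, y) \<Rightarrow> padic_char (x * y)) = padic_char (x0 * y0)"
  proof eventually_elim
    case (elim z)
    obtain x y where z: "z = (x, y)" by (cases z)
    have "x * y = x0 * y0 + (((x - x0) * y0 + (y - y0) * x0) + (x - x0) * (y - y0))"
      by (simp add: algebra_simps)
    moreover have "padic_abs (((x - x0) * y0 + (y - y0) * x0) + (x - x0) * (y - y0)) \<le> 1"
      using elim by (intro padic_abs_add_le) (auto simp: z padic_abs_mult intro: mult_le_one)
    ultimately have "padic_char (x * y) = padic_char (x0 * y0)"
      using padic_char_add padic_char_int by (metis mult_1_right)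
    thus ?case by (simp add: z)
  qed
qed

lemma borel_measurable_padic_char_mult [measurable]:
  "(\<lambda>(x, y). padic_char (x * y :: 'p::prime_card padic)) \<in> borel_measurable (borel \<Otimes>\<^sub>M borel)"
  unfolding borel_prod
proof (rule borel_measurable_continuous_onI)
  show "continuous_on UNIV (\<lambda>(x, y). padic_char (x * y :: 'p padic))"
    unfolding continuous_on_def
  proof safe
    fix x y :: "'p padic"
    have "((\<lambda>(x, y). padic_char (x * y)) \<longlongrightarrow> padic_char (x * y)) (nhds (x, y))"
      using padic_char_mult_tendsto[of x y] by (simp add: nhds_prod)
    thus "((\<lambda>(x, y). padic_char (x * y)) \<longlongrightarrow> padic_char (x * y)) (at (x, y) within UNIV)"
      by (rule filterlim_mono[OF _ order_refl]) (simp add: at_within_def)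
  qed
qed

lemma measurable_padic_char_mult:
  "(\<lambda>x. padic_char (x * y :: 'p::prime_card padic)) \<in> borel_measurable borel"
  "(\<lambda>x. padic_char (y * x :: 'p::prime_card padic)) \<in> borel_measurable borel"
proof -
  show "(\<lambda>x. padic_char (x * y)) \<in> borel_measurable borel"
    using measurable_compose[OF measurable_Pair1' borel_measurable_padic_char_mult, of y] 
      measurable_compose[OF measurable_Pair2' borel_measurable_padic_char_mult, of y] by simp
  show "(\<lambda>x. padic_char (y * x)) \<in> borel_measurable borel"
    using measurable_compose[OF measurable_Pair1' borel_measurable_padic_char_mult, of y] by simp
qed

section \<open>Integrals of characters over balls\<close>

lemma sets_padic_haar [simp, measurable_cong]: "sets (padic_haar :: 'p::prime_card padic measure) = sets borel"
  using is_padic_haar_padic_haar[where 'a='p] by (simp add: is_padic_haar_def)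

lemma space_padic_haar [simp]: "space (padic_haar :: 'p::prime_card padic measure) = UNIV"
  using sets_eq_imp_space_eq[OF sets_padic_haar[where 'p='p]] by simp

lemma emeasure_padic_haar_cball [simp]:
  "emeasure padic_haar (padic_cball k x :: 'p::prime_card padic set) = ennreal (real CARD('p) powi k)"
  by (rule padic_haar_cball[OF is_padic_haar_padic_haar])

lemma measure_padic_haar_cball [simp]:
  "measure padic_haar (padic_cball k x :: 'p::prime_card padic set) = real CARD('p) powi k"
  using padic_powi_pos[of k, where 'p='p] by (simp add: measure_def)

lemma sigma_finite_padic_haar: "sigma_finite_measure (padic_haar :: 'p::prime_card padic measure)"
proof
  have "\<exists>n. x \<in> padic_cball (int n) 0" for x :: "'p padic"
    using real_arch_pow[OF padic_CARD_gt_1[where 'p='p], of "padic_abs x"]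
    by (auto simp: padic_cball_def intro: less_imp_le)
  hence "(\<Union>n. padic_cball (int n) (0 :: 'p padic)) = UNIV" by auto
  thus "\<exists>A. countable A \<and> A \<subseteq> sets padic_haar \<and> \<Union>A = space padic_haar \<and>
      (\<forall>a\<in>A. emeasure (padic_haar :: 'p padic measure) a \<noteq> \<infinity>)"
    by (intro exI[of _ "range (\<lambda>n. padic_cball (int n) (0 :: 'p padic))"]) auto
qed

lemma distr_padic_haar_translate:
  "distr padic_haar borel ((+) a) = (padic_haar :: 'p::prime_card padic measure)"
proof (rule measure_eqI)
  fix A assume "A \<in> sets (distr padic_haar borel ((+) a))"
  hence A: "A \<in> sets borel" by simp
  have m: "(+) a \<in> measurable padic_haar borel"
    unfolding measurable_cong_sets[OF sets_padic_haar refl]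
    by (intro borel_measurable_continuous_onI continuous_intros)
  have "(+) a -` A = (+) (- a) ` A" by (force simp: image_iff)
  moreover have "emeasure padic_haar ((+) (- a) ` A) = emeasure padic_haar A"
    using is_padic_haar_padic_haar[where 'a='p] A unfolding is_padic_haar_def by blast
  ultimately show "emeasure (distr padic_haar borel ((+) a)) A = emeasure padic_haar A"
    using A m by (simp add: emeasure_distr)
qed simp

lemma integral_padic_haar_translate:
  fixes f :: "'p::prime_card padic \<Rightarrow> complex"
  assumes "f \<in> borel_measurable borel"
  shows "(LINT x|padic_haar. f (a + x)) = (LINT x|padic_haar. f x)"
proof -
  have m: "(+) a \<in> measurable padic_haar borel"
    unfolding measurable_cong_sets[OF sets_padic_haar refl]
    by (intro borel_measurable_continuous_onI continuous_intros)
  show ?thesis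
    using integral_distr[OF m assms] by (simp add: distr_padic_haar_translate)
qed

lemma LINT_cball_translate:
  fixes f :: "'p::prime_card padic \<Rightarrow> complex"
  assumes [measurable]: "f \<in> borel_measurable borel"
  shows "(LINT x:padic_cball k a|padic_haar. f x) = (LINT x:padic_cball k 0|padic_haar. f (a + x))"
proof -
  have "indicator (padic_cball k a) (a + x) = (indicator (padic_cball k 0) x :: real)" for x
    by (auto simp: padic_cball_def indicator_def)
  moreover have "(\<lambda>x. indicator (padic_cball k a) x *\<^sub>R f x) \<in> borel_measurable borel" by measurable
  ultimately show ?thesis
    unfolding set_lebesgue_integral_def
    using integral_padic_haar_translate[of "\<lambda>x. indicator (padic_cball k a) x *\<^sub>R f x" a] by simp
qed

text \<open>
  The orthogonality relation for the balls, which are cosets of compact subgroups: either \<open>x * y\<close> is integral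
  throughout the ball around \<open>0\<close>, or some translation of that ball multiplies the integral by
  \<open>\<chi>(1 / p) \<noteq> 1\<close>.
\<close>

lemma LINT_cball_padic_char:
  fixes a y :: "'p::prime_card padic"
  shows "(LINT x:padic_cball k a|padic_haar. padic_char (x * y))
    = (if padic_abs y \<le> real CARD('p) powi (- k) then of_real (real CARD('p) powi k) * padic_char (a * y) else 0)"
proof -
  define I where "I = (LINT x:padic_cball k 0|padic_haar. padic_char (x * y))"
  have p1: "real CARD('p) > 1" by (rule padic_CARD_gt_1)
  have shift: "(LINT x:padic_cball k a|padic_haar. padic_char (x * y)) = padic_char (a * y) * I" for a
    unfolding LINT_cball_translate[OF measurable_padic_char_mult(1)] I_def
    by (simp add: distrib_right padic_char_add)
  have "I = (if padic_abs y \<le> real CARD('p) powi (- k) then of_real (real CARD('p) powi k) else 0)"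
  proof (cases "padic_abs y \<le> real CARD('p) powi (- k)")
    case True
    have "padic_char (x * y) = 1" if "x \<in> padic_cball k 0" for x
    proof (rule padic_char_int)
      have "padic_abs (x * y) \<le> real CARD('p) powi k * real CARD('p) powi (- k)"
        unfolding padic_abs_mult using that True p1 by (intro mult_mono) (auto simp: padic_cball_def)
      also have "\<dots> = 1" using p1 by (simp add: power_int_minus)
      finally show "padic_abs (x * y) \<le> 1" .
    qed
    note one = this
    have "I = (LINT x:padic_cball k (0 :: 'p padic)|padic_haar. 1)"
      unfolding I_def set_lebesgue_integral_def
      by (rule Bochner_Integration.integral_cong[OF refl]) (use one in \<open>auto split: split_indicator\<close>)
    also have "\<dots> = of_real (real CARD('p) powi k)"
      by (simp add: set_lebesgue_integral_def scaleR_conv_of_real)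
    finally show ?thesis using True by simp
  next
    case False
    have y: "y \<noteq> 0"
    proof
      assume "y = 0"
      with False have "real CARD('p) powi (- k) < 0" by simp
      thus False using padic_powi_pos[of "- k", where 'p='p] by (meson less_asym)
    qed
    obtain j where j: "padic_abs y = real CARD('p) powi j" using padic_abs_value[OF y] by blast
    have "j > - k" using False by (simp add: j padic_powi_le_iff)
    \<comment> \<open>A point of the ball with \<open>a * y = 1 / p\<close>; the ball is invariant under translation by it.\<close>
    define a where "a = 1 / of_nat CARD('p) / y"
    have "padic_abs a = real CARD('p) powi 1 * real CARD('p) powi (- j)"
      using p1 by (simp add: a_def divide_inverse padic_abs_mult padic_abs_inverse padic_abs_p j power_int_minus)
    also have "\<dots> = real CARD('p) powi (1 - j)" using p1 by (simp add: power_int_diff power_int_minus field_simps)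
    also have "\<dots> \<le> real CARD('p) powi k" using \<open>j > - k\<close> by (simp only: padic_powi_le_iff)
    finally have a: "a \<in> padic_cball k 0" by (simp add: padic_cball_def)
    have "padic_cball k a = padic_cball k 0"
      using padic_cball_mono[of a k a k 0] padic_cball_mono[of a k 0 k a] a by auto
    hence "I = padic_char (a * y) * I" using shift[of a] by (simp add: I_def)
    moreover have "padic_char (a * y) \<noteq> 1" using y padic_char_inverse_p[where 'p='p] by (simp add: a_def)
    ultimately have "I = 0" by (metis mult_cancel_right1 mult_1)
    thus ?thesis using False by simp
  qed
  thus ?thesis using shift[of a] by (simp add: mult.commute)
qed

lemma finite_measure_padic_ball: "finite_measure (restrict_space padic_haar (padic_cball k (x :: 'p::prime_card padic)))"
proof (rule finite_measureI)
  have "emeasure (restrict_space padic_haar (padic_cball k x)) (padic_cball k x) = emeasure padic_haar (padic_cball k x)"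
    by (rule emeasure_restrict_space) simp_all
  thus "emeasure (restrict_space padic_haar (padic_cball k x)) (space (restrict_space padic_haar (padic_cball k x))) \<noteq> \<infinity>"
    by (simp add: space_restrict_space)
qed

lemma LINT_cball_restrict:
  fixes f :: "'p::prime_card padic \<Rightarrow> complex"
  shows "(LINT y:padic_cball k x|padic_haar. f y) = (LINT y|restrict_space padic_haar (padic_cball k x). f y)"
  by (simp add: set_lebesgue_integral_def integral_restrict_space)

section \<open>Fourier transform of discrete laws and compound Poisson laws\<close>

lemma padic_char_rep_class:
  assumes "padic_abs u \<le> 1"
  shows "padic_char (u * padic_quot_rep (padic_class x)) = padic_char (u * x)"
proof -
  have "padic_abs (padic_quot_rep (padic_class x) - x) \<le> 1"
    using padic_class_eq_iff[of "padic_quot_rep (padic_class x)" x] by simp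
  hence "padic_abs (u * (padic_quot_rep (padic_class x) - x)) \<le> 1"
    using assms by (simp add: padic_abs_mult mult_le_one)
  moreover have "u * padic_quot_rep (padic_class x) = u * x + u * (padic_quot_rep (padic_class x) - x)"
    by (simp add: algebra_simps)
  ultimately show ?thesis by (metis padic_char_add padic_char_int mult_1_right)
qed

text \<open>
  For \<open>\<bar>u\<bar> \<le> 1\<close> this is the character of \<open>\<rat>\<^sub>p / \<int>\<^sub>p\<close> given by \<open>[x] \<mapsto> \<chi>(u x)\<close>; the dual group of \<open>\<rat>\<^sub>p / \<int>\<^sub>p\<close> is
  \<open>\<int>\<^sub>p\<close>.
\<close>

definition quot_char :: "'p::prime_card padic \<Rightarrow> 'p padic_quot \<Rightarrow> complex" where
  "quot_char u g = padic_char (u * padic_quot_rep g)"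

lemma quot_char_class: "padic_abs u \<le> 1 \<Longrightarrow> quot_char u (padic_class x) = padic_char (u * x)"
  by (simp add: quot_char_def padic_char_rep_class)

lemma norm_quot_char [simp]: "norm (quot_char u g) = 1"
  by (simp add: quot_char_def)

lemma quot_char_add:
  assumes "padic_abs u \<le> 1"
  shows "quot_char u (g + h) = quot_char u g * quot_char u h"
proof -
  have "g + h = padic_class (padic_quot_rep g + padic_quot_rep h)" by (simp add: padic_class_add)
  thus ?thesis using quot_char_class[OF assms]
    by (simp add: distrib_left padic_char_add) (simp add: quot_char_def)
qed

lemma quot_char_0: "padic_abs u \<le> 1 \<Longrightarrow> quot_char u 0 = 1"
  using quot_char_class[of u 0] by (simp add: padic_class_0 padic_char_int)

definition fourier_pmf :: "'p::prime_card padic_quot pmf \<Rightarrow> 'p padic \<Rightarrow> complex" where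
  "fourier_pmf q u = measure_pmf.expectation q (quot_char u)"

lemma norm_fourier_pmf_le: "norm (fourier_pmf q u) \<le> 1"
  unfolding fourier_pmf_def
  by (rule order_trans[OF integral_norm_bound]) simp

text \<open>
  Fubini's theorem and the orthogonality relation. The transform is evaluated at \<open>p ^ m * y\<close> with
  \<open>\<bar>y\<bar> \<le> p ^ m\<close> in place of \<open>u\<close> in \<open>\<int>\<^sub>p\<close>: in this form the formula meets the heat kernel without a change
  of variables in Haar measure.
\<close>

lemma fourier_inversion_pmf:
  fixes q :: "'p::prime_card padic_quot pmf"
  shows "(LINT y:padic_cball (int m) 0|padic_haar.
            cnj (quot_char (of_nat CARD('p) ^ m * y) g) * fourier_pmf q (of_nat CARD('p) ^ m * y))
         = of_real (real CARD('p) powi int m) * of_real (pmf q g)"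
proof -
  let ?P = "of_nat CARD('p) ^ m :: 'p padic"
  let ?B = "restrict_space padic_haar (padic_cball (int m) (0 :: 'p padic))"
  let ?f = "\<lambda>g' y. padic_char (y * (?P * (padic_quot_rep g' - padic_quot_rep g)))"
  have p1: "real CARD('p) > 1" by (rule padic_CARD_gt_1)
  interpret B: finite_measure ?B by (rule finite_measure_padic_ball)
  interpret pair_sigma_finite "measure_pmf q" ?B by standard
  have fin: "finite_measure (measure_pmf q \<Otimes>\<^sub>M ?B)"
    by (rule finite_measure_pair_measure) (auto intro: B.finite_measure_axioms measure_pmf.finite_measure_axioms)
  have eq: "cnj (quot_char (?P * y) g) * fourier_pmf q (?P * y) = (LINT g'|q. ?f g' y)" for y
  proof -
    have "cnj (quot_char (?P * y) g) * quot_char (?P * y) g' = ?f g' y" for g'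
    proof -
      have "y * (?P * (padic_quot_rep g' - padic_quot_rep g))
         = - (?P * y * padic_quot_rep g) + ?P * y * padic_quot_rep g'" by (simp add: algebra_simps)
      thus ?thesis by (simp only: padic_char_add padic_char_minus quot_char_def)
    qed
    thus ?thesis unfolding fourier_pmf_def by (simp flip: integral_mult_right_zero)
  qed
  have meas: "(\<lambda>(g', y). ?f g' y) \<in> borel_measurable (measure_pmf q \<Otimes>\<^sub>M ?B)"
  proof -
    have "(\<lambda>(g', y). ?f g' y) \<in> borel_measurable (count_space UNIV \<Otimes>\<^sub>M ?B)"
      by (rule measurable_pair_measure_countable1[OF countable_padic_quot])
         (auto intro!: measurable_restrict_space1 measurable_padic_char_mult cong: measurable_cong_sets)
    thus ?thesis by (simp cong: measurable_cong_sets)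
  qed
  have int: "integrable (measure_pmf q \<Otimes>\<^sub>M ?B) (\<lambda>(g', y). ?f g' y)"
    by (rule finite_measure.integrable_const_bound[OF fin _ meas, of 1]) auto
  have inner: "(LINT y|?B. ?f g' y) = of_real (real CARD('p) powi int m * indicator {g} g')" for g'
  proof -
    have "padic_abs (?P * (padic_quot_rep g' - padic_quot_rep g)) \<le> real CARD('p) powi (- int m)
      \<longleftrightarrow> padic_abs (padic_quot_rep g' - padic_quot_rep g) \<le> 1"
      using mult_le_cancel_left_pos[of "(1 / real CARD('p)) ^ m" "padic_abs (padic_quot_rep g' - padic_quot_rep g)" 1] p1
      by (simp only: padic_powi_minus_nat padic_abs_mult padic_abs_power padic_abs_p) simp
    also have "\<dots> \<longleftrightarrow> g' = g"
      using padic_class_eq_iff[of "padic_quot_rep g'" "padic_quot_rep g"] by simp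
    finally show ?thesis
      by (simp add: LINT_cball_padic_char padic_char_int flip: LINT_cball_restrict)
  qed
  have "(LINT y:padic_cball (int m) 0|padic_haar.
            cnj (quot_char (?P * y) g) * fourier_pmf q (?P * y)) = (LINT y|?B. LINT g'|q. ?f g' y)"
    by (simp add: eq LINT_cball_restrict)
  also have "\<dots> = (LINT g'|q. LINT y|?B. ?f g' y)" by (rule Fubini_integral[OF int])
  also have "\<dots> = of_real (LINT g'|q. real CARD('p) powi int m * indicator {g} g')"
    unfolding inner by (rule integral_complex_of_real)
  also have "(LINT g'|q. real CARD('p) powi int m * indicator {g} g') = real CARD('p) powi int m * pmf q g"
    by (simp add: pmf.rep_eq)
  finally show ?thesis by simp
qed

text \<open>
  The complex case is reduced to real and imaginary parts.
\<close>

lemma integral_bind_pmf_bounded: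
  fixes f :: "'a \<Rightarrow> complex"
  assumes "\<And>x. norm (f x) \<le> B"
  shows "(LINT x|bind_pmf M N. f x) = (LINT x|M. LINT y|N x. f y)"
proof -
  have real: "(LINT x|bind_pmf M N. g x) = (LINT x|M. LINT y|N x. g y)"
    if "\<And>x. \<bar>g x\<bar> \<le> B" for g :: "'a \<Rightarrow> real"
    unfolding measure_pmf_bind
    by (rule integral_bind[where K = "count_space UNIV" and B = B and B' = 1])
       (use that in \<open>auto simp: measure_pmf.emeasure_space_1 measure_pmf_in_subprob_algebra
          intro!: measure_pmf.finite_measure_axioms\<close>)
  have int: "integrable (measure_pmf r) f" for r :: "'a pmf"
    by (rule measure_pmf.integrable_const_bound[where B = B]) (use assms in auto)
  have int2: "integrable M (\<lambda>x. LINT y|N x. f y)"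
  proof (rule measure_pmf.integrable_const_bound[where B = B])
    have "norm (LINT y|N x. f y) \<le> B" for x
      by (rule order_trans[OF integral_norm_bound])
         (use assms int in \<open>auto intro!: measure_pmf.integral_le_const\<close>)
    thus "AE x in M. norm (LINT y|N x. f y) \<le> B" by simp
  qed simp
  have "\<bar>Re (f x)\<bar> \<le> B" "\<bar>Im (f x)\<bar> \<le> B" for x
    using assms[of x] abs_Re_le_cmod[of "f x"] abs_Im_le_cmod[of "f x"] by linarith+
  thus ?thesis
    using real[of "\<lambda>x. Re (f x)"] real[of "\<lambda>x. Im (f x)"]
    by (simp add: complex_eq_iff int int2)
qed

lemma fourier_pmf_return: "padic_abs u \<le> 1 \<Longrightarrow> fourier_pmf (return_pmf 0) u = 1"
  by (simp add: fourier_pmf_def quot_char_0)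

lemma fourier_pmf_convolution:
  assumes "padic_abs u \<le> 1"
  shows "fourier_pmf (bind_pmf q (\<lambda>g. map_pmf ((+) g) r)) u = fourier_pmf q u * fourier_pmf r u"
  unfolding fourier_pmf_def
  by (subst integral_bind_pmf_bounded[where B = 1]) (simp_all add: quot_char_add[OF assms])

text \<open>
  The convolution powers of \<open>q\<close>.
\<close>

primrec walk_pmf :: "'g::monoid_add pmf \<Rightarrow> nat \<Rightarrow> 'g pmf" where
  "walk_pmf q 0 = return_pmf 0"
| "walk_pmf q (Suc n) = bind_pmf q (\<lambda>g. map_pmf ((+) g) (walk_pmf q n))"

lemma fourier_pmf_walk: "padic_abs u \<le> 1 \<Longrightarrow> fourier_pmf (walk_pmf q n) u = fourier_pmf q u ^ n"
  by (induction n) (simp_all add: fourier_pmf_return fourier_pmf_convolution)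

definition compound_poisson_pmf :: "real \<Rightarrow> 'g::monoid_add pmf \<Rightarrow> 'g pmf" where
  "compound_poisson_pmf a q = bind_pmf (poisson_pmf a) (walk_pmf q)"

text \<open>
  The probability generating function of the Poisson law.
\<close>

lemma integral_poisson_power:
  fixes z :: complex
  assumes "a > 0" "norm z \<le> 1"
  shows "(LINT k|poisson_pmf a. z ^ k) = exp (of_real a * (z - 1))"
proof -
  have int: "integrable (measure_pmf (poisson_pmf a)) (\<lambda>k. z ^ k)"
    by (rule measure_pmf.integrable_const_bound[where B = 1])
       (use assms in \<open>auto simp: norm_power power_le_one\<close>)
  have "integrable (count_space UNIV) (\<lambda>k. pmf (poisson_pmf a) k *\<^sub>R z ^ k)"
    using int unfolding measure_pmf_eq_density by (subst (asm) integrable_density) auto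
  from sums_integral_count_space_nat[OF this]
  have "(\<lambda>k. pmf (poisson_pmf a) k *\<^sub>R z ^ k) sums (LINT k|poisson_pmf a. z ^ k)"
    unfolding measure_pmf_eq_density by (subst integral_density) auto
  moreover have "(\<lambda>k. of_real (exp (- a)) * ((of_real a * z) ^ k /\<^sub>R fact k)) sums (of_real (exp (- a)) * exp (of_real a * z))"
    by (intro sums_mult exp_converges)
  moreover have "pmf (poisson_pmf a) k *\<^sub>R z ^ k = of_real (exp (- a)) * ((of_real a * z) ^ k /\<^sub>R fact k)" for k
    using assms by (simp add: scaleR_conv_of_real power_mult_distrib field_simps)
  ultimately have "(LINT k|poisson_pmf a. z ^ k) = of_real (exp (- a)) * exp (of_real a * z)"
    by (metis (no_types, lifting) sums_cong sums_unique2)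
  also have "\<dots> = exp (of_real a * (z - 1))"
    by (simp add: exp_of_real[symmetric] mult_exp_exp algebra_simps)
  finally show ?thesis .
qed

lemma fourier_compound_poisson:
  assumes "padic_abs u \<le> 1" "a > 0"
  shows "fourier_pmf (compound_poisson_pmf a q) u = exp (of_real a * (fourier_pmf q u - 1))"
proof -
  have "fourier_pmf (compound_poisson_pmf a q) u = (LINT k|poisson_pmf a. fourier_pmf (walk_pmf q k) u)"
    unfolding compound_poisson_pmf_def fourier_pmf_def
    by (rule integral_bind_pmf_bounded[where B = 1]) simp
  also have "\<dots> = (LINT k|poisson_pmf a. fourier_pmf q u ^ k)"
    by (simp add: fourier_pmf_walk[OF assms(1)])
  also have "\<dots> = exp (of_real a * (fourier_pmf q u - 1))"
    by (rule integral_poisson_power[OF assms(2) norm_fourier_pmf_le])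
  finally show ?thesis .
qed

section \<open>Fourier transform of a step of the walk\<close>

lemma padic_quot_abs_class:
  "padic_quot_abs (padic_class x) = (if padic_abs x \<le> 1 then 0 else padic_abs x)"
  by (simp add: padic_quot_abs.abs_eq padic_ints_def)

definition quot_ball :: "nat \<Rightarrow> 'p::prime_card padic_quot set" where
  "quot_ball n = {g. padic_quot_abs g \<le> real CARD('p) ^ n}"

lemma class_in_quot_ball:
  "padic_class x \<in> quot_ball n \<longleftrightarrow> padic_abs x \<le> real CARD('p) ^ n" for x :: "'p::prime_card padic"
proof -
  have "1 \<le> real CARD('p) ^ n" using padic_CARD_gt_1[where 'p='p] by simp
  thus ?thesis
    using order_trans[of "padic_abs x" 1 "real CARD('p) ^ n"] by (auto simp: quot_ball_def padic_quot_abs_class)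
qed

lemma in_quot_ball_rep: "g \<in> quot_ball n \<longleftrightarrow> padic_abs (padic_quot_rep g) \<le> real CARD('p) ^ n"
  for g :: "'p::prime_card padic_quot"
  using class_in_quot_ball[of "padic_quot_rep g" n] by simp

text \<open>
  Every coset of \<open>\<int>\<^sub>p\<close> has Haar measure \<open>1\<close>. This counts the points of balls in \<open>\<rat>\<^sub>p / \<int>\<^sub>p\<close> without an
  enumeration.
\<close>

lemma distr_haar_class:
  "distr padic_haar (count_space UNIV) padic_class = count_space (UNIV :: 'p::prime_card padic_quot set)"
proof (rule measure_eqI_countable[where A = UNIV])
  fix g :: "'p padic_quot"
  have eq: "padic_class = (padic_scaled_class 0 :: 'p padic \<Rightarrow> _)"
    by (simp add: padic_scaled_class_def fun_eq_iff)
  have m: "padic_class \<in> measurable (padic_haar :: 'p padic measure) (count_space UNIV)"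
    unfolding eq by simp
  show "emeasure (distr padic_haar (count_space UNIV) padic_class) {g} = emeasure (count_space UNIV) {g}"
    by (simp add: emeasure_distr[OF m]) (simp add: eq padic_scaled_class_vimage)
qed (auto simp: countable_padic_quot)

lemma quot_ball_card:
  "finite (quot_ball n :: 'p::prime_card padic_quot set)" "card (quot_ball n :: 'p padic_quot set) = CARD('p) ^ n"
proof -
  have m: "padic_class \<in> measurable (padic_haar :: 'p padic measure) (count_space UNIV)"
    using measurable_padic_scaled_class[of 0, where 'p='p] by (simp add: padic_scaled_class_def[abs_def])
  have "emeasure (count_space UNIV) (quot_ball n :: 'p padic_quot set)
      = emeasure (distr padic_haar (count_space UNIV) padic_class) (quot_ball n :: 'p padic_quot set)"
    by (simp add: distr_haar_class)
  also have "\<dots> = emeasure padic_haar (padic_class -` quot_ball n :: 'p padic set)"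
    by (simp add: emeasure_distr[OF m])
  also have "padic_class -` quot_ball n = (padic_cball (int n) 0 :: 'p padic set)"
    by (auto simp: class_in_quot_ball padic_cball_def)
  finally have e: "emeasure (count_space UNIV) (quot_ball n :: 'p padic_quot set) = ennreal (real CARD('p) ^ n)"
    by simp
  show fin: "finite (quot_ball n :: 'p padic_quot set)"
    by (rule ccontr) (use e in simp)
  have "real (card (quot_ball n :: 'p padic_quot set)) = real (CARD('p) ^ n)"
    using e fin by (simp add: ennreal_of_nat_eq_real_of_nat)
  thus "card (quot_ball n :: 'p padic_quot set) = CARD('p) ^ n" by (simp only: of_nat_eq_iff)
qed

lemma quot_ball_mono: "m \<le> n \<Longrightarrow> quot_ball m \<subseteq> (quot_ball n :: 'p::prime_card padic_quot set)"
proof -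
  assume "m \<le> n"
  hence "real CARD('p) ^ m \<le> real CARD('p) ^ n"
    using padic_CARD_gt_1[where 'p='p] by (intro power_increasing) auto
  thus ?thesis by (auto simp: quot_ball_def intro: order_trans)
qed

lemma quot_ball_0: "quot_ball 0 = {0 :: 'p::prime_card padic_quot}"
proof -
  have "g = 0" if "padic_abs (padic_quot_rep g) \<le> 1" for g :: "'p padic_quot"
    using that padic_class_eq_iff[of "padic_quot_rep g" 0] by (simp add: padic_class_0)
  moreover have "padic_class 0 \<in> (quot_ball 0 :: 'p padic_quot set)" by (simp add: class_in_quot_ball)
  ultimately show ?thesis by (auto simp: in_quot_ball_rep padic_class_0)
qed

text \<open>
  Spheres are differences of subgroups, so sums of characters over spheres reduce to sums over subgroups.
\<close>

lemma quot_sphere_Suc: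
  "padic_quot_sphere (Suc k) = quot_ball (Suc k) - (quot_ball k :: 'p::prime_card padic_quot set)"
proof -
  have p1: "real CARD('p) > 1" by (rule padic_CARD_gt_1)
  have lt: "real CARD('p) ^ k < real CARD('p) ^ Suc k" using p1 by simp
  have "padic_quot_abs g = real CARD('p) ^ Suc k"
    if g: "padic_quot_abs g \<le> real CARD('p) ^ Suc k" "\<not> padic_quot_abs g \<le> real CARD('p) ^ k" for g :: "'p padic_quot"
  proof -
    define x where "x = padic_quot_rep g"
    have gx: "g = padic_class x" by (simp add: x_def)
    have ax: "padic_quot_abs g = padic_abs x" and x0: "x \<noteq> 0"
      using g(2) p1 unfolding gx padic_quot_abs_class by (auto split: if_splits)
    obtain j where j: "padic_abs x = real CARD('p) powi j" using padic_abs_value[OF x0] by blast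
    have "real CARD('p) powi j \<le> real CARD('p) powi int (Suc k)" "\<not> real CARD('p) powi j \<le> real CARD('p) powi int k"
      using g unfolding ax j power_int_of_nat by blast+
    hence "j = int (Suc k)" unfolding padic_powi_le_iff by linarith
    thus ?thesis by (simp only: ax j power_int_of_nat)
  qed
  thus ?thesis using lt unfolding padic_quot_sphere_def quot_ball_def by auto
qed

lemma quot_ball_Suc_Un: "quot_ball (Suc n) = quot_ball n \<union> (padic_quot_sphere (Suc n) :: 'p::prime_card padic_quot set)"
  "quot_ball n \<inter> (padic_quot_sphere (Suc n) :: 'p padic_quot set) = {}"
  using quot_ball_mono[of n "Suc n", where 'p='p] by (auto simp: quot_sphere_Suc)

lemma finite_quot_sphere_Suc: "finite (padic_quot_sphere (Suc n) :: 'p::prime_card padic_quot set)"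
  by (simp add: quot_sphere_Suc quot_ball_card)

lemma card_quot_sphere_Suc:
  "real (card (padic_quot_sphere (Suc k) :: 'p::prime_card padic_quot set)) = real CARD('p) ^ Suc k - real CARD('p) ^ k"
proof -
  have "card (padic_quot_sphere (Suc k) :: 'p padic_quot set) = CARD('p) ^ Suc k - CARD('p) ^ k"
    unfolding quot_sphere_Suc
    by (subst card_Diff_subset) (simp_all add: quot_ball_card quot_ball_mono del: power_Suc)
  moreover have "CARD('p) ^ k \<le> CARD('p) ^ Suc k"
    using prime_gt_0_nat[OF prime_card[where 'a='p]] by simp
  ultimately show ?thesis by (simp add: of_nat_diff del: power_Suc)
qed

lemma quot_zero_or_sphere:
  fixes g :: "'p::prime_card padic_quot"
  shows "g = 0 \<or> (\<exists>k. g \<in> padic_quot_sphere (Suc k))"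
proof -
  obtain n where "padic_abs (padic_quot_rep g) < real CARD('p) ^ n"
    using real_arch_pow[OF padic_CARD_gt_1[where 'p='p]] by blast
  hence "g \<in> quot_ball n" by (simp add: in_quot_ball_rep)
  moreover have "g \<in> quot_ball n \<Longrightarrow> g = 0 \<or> (\<exists>k. g \<in> padic_quot_sphere (Suc k))" for n
    by (induction n) (auto simp: quot_ball_0 quot_ball_Suc_Un)
  ultimately show ?thesis by blast
qed

lemma quot_ball_add: "g \<in> quot_ball n \<Longrightarrow> h \<in> quot_ball n \<Longrightarrow> g + h \<in> (quot_ball n :: 'p::prime_card padic_quot set)"
  using class_in_quot_ball[of "padic_quot_rep g + padic_quot_rep h" n]
  by (simp add: padic_class_add in_quot_ball_rep padic_abs_add_le)

lemma quot_ball_diff: "g \<in> quot_ball n \<Longrightarrow> h \<in> quot_ball n \<Longrightarrow> g - h \<in> (quot_ball n :: 'p::prime_card padic_quot set)"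
  using class_in_quot_ball[of "padic_quot_rep g - padic_quot_rep h" n]
  by (simp add: padic_class_diff in_quot_ball_rep padic_abs_diff_le)

lemma quot_char_eq_1:
  fixes u :: "'p::prime_card padic"
  assumes u: "padic_abs u = real CARD('p) powi (- int j)" and g: "g \<in> quot_ball n" and "n \<le> j"
  shows "quot_char u g = 1"
  unfolding quot_char_def
proof (rule padic_char_int)
  have "padic_abs (u * padic_quot_rep g) \<le> real CARD('p) powi (- int j) * real CARD('p) ^ n"
    using g u by (simp add: padic_abs_mult in_quot_ball_rep mult_left_mono)
  also have "\<dots> \<le> real CARD('p) powi (- int j) * real CARD('p) ^ j"
    using \<open>n \<le> j\<close> padic_CARD_gt_1[where 'p='p] by (intro mult_left_mono power_increasing) auto
  also have "\<dots> = 1" using padic_CARD_gt_1[where 'p='p] by (simp add: power_int_minus)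
  finally show "padic_abs (u * padic_quot_rep g) \<le> 1" .
qed

text \<open>
  A character sums to \<open>0\<close> over a finite subgroup on which it is not trivial, by a shift of the summation.
\<close>

lemma sum_quot_char_ball:
  fixes u :: "'p::prime_card padic"
  assumes u: "padic_abs u = real CARD('p) powi (- int j)"
  shows "(\<Sum>g\<in>quot_ball n. quot_char u g) = (if n \<le> j then of_nat (CARD('p) ^ n) else 0)"
proof (cases "n \<le> j")
  case True
  thus ?thesis by (simp add: quot_char_eq_1[OF u] quot_ball_card)
next
  case False
  have p1: "real CARD('p) > 1" by (rule padic_CARD_gt_1)
  have u1: "padic_abs u \<le> 1" unfolding u using padic_powi_le_iff[of "- int j" 0, where 'p='p] by simp
  have u0: "u \<noteq> 0" using u padic_powi_pos[of "- int j", where 'p='p] by auto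
  \<comment> \<open>The class of \<open>x\<close> lies in the subgroup, and \<open>u * x = 1 / p\<close>.\<close>
  define x where "x = 1 / of_nat CARD('p) / u"
  have "padic_abs x = real CARD('p) ^ Suc j"
    using p1 u by (simp add: x_def divide_inverse padic_abs_mult padic_abs_inverse padic_abs_p power_int_minus)
  also have "\<dots> \<le> real CARD('p) ^ n" using False p1 by (intro power_increasing) auto
  finally have g0: "padic_class x \<in> quot_ball n" by (simp add: class_in_quot_ball)
  define S where "S = (\<Sum>g\<in>quot_ball n. quot_char u g)"
  have "S = (\<Sum>g\<in>quot_ball n. quot_char u (padic_class x + g))"
    unfolding S_def
    by (rule sum.reindex_bij_witness[of _ "\<lambda>g. padic_class x + g" "\<lambda>g. g - padic_class x"])
       (use g0 in \<open>auto intro: quot_ball_add quot_ball_diff\<close>)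
  also have "\<dots> = quot_char u (padic_class x) * S"
    by (simp add: S_def quot_char_add[OF u1] sum_distrib_left)
  finally have "S = quot_char u (padic_class x) * S" .
  moreover have "quot_char u (padic_class x) \<noteq> 1"
    using padic_char_inverse_p[where 'p='p] u0 by (simp add: quot_char_class[OF u1] x_def)
  ultimately have "S = 0" by (metis mult_cancel_right1 mult_1)
  thus ?thesis using False by (simp add: S_def)
qed

definition is_step_pmf :: "real \<Rightarrow> real \<Rightarrow> 'p::prime_card padic_quot pmf \<Rightarrow> bool" where
  "is_step_pmf b P\<^sub>0 q \<longleftrightarrow> pmf q 0 = P\<^sub>0 \<and>
     (\<forall>k\<ge>1. \<forall>g\<in>padic_quot_sphere k. pmf q g =
          (1 - P\<^sub>0) * (real CARD('p) powr b - 1) / real CARD('p) powr (real k * b)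
            * (1 / real (card (padic_quot_sphere k :: 'p padic_quot set))))"

lemma step_pmf_sphere:
  fixes q :: "'p::prime_card padic_quot pmf"
  assumes "is_step_pmf b P\<^sub>0 q" "g \<in> padic_quot_sphere (Suc k)"
  shows "pmf q g = (1 - P\<^sub>0) * (real CARD('p) powr b - 1) / real CARD('p) powr (real (Suc k) * b)
            / (real CARD('p) ^ Suc k - real CARD('p) ^ k)"
  using assms(1)[unfolded is_step_pmf_def, THEN conjunct2, rule_format, of "Suc k" g] assms(2)
  by (simp add: card_quot_sphere_Suc[symmetric] del: of_nat_Suc power_Suc)

text \<open>
  The masses of the spheres telescope, since the mass of the sphere of index \<open>k\<close> is \<open>1 - P\<^sub>0\<close> times
  \<open>p powr (- (k - 1) * b) - p powr (- k * b)\<close>.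
\<close>

lemma measure_step_ball:
  fixes q :: "'p::prime_card padic_quot pmf"
  assumes q: "is_step_pmf b P\<^sub>0 q"
  shows "(\<Sum>g\<in>quot_ball n. pmf q g) = 1 - (1 - P\<^sub>0) / real CARD('p) powr (real n * b)"
proof (induction n)
  case 0
  show ?case using q padic_CARD_gt_1[where 'p='p] by (simp add: quot_ball_0 is_step_pmf_def)
next
  case (Suc n)
  have p1: "real CARD('p) > 1" by (rule padic_CARD_gt_1)
  let ?S = "padic_quot_sphere (Suc n) :: 'p padic_quot set"
  have c: "real (card ?S) \<noteq> 0" using p1 unfolding card_quot_sphere_Suc by simp
  have "(\<Sum>g\<in>?S. pmf q g) = (1 - P\<^sub>0) * (real CARD('p) powr b - 1) / real CARD('p) powr (real (Suc n) * b)"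
    using c by (simp add: step_pmf_sphere[OF q] card_quot_sphere_Suc[symmetric] del: power_Suc of_nat_Suc)
  moreover define x y where "x = real CARD('p) powr b" and "y = real CARD('p) powr (real n * b)"
  have xy: "real CARD('p) powr (real (Suc n) * b) = x * y"
    by (simp add: x_def y_def algebra_simps flip: powr_add)
  have pos: "x > 0" "y > 0" using p1 by (simp_all add: x_def y_def)
  moreover have "(\<Sum>g\<in>quot_ball (Suc n). pmf q g) = (\<Sum>g\<in>quot_ball n. pmf q g) + (\<Sum>g\<in>?S. pmf q g)"
    unfolding quot_ball_Suc_Un(1)
    by (intro sum.union_disjoint finite_quot_sphere_Suc quot_ball_card quot_ball_Suc_Un)
  ultimately have "(\<Sum>g\<in>quot_ball (Suc n). pmf q g) = 1 - (1 - P\<^sub>0) / y + (1 - P\<^sub>0) * (x - 1) / (x * y)"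
    unfolding Suc.IH xy x_def[symmetric] y_def[symmetric] by simp
  also have "\<dots> = 1 - (1 - P\<^sub>0) / (x * y)" using pos by (simp add: divide_simps) (simp add: algebra_simps)
  finally show ?case unfolding xy .
qed

lemma fourier_pmf_as_limit:
  "(\<lambda>n. \<Sum>g\<in>quot_ball n. of_real (pmf q g) * quot_char u g) \<longlonglongrightarrow> fourier_pmf q (u :: 'p::prime_card padic)"
proof -
  have eq: "(LINT g|q. indicator (quot_ball n) g *\<^sub>R quot_char u g) = (\<Sum>g\<in>quot_ball n. of_real (pmf q g) * quot_char u g)" for n
    by (subst integral_measure_pmf[OF quot_ball_card(1)])
       (auto simp: scaleR_conv_of_real indicator_eq_0_iff intro!: sum.cong)
  have "(\<lambda>n. LINT g|q. indicator (quot_ball n) g *\<^sub>R quot_char u g) \<longlonglongrightarrow> (LINT g|q. quot_char u g)"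
  proof (rule integral_dominated_convergence[where w = "\<lambda>_. 1"])
    have "(\<lambda>n. indicator (quot_ball n) g *\<^sub>R quot_char u g) \<longlonglongrightarrow> quot_char u g" for g
    proof (rule tendsto_eventually)
      obtain n where n: "padic_abs (padic_quot_rep g) < real CARD('p) ^ n"
        using real_arch_pow[OF padic_CARD_gt_1[where 'p='p]] by blast
      hence "g \<in> quot_ball n" by (simp add: in_quot_ball_rep)
      thus "\<forall>\<^sub>F n in sequentially. indicator (quot_ball n) g *\<^sub>R quot_char u g = quot_char u g"
        using quot_ball_mono[of n, where 'p='p] unfolding eventually_sequentially
        by (intro exI[of _ n]) (auto simp: indicator_def)
    qed
    thus "AE g in q. (\<lambda>n. indicator (quot_ball n) g *\<^sub>R quot_char u g) \<longlonglongrightarrow> quot_char u g" by simp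
  qed (auto simp: indicator_def)
  thus ?thesis by (simp add: eq fourier_pmf_def)
qed

lemma padic_abs_le_1_cases:
  fixes u :: "'p::prime_card padic"
  assumes "u \<noteq> 0" "padic_abs u \<le> 1"
  obtains j :: nat where "padic_abs u = real CARD('p) powi (- int j)"
proof -
  obtain k where k: "padic_abs u = real CARD('p) powi k" using padic_abs_value[OF assms(1)] by blast
  hence "k \<le> 0" using assms(2) padic_powi_le_iff[of k 0, where 'p='p] by simp
  thus ?thesis using that[of "nat (- k)"] k by simp
qed

text \<open>
  Let \<open>\<bar>u\<bar> = p powi (- j)\<close>. The character given by \<open>u\<close> is \<open>1\<close> on the ball of index \<open>j\<close>, sums to
  \<open>- p ^ j\<close> over the sphere of index \<open>j + 1\<close>, and sums to \<open>0\<close> over larger spheres. Hence the partial sums of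
  the Fourier series stop changing after index \<open>j + 1\<close>, and what is left is an algebraic identity, which
  produces the constant \<open>\<alpha>\<close>.
\<close>

lemma fourier_step_pmf:
  fixes q :: "'p::prime_card padic_quot pmf" and u :: "'p padic"
  assumes q: "is_step_pmf b P\<^sub>0 q" and b: "b > 0" and u: "padic_abs u \<le> 1"
    and \<alpha>: "\<alpha> = (1 - P\<^sub>0) * (real CARD('p) powr (b + 1) - 1) / (real CARD('p) powr b * (real CARD('p) - 1))"
  shows "fourier_pmf q u = of_real (1 - \<alpha> * padic_abs u powr b)"
proof (cases "u = 0")
  case True
  have "quot_char (0 :: 'p padic) = (\<lambda>_. 1)" by (simp add: quot_char_def padic_char_int fun_eq_iff)
  thus ?thesis using True by (simp add: fourier_pmf_def)
next
  case False
  have p1: "real CARD('p) > 1" by (rule padic_CARD_gt_1)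
  obtain j :: nat where j: "padic_abs u = real CARD('p) powi (- int j)"
    by (rule padic_abs_le_1_cases[OF False u])
  define v where "v k = (1 - P\<^sub>0) * (real CARD('p) powr b - 1) / real CARD('p) powr (real (Suc k) * b)
            / (real CARD('p) ^ Suc k - real CARD('p) ^ k)" for k
  define T where "T n = (\<Sum>g\<in>quot_ball n. of_real (pmf q g) * quot_char u g)" for n
  have step: "T (Suc n) = T n + of_real (v n) * ((\<Sum>g\<in>quot_ball (Suc n). quot_char u g) - (\<Sum>g\<in>quot_ball n. quot_char u g))" for n
  proof -
    have split: "(\<Sum>g\<in>quot_ball (Suc n). f g) = (\<Sum>g\<in>quot_ball n. f g) + (\<Sum>g\<in>padic_quot_sphere (Suc n). f g)"
      for f :: "'p padic_quot \<Rightarrow> complex"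
      unfolding quot_ball_Suc_Un(1)
      by (intro sum.union_disjoint finite_quot_sphere_Suc quot_ball_card quot_ball_Suc_Un)
    have "(\<Sum>g\<in>padic_quot_sphere (Suc n). of_real (pmf q g) * quot_char u g)
        = of_real (v n) * (\<Sum>g\<in>padic_quot_sphere (Suc n). quot_char u g)"
      unfolding sum_distrib_left by (rule sum.cong) (simp_all only: step_pmf_sphere[OF q] v_def)
    thus ?thesis unfolding T_def by (simp add: split)
  qed
  have Tj: "T j = of_real (\<Sum>g\<in>quot_ball j. pmf q g)"
    unfolding T_def by (simp add: quot_char_eq_1[OF j])
  \<comment> \<open>From index \<open>Suc j\<close> on, the partial sums are constant.\<close>
  have Tn: "T (Suc j + i) = of_real ((\<Sum>g\<in>quot_ball j. pmf q g) - v j * real CARD('p) ^ j)" for i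
  proof (induction i)
    case 0
    show ?case by (simp add: step Tj sum_quot_char_ball[OF j])
  next
    case (Suc i)
    have "T (Suc j + Suc i) = T (Suc (Suc j + i))" by simp
    also have "\<dots> = T (Suc j + i)" by (simp only: step) (simp add: sum_quot_char_ball[OF j])
    finally show ?case using Suc by simp
  qed
  have "(\<lambda>i. T (i + Suc j)) \<longlonglongrightarrow> fourier_pmf q u"
    using LIMSEQ_ignore_initial_segment[OF fourier_pmf_as_limit] unfolding T_def by blast
  hence "(\<lambda>i. of_real ((\<Sum>g\<in>quot_ball j. pmf q g) - v j * real CARD('p) ^ j)) \<longlonglongrightarrow> fourier_pmf q u"
    using Tn by (simp add: add.commute)
  hence "fourier_pmf q u = of_real ((\<Sum>g\<in>quot_ball j. pmf q g) - v j * real CARD('p) ^ j)"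
    by (rule LIMSEQ_unique) simp
  also have "(\<Sum>g\<in>quot_ball j. pmf q g) - v j * real CARD('p) ^ j = 1 - \<alpha> * padic_abs u powr b"
  proof -
    define x where "x = real CARD('p) powr b"
    define y where "y = real CARD('p) powr (real j * b)"
    have pos: "x > 0" "y > 0" using p1 by (simp_all add: x_def y_def)
    have 1: "real CARD('p) powr (real (Suc j) * b) = x * y"
      by (simp add: x_def y_def algebra_simps flip: powr_add)
    have 2: "padic_abs u powr b = 1 / y"
    proof -
      have "padic_abs u = real CARD('p) powr (- real j)"
        using p1 by (simp add: j power_int_minus powr_minus powr_realpow)
      hence "padic_abs u powr b = real CARD('p) powr (- (real j * b))"
        by (simp only: powr_powr mult_minus_left)
      thus ?thesis by (simp add: y_def powr_minus inverse_eq_divide)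
    qed
    have 3: "real CARD('p) powr (b + 1) = x * real CARD('p)" using p1 by (simp add: x_def powr_add)
    have "v j * real CARD('p) ^ j = (1 - P\<^sub>0) * (x - 1) / (x * y) / (real CARD('p) - 1)"
      using p1 pos unfolding v_def 1 x_def[symmetric] by (simp add: field_simps)
    thus ?thesis unfolding measure_step_ball[OF q] \<alpha> 2 3 x_def[symmetric] y_def[symmetric]
      using p1 pos by (simp add: divide_simps) (simp add: algebra_simps)
  qed
  finally show ?thesis .
qed

text \<open>
  The prescribed masses determine the law, since every element of the group is \<open>0\<close> or lies on a sphere.
\<close>

lemma walk_increments_law:
  fixes X :: "nat \<Rightarrow> 'v \<Rightarrow> 'p::prime_card padic_quot"
  assumes X: "padic_walk_increments b P\<^sub>0 M X"
  obtains q where "is_step_pmf b P\<^sub>0 q" "\<And>i. i \<ge> 1 \<Longrightarrow> distr M (count_space UNIV) (X i) = measure_pmf q"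
proof -
  have M: "prob_space M" using X by (simp add: padic_walk_increments_def)
  interpret prob_space M by (rule M)
  have Xm: "X i \<in> measurable M (count_space UNIV)" if "i \<ge> 1" for i
    using X that by (auto simp: padic_walk_increments_def indep_vars_def)
  obtain q where q: "measure_pmf q = distr M (count_space UNIV) (X 1)"
    by (rule distr_countable_eq_pmf[OF M Xm[OF order_refl]])
  have pr: "measure (distr M (count_space UNIV) (X i)) {g} = prob {\<omega>\<in>space M. X i \<omega> = g}" if "i \<ge> 1" for i g
    by (subst measure_distr[OF Xm[OF that]]) (auto intro!: arg_cong2[where f = measure])
  have pmf: "pmf q g = prob {\<omega>\<in>space M. X 1 \<omega> = g}" for g
    using pr[of 1 g] by (simp add: pmf.rep_eq q)
  have step: "is_step_pmf b P\<^sub>0 q"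
    using X unfolding is_step_pmf_def padic_walk_increments_def pmf by auto
  have "distr M (count_space UNIV) (X i) = measure_pmf q" if i: "i \<ge> 1" for i
  proof (rule measure_eqI_countable[where A = UNIV])
    fix g :: "'p padic_quot"
    interpret D: prob_space "distr M (count_space UNIV) (X i)" by (rule prob_space_distr[OF Xm[OF i]])
    have "prob {\<omega>\<in>space M. X i \<omega> = g} = pmf q g"
      using quot_zero_or_sphere[of g]
    proof
      assume "g = 0"
      thus ?thesis using X i step by (simp add: padic_walk_increments_def is_step_pmf_def)
    next
      assume "\<exists>k. g \<in> padic_quot_sphere (Suc k)"
      then obtain k where k: "Suc k \<ge> 1" "g \<in> padic_quot_sphere (Suc k)" by auto
      let ?v = "(1 - P\<^sub>0) * (real CARD('p) powr b - 1) / real CARD('p) powr (real (Suc k) * b)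
            * (1 / real (card (padic_quot_sphere (Suc k) :: 'p padic_quot set)))"
      have "prob {\<omega>\<in>space M. X i \<omega> = g} = ?v"
        using X i k unfolding padic_walk_increments_def by blast
      moreover have "pmf q g = ?v" using step k unfolding is_step_pmf_def by blast
      ultimately show ?thesis by simp
    qed
    thus "emeasure (distr M (count_space UNIV) (X i)) {g} = emeasure (measure_pmf q) {g}"
      by (simp add: D.emeasure_eq_measure pr[OF i] emeasure_pmf_single)
  qed (auto simp: countable_padic_quot)
  thus ?thesis using that[OF step] by blast
qed

section \<open>The heat kernel modulo \<open>p ^ m \<int>\<^sub>p\<close>\<close>

lemma borel_measurable_padic_abs [measurable]: "(padic_abs :: 'p::prime_card padic \<Rightarrow> real) \<in> borel_measurable borel"
proof (rule borel_measurable_continuous_onI)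
  have "padic_abs = (\<lambda>x. dist x (0 :: 'p padic))" by (simp add: dist_padic_def fun_eq_iff)
  show "continuous_on UNIV (padic_abs :: 'p padic \<Rightarrow> real)"
    unfolding \<open>padic_abs = (\<lambda>x. dist x 0)\<close> by (intro continuous_intros)
qed

text \<open>
  Integrating the heat kernel over a coset of \<open>p ^ m \<int>\<^sub>p\<close> cuts its Fourier integral off at \<open>\<bar>y\<bar> = p ^ m\<close>.
\<close>

lemma LINT_cball_heat_kernel:
  fixes g :: "'p::prime_card padic_quot" and m :: nat
  assumes int: "integrable (padic_haar :: 'p padic measure) (\<lambda>y. exp (- \<sigma> * t * padic_abs y powr b))"
  defines "B \<equiv> padic_scaled_class m -` {g}"
  shows "set_integrable padic_haar B (padic_heat_kernel b \<sigma> t)"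
    "(LINT x:B|padic_haar. padic_heat_kernel b \<sigma> t x) = of_real (real CARD('p) powi (- int m)) *
       (LINT y:padic_cball (int m) 0|padic_haar.
          quot_char (of_nat CARD('p) ^ m * y) g * of_real (exp (- \<sigma> * t * padic_abs y powr b)))"
proof -
  let ?e = "\<lambda>y :: 'p padic. exp (- \<sigma> * t * padic_abs y powr b)"
  let ?a = "of_nat CARD('p) ^ m * padic_quot_rep g :: 'p padic"
  let ?M = "restrict_space padic_haar B"
  let ?f = "\<lambda>x y. padic_char (x * y) * of_real (?e y)"
  have B: "B = padic_cball (- int m) ?a" by (simp add: B_def padic_scaled_class_vimage)
  interpret haar: sigma_finite_measure "padic_haar :: 'p padic measure" by (rule sigma_finite_padic_haar)
  interpret M: finite_measure ?M unfolding B by (rule finite_measure_padic_ball)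
  interpret pair_sigma_finite ?M "padic_haar :: 'p padic measure" by standard
  have setM: "sets ?M = sets (restrict_space borel B)" by (simp add: sets_restrict_space)
  have meas: "(\<lambda>(x, y). ?f x y) \<in> borel_measurable (?M \<Otimes>\<^sub>M padic_haar)"
  proof -
    have "(\<lambda>z. z) \<in> ?M \<Otimes>\<^sub>M padic_haar \<rightarrow>\<^sub>M borel \<Otimes>\<^sub>M borel"
      by (rule measurable_pair) (auto intro!: measurable_compose[OF measurable_fst] measurable_restrict_space1
            simp: o_def cong: measurable_cong_sets)
    moreover have "(\<lambda>(x, y). ?f x y) \<in> borel_measurable (borel \<Otimes>\<^sub>M borel)" by measurable
    ultimately show ?thesis by (rule measurable_compose)
  qed
  have int2: "integrable padic_haar (\<lambda>y. ?f x y)" for x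
  proof (rule Bochner_Integration.integrable_bound[OF int])
    show "(\<lambda>y. ?f x y) \<in> borel_measurable padic_haar"
      using measurable_padic_char_mult(2)[of x] by measurable
  qed (simp add: norm_mult)
  have intM: "integrable (?M \<Otimes>\<^sub>M padic_haar) (\<lambda>(x, y). ?f x y)"
  proof (rule Fubini_integrable[OF meas])
    show "AE x in ?M. integrable padic_haar (\<lambda>y. (\<lambda>(x, y). ?f x y) (x, y))" using int2 by simp
  qed (simp add: norm_mult)
  have heat: "padic_heat_kernel b \<sigma> t x = (LINT y|padic_haar. ?f x y)" for x
    by (simp add: padic_heat_kernel_def)
  show "set_integrable padic_haar B (padic_heat_kernel b \<sigma> t)"
    unfolding set_integrable_def using integrable_fst[OF intM]
    by (subst (asm) integrable_restrict_space) (simp_all add: heat B)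
  have inner: "(LINT x|?M. ?f x y) = of_real (real CARD('p) powi (- int m)) *
      (indicator (padic_cball (int m) 0) y *\<^sub>R (quot_char (of_nat CARD('p) ^ m * y) g * of_real (?e y)))" for y
  proof -
    have "(LINT x|?M. ?f x y) = (LINT x:B|padic_haar. padic_char (x * y)) * of_real (?e y)"
      by (simp add: B LINT_cball_restrict)
    also have "(LINT x:B|padic_haar. padic_char (x * y)) =
       of_real (real CARD('p) powi (- int m)) * (indicator (padic_cball (int m) 0) y *\<^sub>R quot_char (of_nat CARD('p) ^ m * y) g)"
      unfolding B LINT_cball_padic_char
      by (simp add: quot_char_def padic_cball_def indicator_def mult_ac)
    finally show ?thesis by (simp add: mult_ac)
  qed
  have "(LINT x:B|padic_haar. padic_heat_kernel b \<sigma> t x) = (LINT x|?M. LINT y|padic_haar. ?f x y)"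
    by (simp add: heat B LINT_cball_restrict)
  also have "\<dots> = (LINT y|padic_haar. LINT x|?M. ?f x y)" by (rule Fubini_integral[OF intM, symmetric])
  also have "\<dots> = of_real (real CARD('p) powi (- int m)) *
       (LINT y:padic_cball (int m) 0|padic_haar. quot_char (of_nat CARD('p) ^ m * y) g * of_real (?e y))"
    unfolding inner set_lebesgue_integral_def by (rule integral_mult_right_zero)
  finally show "(LINT x:B|padic_haar. padic_heat_kernel b \<sigma> t x) = of_real (real CARD('p) powi (- int m)) *
       (LINT y:padic_cball (int m) 0|padic_haar. quot_char (of_nat CARD('p) ^ m * y) g * of_real (?e y))" .
qed

text \<open>
  The cut-off integral is the complex conjugate of the one in the inversion formula, because the
  transform is real.
\<close>

lemma LINT_heat_kernel_eq_pmf: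
  fixes q :: "'p::prime_card padic_quot pmf"
  assumes int: "integrable (padic_haar :: 'p padic measure) (\<lambda>y. exp (- \<sigma> * t * padic_abs y powr b))"
    and q: "\<And>y. padic_abs y \<le> real CARD('p) ^ m \<Longrightarrow>
        fourier_pmf q (of_nat CARD('p) ^ m * y) = of_real (exp (- \<sigma> * t * padic_abs y powr b))"
  shows "(LINT x:padic_scaled_class m -` {g}|padic_haar. padic_heat_kernel b \<sigma> t x) = of_real (pmf q g)"
proof -
  let ?P = "of_nat CARD('p) ^ m :: 'p padic"
  have p1: "real CARD('p) > 1" by (rule padic_CARD_gt_1)
  have "(LINT y:padic_cball (int m) 0|padic_haar. quot_char (?P * y) g * of_real (exp (- \<sigma> * t * padic_abs y powr b)))
      = (LINT y:padic_cball (int m) 0|padic_haar. cnj (cnj (quot_char (?P * y) g) * fourier_pmf q (?P * y)))"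
    unfolding set_lebesgue_integral_def
    by (rule Bochner_Integration.integral_cong[OF refl]) (auto simp: indicator_def padic_cball_def q)
  also have "\<dots> = cnj (LINT y:padic_cball (int m) 0|padic_haar. cnj (quot_char (?P * y) g) * fourier_pmf q (?P * y))"
    unfolding set_lebesgue_integral_def by (simp only: complex_cnj_scaleR[symmetric] Bochner_Integration.integral_cnj)
  also have "\<dots> = of_real (real CARD('p) powi int m * pmf q g)"
    unfolding fourier_inversion_pmf by simp
  finally show ?thesis
    unfolding LINT_cball_heat_kernel(2)[OF int] using p1
    by (simp add: power_int_minus)
qed

text \<open>
  The integrability of the Fourier transform of the heat kernel is contained in the assumption that the
  heat kernel is a probability density: if it failed, the integral that defines the kernel would have
  its default value \<open>0\<close> everywhere.
\<close>

lemma heat_density_integrable: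
  fixes Z :: "'w \<Rightarrow> 'p::prime_card padic"
  assumes "prob_space N"
    and Z: "distributed N padic_haar Z (\<lambda>x. ennreal (Re (padic_heat_kernel b \<sigma> t x)))"
  shows "integrable (padic_haar :: 'p padic measure) (\<lambda>y. exp (- \<sigma> * t * padic_abs y powr b))"
proof (rule ccontr)
  interpret prob_space N by fact
  assume n: "\<not> ?thesis"
  have "padic_heat_kernel b \<sigma> t x = 0" for x :: "'p padic"
    unfolding padic_heat_kernel_def
  proof (rule not_integrable_integral_eq, rule notI)
    assume "integrable padic_haar (\<lambda>y. padic_char (x * y) * of_real (exp (- \<sigma> * t * padic_abs y powr b)))"
    from integrable_norm[OF this] show False using n by (simp add: norm_mult)
  qed
  hence "emeasure N (Z -` UNIV \<inter> space N) = 0"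
    by (subst distributed_emeasure[OF Z]) auto
  thus False by (simp add: emeasure_space_1)
qed

text \<open>
  The mass that the density puts on a coset is at least the integral of the heat kernel, since
  \<^const>\<open>ennreal\<close> truncates negative values. So one discrete law dominates the other, and two probabilities
  of this kind coincide.
\<close>

lemma distr_scaled_class_heat:
  fixes Z :: "'w \<Rightarrow> 'p::prime_card padic" and q :: "'p padic_quot pmf"
  assumes N: "prob_space N"
    and Z: "distributed N padic_haar Z (\<lambda>x. ennreal (Re (padic_heat_kernel b \<sigma> t x)))"
    and q: "\<And>y. padic_abs y \<le> real CARD('p) ^ m \<Longrightarrow>
        fourier_pmf q (of_nat CARD('p) ^ m * y) = of_real (exp (- \<sigma> * t * padic_abs y powr b))"
  shows "distr N (count_space UNIV) (\<lambda>\<omega>. padic_scaled_class m (Z \<omega>)) = measure_pmf q"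
proof -
  interpret prob_space N by fact
  have int: "integrable (padic_haar :: 'p padic measure) (\<lambda>y. exp (- \<sigma> * t * padic_abs y powr b))"
    by (rule heat_density_integrable[OF N Z])
  have Zm: "Z \<in> measurable N borel"
    using distributed_measurable[OF Z] by (simp cong: measurable_cong_sets)
  have cm: "(\<lambda>\<omega>. padic_scaled_class m (Z \<omega>)) \<in> measurable N (count_space UNIV)"
    by (rule measurable_compose[OF Zm measurable_padic_scaled_class])
  let ?D = "distr N (count_space UNIV) (\<lambda>\<omega>. padic_scaled_class m (Z \<omega>))"
  obtain r where r: "measure_pmf r = ?D" by (rule distr_countable_eq_pmf[OF N cm])
  have "pmf q g \<le> pmf r g" for g
  proof -
    let ?B = "padic_scaled_class m -` {g} :: 'p padic set"
    let ?f = "\<lambda>x. indicator ?B x * Re (padic_heat_kernel b \<sigma> t x)"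
    have "set_integrable padic_haar ?B (padic_heat_kernel b \<sigma> t)"
      by (rule LINT_cball_heat_kernel(1)[OF int])
    hence i: "integrable padic_haar (\<lambda>x. indicator ?B x *\<^sub>R padic_heat_kernel b \<sigma> t x)"
      by (simp add: set_integrable_def)
    have fi: "integrable padic_haar ?f" using integrable_Re[OF i] by simp
    have "pmf q g = Re (LINT x:?B|padic_haar. padic_heat_kernel b \<sigma> t x)"
      by (simp add: LINT_heat_kernel_eq_pmf[OF int q])
    also have "\<dots> = (LINT x|padic_haar. ?f x)"
      unfolding set_lebesgue_integral_def by (subst integral_Re[OF i, symmetric]) simp
    also have "\<dots> \<le> (LINT x|padic_haar. max 0 (?f x))"
      by (intro integral_mono integrable_max fi integrable_zero) auto
    finally have "ennreal (pmf q g) \<le> ennreal (LINT x|padic_haar. max 0 (?f x))" by (rule ennreal_leI)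
    also have "\<dots> = (\<integral>\<^sup>+x. ennreal (max 0 (?f x)) \<partial>padic_haar)"
      by (intro nn_integral_eq_integral[symmetric] integrable_max fi integrable_zero) auto
    also have "\<dots> = (\<integral>\<^sup>+x. ennreal (Re (padic_heat_kernel b \<sigma> t x)) * indicator ?B x \<partial>padic_haar)"
      by (intro nn_integral_cong) (auto simp: indicator_def max_def ennreal_neg)
    also have "\<dots> = emeasure N (Z -` ?B \<inter> space N)"
      by (rule distributed_emeasure[OF Z, symmetric]) (simp add: padic_scaled_class_vimage)
    also have "\<dots> = emeasure ?D {g}" by (subst emeasure_distr[OF cm]) (auto intro!: arg_cong2[where f = emeasure])
    also have "\<dots> = ennreal (pmf r g)" by (simp add: emeasure_pmf_single flip: r)
    finally show ?thesis by simp
  qed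
  hence "q = r" using pmf_neq_exists_less[of r q] by (metis not_le)
  thus ?thesis by (simp add: r)
qed

section \<open>Laws of the increments on the grid\<close>

lemma measurable_sequence:
  assumes "\<And>i :: nat. X i \<in> measurable M (count_space UNIV)"
  shows "(\<lambda>\<omega> i. X i \<omega>) \<in> measurable M (PiM UNIV (\<lambda>_. count_space UNIV))"
  using measurable_restrict[of UNIV X M "\<lambda>_. count_space UNIV"] assms by (simp add: restrict_def)

text \<open>
  Both laws of increments below are identified through their finite-dimensional cylinders.
\<close>

lemma distr_sequence_eq_PiM_pmf:
  fixes X :: "nat \<Rightarrow> 'w \<Rightarrow> 'a" and q :: "'a pmf"
  assumes "prob_space M"
    and X: "\<And>j. X j \<in> measurable M (count_space UNIV)"
    and indep: "\<And>J F. finite J \<Longrightarrow> J \<noteq> {} \<Longrightarrow>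
       emeasure M {\<omega>\<in>space M. \<forall>j\<in>J. X j \<omega> \<in> F j} = (\<Prod>j\<in>J. emeasure (measure_pmf q) (F j))"
  shows "distr M (PiM UNIV (\<lambda>_. count_space UNIV)) (\<lambda>\<omega> j. X j \<omega>) = PiM UNIV (\<lambda>_. measure_pmf q)"
proof -
  interpret prob_space M by fact
  interpret product_prob_space "\<lambda>_ :: nat. measure_pmf q" UNIV by standard
  note meas = measurable_sequence[of X M, OF X]
  have sets: "sets (PiM UNIV (\<lambda>_ :: nat. count_space (UNIV :: 'a set))) = sets (PiM UNIV (\<lambda>_. measure_pmf q))"
    by (rule sets_PiM_cong) auto
  show ?thesis
  proof (rule PiM_eq)
    fix J :: "nat set" and F :: "nat \<Rightarrow> 'a set"
    assume J: "finite J" "J \<subseteq> UNIV" "\<And>j. j \<in> J \<Longrightarrow> F j \<in> sets (measure_pmf q)"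
    let ?E = "prod_emb UNIV (\<lambda>_. measure_pmf q) J (Pi\<^sub>E J F)"
    have "?E \<in> sets (PiM UNIV (\<lambda>_. measure_pmf q))"
      by (rule sets_PiM_I) (use J in auto)
    hence "emeasure (distr M (PiM UNIV (\<lambda>_. count_space UNIV)) (\<lambda>\<omega> j. X j \<omega>)) ?E
      = emeasure M ((\<lambda>\<omega> j. X j \<omega>) -` ?E \<inter> space M)"
      by (intro emeasure_distr[OF meas]) (simp add: sets)
    also have "(\<lambda>\<omega> j. X j \<omega>) -` ?E \<inter> space M = {\<omega>\<in>space M. \<forall>j\<in>J. X j \<omega> \<in> F j}"
      by (auto simp: prod_emb_def PiE_iff)
    also have "emeasure M \<dots> = (\<Prod>j\<in>J. emeasure (measure_pmf q) (F j))"
      by (cases "J = {}") (simp_all add: prob_space.emeasure_space_1[OF assms(1)] indep[OF J(1)])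
    finally show "emeasure (distr M (PiM UNIV (\<lambda>_. count_space UNIV)) (\<lambda>\<omega> j. X j \<omega>)) ?E
       = (\<Prod>j\<in>J. emeasure (measure_pmf q) (F j))" .
  qed (simp add: sets)
qed

lemma (in prob_space) emeasure_indep_cylinder:
  assumes ind: "indep_vars (\<lambda>_. count_space UNIV) V I" and J: "finite J" "J \<noteq> {}" "J \<subseteq> I"
  shows "emeasure M {\<omega>\<in>space M. \<forall>j\<in>J. V j \<omega> \<in> F j} = (\<Prod>j\<in>J. emeasure (distr M (count_space UNIV) (V j)) (F j))"
proof -
  have V: "V j \<in> measurable M (count_space UNIV)" if "j \<in> J" for j
    using ind J(3) that by (auto simp: indep_vars_def)
  have "{\<omega>\<in>space M. \<forall>j\<in>J. V j \<omega> \<in> F j} = (\<Inter>j\<in>J. V j -` F j \<inter> space M)" using J(2) by auto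
  hence "emeasure M {\<omega>\<in>space M. \<forall>j\<in>J. V j \<omega> \<in> F j} = ennreal (\<Prod>j\<in>J. prob (V j -` F j \<inter> space M))"
    using indep_varsD[OF ind J(2,1,3), of F] by (simp add: emeasure_eq_measure)
  also have "\<dots> = (\<Prod>j\<in>J. emeasure M (V j -` F j \<inter> space M))"
    by (simp add: prod_ennreal emeasure_eq_measure)
  also have "\<dots> = (\<Prod>j\<in>J. emeasure (distr M (count_space UNIV) (V j)) (F j))"
    by (intro prod.cong refl emeasure_distr[symmetric] V) auto
  finally show ?thesis .
qed

lemma distr_brownian_increments:
  fixes Y :: "real \<Rightarrow> 'w \<Rightarrow> 'p::prime_card padic" and q :: "'p padic_quot pmf"
  assumes Y: "padic_brownian_motion b \<sigma> N Y" and h: "h > 0"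
    and q: "\<And>y. padic_abs y \<le> real CARD('p) ^ m \<Longrightarrow>
        fourier_pmf q (of_nat CARD('p) ^ m * y) = of_real (exp (- \<sigma> * h * padic_abs y powr b))"
  shows "\<And>i. (\<lambda>\<omega>. padic_scaled_class m (Y (h * real (Suc i)) \<omega> - Y (h * real i) \<omega>)) \<in> measurable N (count_space UNIV)"
    and "distr N (PiM UNIV (\<lambda>_. count_space UNIV))
       (\<lambda>\<omega> i. padic_scaled_class m (Y (h * real (Suc i)) \<omega> - Y (h * real i) \<omega>))
     = PiM UNIV (\<lambda>_. measure_pmf q)"
proof -
  have N: "prob_space N" using Y by (simp add: padic_brownian_motion_def)
  interpret prob_space N by (rule N)
  let ?C = "count_space (UNIV :: 'p padic_quot set)"
  let ?V = "\<lambda>i \<omega>. padic_scaled_class m (Y (h * real (Suc i)) \<omega> - Y (h * real i) \<omega>)"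
  have dist: "distributed N padic_haar (\<lambda>\<omega>. Y (h * real (Suc i)) \<omega> - Y (h * real i) \<omega>)
        (\<lambda>x. ennreal (Re (padic_heat_kernel b \<sigma> h x)))" for i
  proof -
    have "\<forall>s\<ge>0. \<forall>t>0. distributed N padic_haar (\<lambda>\<omega>. Y (s + t) \<omega> - Y s \<omega>)
        (\<lambda>x. ennreal (Re (padic_heat_kernel b \<sigma> t x)))"
      using Y by (simp add: padic_brownian_motion_def)
    hence "distributed N padic_haar (\<lambda>\<omega>. Y (h * real i + h) \<omega> - Y (h * real i) \<omega>)
        (\<lambda>x. ennreal (Re (padic_heat_kernel b \<sigma> h x)))" using h by simp
    thus ?thesis by (simp add: algebra_simps)
  qed
  show V: "?V i \<in> measurable N ?C" for i
    using distributed_measurable[OF dist[of i]]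
    by (intro measurable_compose[OF _ measurable_padic_scaled_class]) (simp cong: measurable_cong_sets)
  have law: "distr N ?C (?V i) = measure_pmf q" for i
    by (rule distr_scaled_class_heat[OF N dist q])
  show "distr N (PiM UNIV (\<lambda>_. count_space UNIV)) (\<lambda>\<omega> i. ?V i \<omega>) = PiM UNIV (\<lambda>_. measure_pmf q)"
  proof (rule distr_sequence_eq_PiM_pmf[OF N V])
    fix J :: "nat set" and F :: "nat \<Rightarrow> 'p padic_quot set"
    assume J: "finite J" "J \<noteq> {}"
    then obtain n where n: "J \<subseteq> {..<n}" using finite_nat_iff_bounded by blast
    have "\<forall>(n::nat) \<tau>. 0 \<le> \<tau> 0 \<and> (\<forall>i<n. \<tau> i < \<tau> (Suc i)) \<longrightarrow>
        indep_vars (\<lambda>_. borel) (\<lambda>i \<omega>. Y (\<tau> (Suc i)) \<omega> - Y (\<tau> i) \<omega>) {..<n}"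
      using Y by (simp add: padic_brownian_motion_def)
    from this[rule_format, of "\<lambda>i. h * real i" n]
    have "indep_vars (\<lambda>_. borel) (\<lambda>i \<omega>. Y (h * real (Suc i)) \<omega> - Y (h * real i) \<omega>) {..<n}" using h by simp
    hence ind: "indep_vars (\<lambda>_. ?C) ?V {..<n}" by (rule indep_vars_compose2) simp
    show "emeasure N {\<omega>\<in>space N. \<forall>j\<in>J. ?V j \<omega> \<in> F j} = (\<Prod>j\<in>J. emeasure (measure_pmf q) (F j))"
      by (simp only: emeasure_indep_cylinder[OF ind J n] law)
  qed
qed

text \<open>
  Splitting off the first summand matches the recursion of \<^const>\<open>walk_pmf\<close>.
\<close>

lemma block_sum_distr:
  fixes X :: "nat \<Rightarrow> 'w \<Rightarrow> 'p::prime_card padic_quot" and q :: "'p padic_quot pmf"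
  assumes "prob_space M" and indep: "prob_space.indep_vars M (\<lambda>_. count_space UNIV) X {1..}"
    and law: "\<And>i. i \<ge> 1 \<Longrightarrow> distr M (count_space UNIV) (X i) = measure_pmf q"
  shows "distr M (count_space UNIV) (\<lambda>\<omega>. \<Sum>j\<in>{a<..a + k}. X j \<omega>) = measure_pmf (walk_pmf q k)"
proof (induction k arbitrary: a)
  case 0
  interpret prob_space M by fact
  show ?case by (simp add: return_pmf.rep_eq) 
next
  case (Suc k)
  interpret prob_space M by fact
  let ?C = "count_space (UNIV :: 'p padic_quot set)"
  let ?R = "\<lambda>\<omega>. \<Sum>j\<in>{Suc a<..Suc a + k}. X j \<omega>"
  have X: "X j \<in> measurable M ?C" if "j \<ge> 1" for j using indep that by (simp add: indep_vars_def)
  have R: "?R \<in> measurable M ?C" by (intro measurable_quot_sum X) simp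
  have split: "(\<Sum>j\<in>{a<..a + Suc k}. X j \<omega>) = X (Suc a) \<omega> + ?R \<omega>" for \<omega>
  proof -
    have "{a<..a + Suc k} = insert (Suc a) {Suc a<..Suc a + k}" by auto
    thus ?thesis by simp
  qed
  have "indep_var (PiM {Suc a} (\<lambda>_. ?C)) (\<lambda>\<omega>. restrict (\<lambda>i. X i \<omega>) {Suc a})
     (PiM {Suc a<..Suc a + k} (\<lambda>_. ?C)) (\<lambda>\<omega>. restrict (\<lambda>i. X i \<omega>) {Suc a<..Suc a + k})"
    by (rule indep_var_restrict[OF indep]) auto
  hence "indep_var ?C ((\<lambda>v. v (Suc a)) \<circ> (\<lambda>\<omega>. restrict (\<lambda>i. X i \<omega>) {Suc a}))
     ?C ((\<lambda>v. \<Sum>j\<in>{Suc a<..Suc a + k}. v j) \<circ> (\<lambda>\<omega>. restrict (\<lambda>i. X i \<omega>) {Suc a<..Suc a + k}))"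
    by (rule indep_var_compose) (auto intro!: measurable_quot_sum)
  also have "(\<lambda>v. v (Suc a)) \<circ> (\<lambda>\<omega>. restrict (\<lambda>i. X i \<omega>) {Suc a}) = X (Suc a)" by auto
  also have "(\<lambda>v. \<Sum>j\<in>{Suc a<..Suc a + k}. v j) \<circ> (\<lambda>\<omega>. restrict (\<lambda>i. X i \<omega>) {Suc a<..Suc a + k}) = ?R" by auto
  finally have "indep_var ?C (X (Suc a)) ?C ?R" .
  hence "distr M (?C \<Otimes>\<^sub>M ?C) (\<lambda>\<omega>. (X (Suc a) \<omega>, ?R \<omega>)) = distr M ?C (X (Suc a)) \<Otimes>\<^sub>M distr M ?C ?R"
    by (simp add: indep_var_distribution_eq)
  hence joint: "distr M (?C \<Otimes>\<^sub>M ?C) (\<lambda>\<omega>. (X (Suc a) \<omega>, ?R \<omega>)) = measure_pmf q \<Otimes>\<^sub>M measure_pmf (walk_pmf q k)"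
    by (simp only: law Suc.IH)
  have pair: "(\<lambda>\<omega>. (X (Suc a) \<omega>, ?R \<omega>)) \<in> measurable M (?C \<Otimes>\<^sub>M ?C)"
    by (rule measurable_Pair[OF X R]) simp
  have plus: "(\<lambda>(g, h). g + h) \<in> measurable (?C \<Otimes>\<^sub>M ?C) ?C"
    by (rule measurable_pair_measure_countable1[OF countable_padic_quot]) simp
  show ?case
  proof (rule measure_eqI)
    fix A assume "A \<in> sets (distr M ?C (\<lambda>\<omega>. \<Sum>j\<in>{a<..a + Suc k}. X j \<omega>))"
    have S: "(\<lambda>(g, h). g + h) -` A \<in> sets (?C \<Otimes>\<^sub>M ?C)"
      using measurable_sets[OF plus, of A] by (simp add: space_pair_measure)
    have m: "(\<lambda>\<omega>. X (Suc a) \<omega> + ?R \<omega>) \<in> measurable M ?C" by (intro measurable_quot_add X R) simp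
    have "emeasure (distr M ?C (\<lambda>\<omega>. \<Sum>j\<in>{a<..a + Suc k}. X j \<omega>)) A
       = emeasure M ((\<lambda>\<omega>. X (Suc a) \<omega> + ?R \<omega>) -` A \<inter> space M)"
      unfolding split by (rule emeasure_distr[OF m]) simp
    also have "\<dots> = emeasure (distr M (?C \<Otimes>\<^sub>M ?C) (\<lambda>\<omega>. (X (Suc a) \<omega>, ?R \<omega>))) ((\<lambda>(g, h). g + h) -` A)"
      by (subst emeasure_distr[OF pair S]) (auto intro!: arg_cong2[where f = emeasure])
    also have "\<dots> = (\<integral>\<^sup>+g. emeasure (measure_pmf (walk_pmf q k)) (Pair g -` ((\<lambda>(g, h). g + h) -` A)) \<partial>measure_pmf q)"
      unfolding joint
      by (rule measure_pmf.emeasure_pair_measure_alt) (use S in \<open>simp cong: sets_pair_measure_cong\<close>)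
    also have "\<dots> = emeasure (measure_pmf (walk_pmf q (Suc k))) A"
      by (simp add: vimage_def)
    finally show "emeasure (distr M ?C (\<lambda>\<omega>. \<Sum>j\<in>{a<..a + Suc k}. X j \<omega>)) A = emeasure (measure_pmf (walk_pmf q (Suc k))) A" .
  qed simp
qed

abbreviation poisson_process :: "real \<Rightarrow> (nat \<Rightarrow> nat) measure" where
  "poisson_process a \<equiv> PiM UNIV (\<lambda>_ :: nat. measure_pmf (poisson_pmf a))"

lemma measurable_component_count:
  "(\<lambda>\<kappa>. \<kappa> i) \<in> measurable (poisson_process a) (count_space UNIV)"
  using measurable_component_singleton[of i UNIV "\<lambda>_ :: nat. measure_pmf (poisson_pmf a)"] by simp

text \<open>
  The number of steps that the clock makes during the first \<open>i\<close> cells of the grid, when \<open>\<kappa> r\<close> is the number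
  of ticks in the cell \<open>r\<close>.
\<close>

definition arrivals :: "(nat \<Rightarrow> nat) \<Rightarrow> nat \<Rightarrow> nat" where
  "arrivals \<kappa> i = (\<Sum>r<i. \<kappa> r)"

lemma arrivals_simps [simp]: "arrivals \<kappa> 0 = 0" "arrivals \<kappa> (Suc i) = arrivals \<kappa> i + \<kappa> i"
  by (simp_all add: arrivals_def)

lemma arrivals_mono: "mono (arrivals \<kappa>)"
  by (rule monoI) (auto simp: arrivals_def intro!: sum_mono2)

lemma measurable_arrivals:
  "(\<lambda>\<kappa>. arrivals \<kappa> i) \<in> measurable (PiM UNIV (\<lambda>_ :: nat. measure_pmf (r :: nat pmf))) (count_space UNIV)"
proof (induction i)
  case (Suc i)
  have c: "(\<lambda>\<kappa>. \<kappa> i) \<in> measurable (PiM UNIV (\<lambda>_ :: nat. measure_pmf r)) (count_space UNIV)"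
    using measurable_component_singleton[of i UNIV "\<lambda>_ :: nat. measure_pmf r"] by simp
  show ?case unfolding arrivals_simps
    by (rule measurable_compose_countable[OF _ Suc, where f = "\<lambda>k \<kappa>. k + \<kappa> i"])
       (rule measurable_compose[OF c], simp)
qed simp

text \<open>
  The increment of the walk over the cell \<open>i\<close> of the grid when it is run by the clock \<open>\<kappa>\<close>.
\<close>

definition block_sum :: "(nat \<Rightarrow> 'w \<Rightarrow> 'g::comm_monoid_add) \<Rightarrow> nat \<Rightarrow> 'w \<times> (nat \<Rightarrow> nat) \<Rightarrow> 'g" where
  "block_sum X i = (\<lambda>(\<omega>, \<kappa>). \<Sum>j\<in>{arrivals \<kappa> i<..arrivals \<kappa> (Suc i)}. X j \<omega>)"

lemma random_walk_arrivals: "random_walk X (arrivals \<kappa> i) \<omega> = (\<Sum>r<i. block_sum X r (\<omega>, \<kappa>))"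
proof (induction i)
  case (Suc i)
  have "{1..arrivals \<kappa> (Suc i)} = {1..arrivals \<kappa> i} \<union> {arrivals \<kappa> i<..arrivals \<kappa> (Suc i)}"
    by auto
  hence "random_walk X (arrivals \<kappa> (Suc i)) \<omega> = random_walk X (arrivals \<kappa> i) \<omega> + block_sum X i (\<omega>, \<kappa>)"
    unfolding random_walk_def block_sum_def by (simp del: arrivals_simps) (rule sum.union_disjoint, auto)
  thus ?case by (simp add: Suc)
qed (simp add: random_walk_def)

lemma grid_path_block_sum:
  "grid_path h m (\<lambda>i. block_sum X i (\<omega>, \<kappa>))
    = skorokhod_of (\<lambda>t. padic_embed m (random_walk X (arrivals \<kappa> (nat \<lfloor>t / h\<rfloor>)) \<omega>))"
  by (simp add: grid_path_def random_walk_arrivals)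

text \<open>
  For a fixed clock \<open>\<kappa>\<close> the blocks are disjoint, so their sums are independent with laws
  \<open>walk_pmf q (\<kappa> j)\<close>. The probability of a cylinder is thus a product of functions of the \<open>\<kappa> j\<close>, and
  integration over the independent \<open>\<kappa> j\<close> turns each factor into a compound Poisson probability.
\<close>

lemma distr_block_sums:
  fixes X :: "nat \<Rightarrow> 'w \<Rightarrow> 'p::prime_card padic_quot" and q :: "'p padic_quot pmf" and a :: real
  assumes M: "prob_space M" and indep: "prob_space.indep_vars M (\<lambda>_. count_space UNIV) X {1..}"
    and law: "\<And>i. i \<ge> 1 \<Longrightarrow> distr M (count_space UNIV) (X i) = measure_pmf q"
  defines "M' \<equiv> M \<Otimes>\<^sub>M PiM UNIV (\<lambda>_ :: nat. measure_pmf (poisson_pmf a))"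
  shows "\<And>i. block_sum X i \<in> measurable M' (count_space UNIV)"
    and "distr M' (PiM UNIV (\<lambda>_. count_space UNIV)) (\<lambda>z i. block_sum X i z)
       = PiM UNIV (\<lambda>_. measure_pmf (compound_poisson_pmf a q))"
proof -
  interpret M: prob_space M by fact
  interpret P: product_prob_space "\<lambda>_ :: nat. measure_pmf (poisson_pmf a)" UNIV by standard
  let ?P = "PiM UNIV (\<lambda>_ :: nat. measure_pmf (poisson_pmf a))"
  let ?C = "count_space (UNIV :: 'p padic_quot set)"
  interpret MP: pair_prob_space M ?P by standard
  have X: "X j \<in> measurable M ?C" if "j \<ge> 1" for j using indep that by (simp add: M.indep_vars_def)
  show B: "block_sum X i \<in> measurable M' ?C" for i
  proof -
    have s: "(\<lambda>z. \<Sum>j\<in>{m<..n}. X j (fst z)) \<in> measurable M' ?C" for m n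
      unfolding M'_def by (intro measurable_quot_sum measurable_compose[OF measurable_fst X]) simp
    have c: "(\<lambda>z. arrivals (snd z) i) \<in> measurable M' (count_space UNIV)" for i
      unfolding M'_def by (rule measurable_compose[OF measurable_snd measurable_arrivals])
    have "(\<lambda>z. \<Sum>j\<in>{arrivals (snd z) i<..n}. X j (fst z)) \<in> measurable M' ?C" for n
      by (rule measurable_compose_countable[OF s c])
    hence "(\<lambda>z. \<Sum>j\<in>{arrivals (snd z) i<..arrivals (snd z) (Suc i)}. X j (fst z)) \<in> measurable M' ?C"
      by (rule measurable_compose_countable[OF _ c])
    thus ?thesis by (simp add: block_sum_def case_prod_unfold)
  qed
  show "distr M' (PiM UNIV (\<lambda>_. count_space UNIV)) (\<lambda>z i. block_sum X i z)
       = PiM UNIV (\<lambda>_. measure_pmf (compound_poisson_pmf a q))"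
  proof (rule distr_sequence_eq_PiM_pmf)
    show "prob_space M'" unfolding M'_def by (rule MP.prob_space_axioms)
    show "block_sum X i \<in> measurable M' ?C" for i by (rule B)
  next
    fix J :: "nat set" and F :: "nat \<Rightarrow> 'p padic_quot set"
    assume J: "finite J" "J \<noteq> {}"
    have fixed: "emeasure M {\<omega>\<in>space M. \<forall>j\<in>J. block_sum X j (\<omega>, \<kappa>) \<in> F j}
       = (\<Prod>j\<in>J. emeasure (measure_pmf (walk_pmf q (\<kappa> j))) (F j))" for \<kappa>
    proof -
      let ?K = "\<lambda>j. {arrivals \<kappa> j<..arrivals \<kappa> (Suc j)}"
      let ?S = "\<lambda>j \<omega>. \<Sum>i\<in>?K j. X i \<omega>"
      have disj: "?K i \<inter> ?K j = {}" if "i < j" for i j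
        using monoD[OF arrivals_mono[of \<kappa>], of "Suc i" j] that by (auto simp del: arrivals_simps)
      have "disjoint_family_on ?K J" unfolding disjoint_family_on_def
      proof (intro ballI impI)
        fix i j :: nat assume "i \<noteq> j"
        thus "?K i \<inter> ?K j = {}" using disj[of i j] disj[of j i] by (cases "i < j") (auto simp del: arrivals_simps)
      qed
      hence "M.indep_vars (\<lambda>j. PiM (?K j) (\<lambda>_. ?C)) (\<lambda>j \<omega>. restrict (\<lambda>i. X i \<omega>) (?K j)) J"
        by (intro M.indep_vars_restrict[OF indep]) auto
      hence "M.indep_vars (\<lambda>_. ?C) (\<lambda>j \<omega>. (\<lambda>v. \<Sum>i\<in>?K j. v i) (restrict (\<lambda>i. X i \<omega>) (?K j))) J"
        by (rule M.indep_vars_compose2) (intro measurable_quot_sum, simp)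
      hence ind: "M.indep_vars (\<lambda>_. ?C) ?S J" by simp
      have "emeasure M {\<omega>\<in>space M. \<forall>j\<in>J. block_sum X j (\<omega>, \<kappa>) \<in> F j} = (\<Prod>j\<in>J. emeasure (distr M ?C (?S j)) (F j))"
        using M.emeasure_indep_cylinder[OF ind J order_refl, of F] by (simp add: block_sum_def)
      also have "\<dots> = (\<Prod>j\<in>J. emeasure (measure_pmf (walk_pmf q (\<kappa> j))) (F j))"
        by (simp only: arrivals_simps block_sum_distr[OF M indep law])
      finally show ?thesis .
    qed
    let ?E = "{z\<in>space M'. \<forall>j\<in>J. block_sum X j z \<in> F j}"
    have E: "?E \<in> sets M'"
      by (intro sets.sets_Collect_finite_All J measurable_sets_Collect[OF B]) simp
    have "emeasure M' ?E = (\<integral>\<^sup>+\<kappa>. emeasure M ((\<lambda>\<omega>. (\<omega>, \<kappa>)) -` ?E) \<partial>?P)"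
      unfolding M'_def by (rule MP.emeasure_pair_measure_alt2) (use E in \<open>simp add: M'_def\<close>)
    also have "\<dots> = (\<integral>\<^sup>+\<kappa>. (\<Prod>j\<in>J. emeasure (measure_pmf (walk_pmf q (\<kappa> j))) (F j)) \<partial>?P)"
    proof (rule nn_integral_cong)
      fix \<kappa> assume "\<kappa> \<in> space ?P"
      hence "(\<lambda>\<omega>. (\<omega>, \<kappa>)) -` ?E = {\<omega>\<in>space M. \<forall>j\<in>J. block_sum X j (\<omega>, \<kappa>) \<in> F j}"
        by (auto simp: M'_def space_pair_measure)
      thus "emeasure M ((\<lambda>\<omega>. (\<omega>, \<kappa>)) -` ?E) = (\<Prod>j\<in>J. emeasure (measure_pmf (walk_pmf q (\<kappa> j))) (F j))"
        using fixed by simp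
    qed
    also have "\<dots> = (\<integral>\<^sup>+\<kappa>. (\<Prod>j\<in>J. emeasure (measure_pmf (walk_pmf q (\<kappa> j))) (F j)) \<partial>PiM J (\<lambda>_. measure_pmf (poisson_pmf a)))"
      by (subst P.distr_PiM_restrict_finite[OF J(1), symmetric], simp, subst nn_integral_distr)
         (auto intro!: measurable_restrict_subset borel_measurable_prod_ennreal measurable_compose[OF measurable_component_singleton])
    also have "\<dots> = (\<Prod>j\<in>J. \<integral>\<^sup>+k. emeasure (measure_pmf (walk_pmf q k)) (F j) \<partial>poisson_pmf a)"
      by (rule P.product_nn_integral_prod[OF J(1)]) simp
    finally show "emeasure M' ?E = (\<Prod>j\<in>J. emeasure (measure_pmf (compound_poisson_pmf a q)) (F j))"
      by (simp add: compound_poisson_pmf_def)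
  qed
qed

section \<open>Regularity of the Poisson clock\<close>

text \<open>
  The Stein identity of the Poisson law, from which its moments are read off.
\<close>

lemma nn_integral_poisson_mult:
  assumes a: "a > 0"
  shows "(\<integral>\<^sup>+k. ennreal (real k) * f k \<partial>poisson_pmf a) = ennreal a * (\<integral>\<^sup>+k. f (Suc k) \<partial>poisson_pmf a)"
proof -
  have "(\<integral>\<^sup>+k. ennreal (real k) * f k \<partial>poisson_pmf a)
      = (\<Sum>k. ennreal (pmf (poisson_pmf a) k) * (ennreal (real k) * f k))"
    by (simp only: nn_integral_measure_pmf nn_integral_count_space_nat)
  also have "\<dots> = (\<Sum>k. ennreal (pmf (poisson_pmf a) (Suc k)) * (ennreal (real (Suc k)) * f (Suc k)))"
    using suminf_offset[of "\<lambda>k. ennreal (pmf (poisson_pmf a) k) * (ennreal (real k) * f k)" 1] by simp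
  also have "\<dots> = (\<Sum>k. ennreal a * (ennreal (pmf (poisson_pmf a) k) * f (Suc k)))"
  proof (rule suminf_cong)
    fix k
    have "pmf (poisson_pmf a) (Suc k) * real (Suc k) = a * pmf (poisson_pmf a) k"
      using a by (simp add: field_simps del: of_nat_Suc)
    hence "ennreal (pmf (poisson_pmf a) (Suc k)) * ennreal (real (Suc k)) = ennreal a * ennreal (pmf (poisson_pmf a) k)"
      using a by (metis ennreal_mult less_imp_le of_nat_0_le_iff pmf_nonneg)
    thus "ennreal (pmf (poisson_pmf a) (Suc k)) * (ennreal (real (Suc k)) * f (Suc k))
       = ennreal a * (ennreal (pmf (poisson_pmf a) k) * f (Suc k))"
      by (simp add: mult.assoc[symmetric])
  qed
  also have "\<dots> = ennreal a * (\<integral>\<^sup>+k. f (Suc k) \<partial>poisson_pmf a)"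
    by (simp only: nn_integral_measure_pmf nn_integral_count_space_nat ennreal_suminf_cmult)
  finally show ?thesis .
qed

lemma poisson_moments:
  assumes a: "a > 0"
  shows "integrable (poisson_pmf a) (\<lambda>k. (real k)\<^sup>2)" "integrable (poisson_pmf a) real"
    "measure_pmf.expectation (poisson_pmf a) real = a"
    "measure_pmf.expectation (poisson_pmf a) (\<lambda>k. (real k - a)\<^sup>2) = a"
proof -
  have 1: "(\<integral>\<^sup>+k. ennreal (real k) \<partial>poisson_pmf a) = ennreal a"
    using nn_integral_poisson_mult[OF a, of "\<lambda>_. 1"] by simp
  have "(\<integral>\<^sup>+k. ennreal ((real k)\<^sup>2) \<partial>poisson_pmf a) = (\<integral>\<^sup>+k. ennreal (real k) * ennreal (real k) \<partial>poisson_pmf a)"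
    by (simp add: power2_eq_square ennreal_mult)
  also have "\<dots> = ennreal a * (\<integral>\<^sup>+k. ennreal (real k) + 1 \<partial>poisson_pmf a)"
    by (subst nn_integral_poisson_mult[OF a]) (simp add: add.commute)
  also have "\<dots> = ennreal a * (ennreal a + 1)"
    by (subst nn_integral_add) (simp_all add: 1)
  also have "\<dots> = ennreal (a * (a + 1))" using a by (simp add: ennreal_mult)
  finally have 2: "(\<integral>\<^sup>+k. ennreal ((real k)\<^sup>2) \<partial>poisson_pmf a) = ennreal (a * (a + 1))" .
  show i1: "integrable (poisson_pmf a) real"
    by (rule integrableI_nonneg) (simp_all add: 1)
  show i2: "integrable (poisson_pmf a) (\<lambda>k. (real k)\<^sup>2)"
    by (rule integrableI_nonneg) (simp_all add: 2)
  show e1: "measure_pmf.expectation (poisson_pmf a) real = a"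
    using a by (subst integral_eq_nn_integral) (simp_all add: 1)
  have e2: "measure_pmf.expectation (poisson_pmf a) (\<lambda>k. (real k)\<^sup>2) = a * (a + 1)"
    using a by (subst integral_eq_nn_integral) (simp_all add: 2)
  have "measure_pmf.expectation (poisson_pmf a) (\<lambda>k. (real k - a)\<^sup>2)
     = measure_pmf.expectation (poisson_pmf a) (\<lambda>k. (real k)\<^sup>2 - 2 * a * real k + a\<^sup>2)"
    by (simp add: power2_diff algebra_simps)
  also have "\<dots> = a * (a + 1) - 2 * a * a + a\<^sup>2"
    using i1 i2 by (simp add: e1 e2)
  finally show "measure_pmf.expectation (poisson_pmf a) (\<lambda>k. (real k - a)\<^sup>2) = a"
    by (simp add: power2_eq_square algebra_simps)
qed

text \<open>
  The bound is quadratic in \<open>a\<close>; this is why multiple ticks in one cell disappear when \<open>lam ^ 2 * h\<close> tends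
  to \<open>0\<close>, the number of cells being of order \<open>1 / h\<close> and \<open>a = lam * h\<close>.
\<close>

lemma poisson_prob_ge_2:
  assumes "a > 0"
  shows "measure (poisson_pmf a) {2..} \<le> a\<^sup>2"
proof -
  have "{2..} = - {0, 1 :: nat}" by auto
  hence "measure (poisson_pmf a) {2..} = 1 - measure (poisson_pmf a) {0, 1}"
    using measure_pmf.prob_compl[of "{0, 1}" "poisson_pmf a"] by (simp add: Compl_eq_Diff_UNIV)
  also have "measure (poisson_pmf a) {0, 1} = exp (- a) * (1 + a)"
    using assms by (simp add: measure_measure_pmf_finite algebra_simps)
  finally have "measure (poisson_pmf a) {2..} = 1 - exp (- a) * (1 + a)" .
  moreover have "(1 - a) * (1 + a) \<le> exp (- a) * (1 + a)"
    using exp_ge_add_one_self[of "- a"] assms by (intro mult_right_mono) auto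
  ultimately show ?thesis by (simp add: power2_eq_square algebra_simps)
qed

lemma poisson_process_component:
  "distr (poisson_process a) (count_space UNIV) (\<lambda>\<kappa>. \<kappa> i) = measure_pmf (poisson_pmf a)"
proof -
  have "distr (poisson_process a) (measure_pmf (poisson_pmf a)) (\<lambda>\<kappa>. \<kappa> i) = measure_pmf (poisson_pmf a)"
    by (rule distr_PiM_component) (auto intro: measure_pmf.prob_space_axioms)
  moreover have "distr (poisson_process a) (measure_pmf (poisson_pmf a)) (\<lambda>\<kappa>. \<kappa> i)
      = distr (poisson_process a) (count_space UNIV) (\<lambda>\<kappa>. \<kappa> i)"
    by (rule distr_cong) simp_all
  ultimately show ?thesis by simp
qed

text \<open>
  The cross terms of the second moment vanish by independence, so the variance of the count is \<open>n * a\<close>.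
\<close>

lemma arrivals_chebyshev:
  assumes a: "a > 0" and x: "x > 0"
  shows "measure (poisson_process a) {\<kappa>\<in>space (poisson_process a). \<bar>real (arrivals \<kappa> n) - real n * a\<bar> \<ge> x} \<le> real n * a / x\<^sup>2"
proof -
  let ?P = "poisson_process a"
  interpret prob_space ?P
    by (rule prob_space_PiM) (rule measure_pmf.prob_space_axioms)
  define Z where "Z r \<kappa> = real (\<kappa> r) - a" for r :: nat and \<kappa> :: "nat \<Rightarrow> nat"
  have comp1: "(LINT \<kappa>|?P. f (\<kappa> r)) = (LINT k|poisson_pmf a. f k)" for f :: "nat \<Rightarrow> real" and r
  proof -
    have "(LINT k|distr ?P (count_space UNIV) (\<lambda>\<kappa>. \<kappa> r). f k) = (LINT \<kappa>|?P. f (\<kappa> r))"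
      by (rule integral_distr[OF measurable_component_count]) simp
    thus ?thesis by (simp only: poisson_process_component)
  qed
  have comp2: "integrable ?P (\<lambda>\<kappa>. f (\<kappa> r)) \<longleftrightarrow> integrable (poisson_pmf a) f" for f :: "nat \<Rightarrow> real" and r
  proof -
    have "integrable (distr ?P (count_space UNIV) (\<lambda>\<kappa>. \<kappa> r)) f \<longleftrightarrow> integrable ?P (\<lambda>\<kappa>. f (\<kappa> r))"
      by (rule integrable_distr_eq[OF measurable_component_count]) simp
    thus ?thesis by (simp only: poisson_process_component)
  qed
  have iZ: "integrable ?P (Z r)" for r
    using poisson_moments[OF a] unfolding Z_def by (subst comp2[of "\<lambda>k. real k - a"]) simp
  have eZ: "expectation (Z r) = 0" for r
    using poisson_moments[OF a] unfolding Z_def by (subst comp1[of "\<lambda>k. real k - a"]) simp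
  have iZ2: "integrable ?P (\<lambda>\<kappa>. (Z r \<kappa>)\<^sup>2)" and eZ2: "expectation (\<lambda>\<kappa>. (Z r \<kappa>)\<^sup>2) = a" for r
  proof -
    have "integrable (poisson_pmf a) (\<lambda>k. (real k)\<^sup>2 - 2 * a * real k + a\<^sup>2)"
      using poisson_moments[OF a] by (intro Bochner_Integration.integrable_add Bochner_Integration.integrable_diff) auto
    hence "integrable (poisson_pmf a) (\<lambda>k. (real k - a)\<^sup>2)" by (simp add: power2_diff algebra_simps)
    thus "integrable ?P (\<lambda>\<kappa>. (Z r \<kappa>)\<^sup>2)" "expectation (\<lambda>\<kappa>. (Z r \<kappa>)\<^sup>2) = a"
      using poisson_moments[OF a] unfolding Z_def
      by (subst comp2[of "\<lambda>k. (real k - a)\<^sup>2"], simp, subst comp1[of "\<lambda>k. (real k - a)\<^sup>2"], simp)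
  qed
  have coord: "distr ?P (measure_pmf (poisson_pmf a)) (\<lambda>\<kappa>. \<kappa> i) = measure_pmf (poisson_pmf a)" for i
    by (rule distr_PiM_component) (auto intro: measure_pmf.prob_space_axioms)
  have "indep_vars (\<lambda>_. measure_pmf (poisson_pmf a)) (\<lambda>r \<kappa>. \<kappa> r) (UNIV :: nat set)"
    by (subst indep_vars_iff_distr_eq_PiM) (simp_all add: restrict_def coord)
  hence ind: "indep_vars (\<lambda>_. borel) Z UNIV"
    unfolding Z_def by (rule indep_vars_compose2[where Y = "\<lambda>_ k. real k - a"]) simp
  have cross: "integrable ?P (\<lambda>\<kappa>. Z r \<kappa> * Z s \<kappa>)" "expectation (\<lambda>\<kappa>. Z r \<kappa> * Z s \<kappa>) = 0"
    if "r \<noteq> s" for r s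
  proof -
    have "indep_vars (\<lambda>_. borel) Z {r, s}" by (rule indep_vars_subset[OF ind]) simp
    from indep_vars_integrable[OF _ this iZ] indep_vars_lebesgue_integral[OF _ this iZ]
    have "integrable ?P (\<lambda>\<kappa>. \<Prod>i\<in>{r, s}. Z i \<kappa>)"
      "expectation (\<lambda>\<kappa>. \<Prod>i\<in>{r, s}. Z i \<kappa>) = (\<Prod>i\<in>{r, s}. expectation (Z i))" by blast+
    thus "integrable ?P (\<lambda>\<kappa>. Z r \<kappa> * Z s \<kappa>)" "expectation (\<lambda>\<kappa>. Z r \<kappa> * Z s \<kappa>) = 0"
      using that by (simp_all add: eZ)
  qed
  define S where "S n \<kappa> = (\<Sum>r<n. Z r \<kappa>)" for n \<kappa>
  have S2: "integrable ?P (\<lambda>\<kappa>. (S n \<kappa>)\<^sup>2) \<and> expectation (\<lambda>\<kappa>. (S n \<kappa>)\<^sup>2) = real n * a" for n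
  proof (induction n)
    case (Suc n)
    have eq: "(S (Suc n) \<kappa>)\<^sup>2 = (S n \<kappa>)\<^sup>2 + (Z n \<kappa>)\<^sup>2 + 2 * (\<Sum>r<n. Z r \<kappa> * Z n \<kappa>)" for \<kappa>
      by (simp add: S_def power2_sum sum_distrib_right[symmetric] algebra_simps)
    have i: "integrable ?P (\<lambda>\<kappa>. \<Sum>r<n. Z r \<kappa> * Z n \<kappa>)"
      by (intro Bochner_Integration.integrable_sum cross) simp
    have e: "expectation (\<lambda>\<kappa>. \<Sum>r<n. Z r \<kappa> * Z n \<kappa>) = 0"
      by (subst Bochner_Integration.integral_sum) (auto intro!: cross sum.neutral)
    show ?case unfolding eq
      using Suc iZ2[of n] i by (simp add: e eZ2 algebra_simps)
  qed (simp add: S_def)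
  have Sn: "S n \<kappa> = real (arrivals \<kappa> n) - real n * a" for \<kappa>
    by (simp add: S_def Z_def arrivals_def sum_subtractf)
  have iS: "integrable ?P (S n)" unfolding S_def by (intro Bochner_Integration.integrable_sum iZ)
  have eS: "expectation (S n) = 0" unfolding S_def by (subst Bochner_Integration.integral_sum) (simp_all add: iZ eZ)
  have "prob {\<kappa>\<in>space ?P. x \<le> \<bar>S n \<kappa> - expectation (S n)\<bar>} \<le> variance (S n) / x\<^sup>2"
    by (rule Chebyshev_inequality) (use S2 x iS in auto)
  thus ?thesis using conjunct2[OF S2[of n]] by (simp add: eS Sn)
qed

lemma prob_single_arrivals:
  assumes "a > 0"
  shows "measure (poisson_process a) {\<kappa>\<in>space (poisson_process a). \<kappa> i \<ge> 2} \<le> a\<^sup>2"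
proof -
  have "measure (poisson_process a) {\<kappa>\<in>space (poisson_process a). \<kappa> i \<ge> 2}
      = measure (distr (poisson_process a) (count_space UNIV) (\<lambda>\<kappa>. \<kappa> i)) {2..}"
    by (subst measure_distr[OF measurable_component_count]) (auto intro!: arg_cong2[where f = measure])
  thus ?thesis using poisson_prob_ge_2[OF assms] by (simp only: poisson_process_component)
qed

text \<open>
  The union bound over \<open>R * w\<close> cells for multiple ticks, and over \<open>R + 1\<close> checkpoints for deviations from the
  mean. Since \<open>h * w\<close> is bounded by \<open>d / 2\<close>, the result depends on \<open>h\<close> and \<open>w\<close> only through
  \<open>lam ^ 2 * h\<close>.
\<close>

lemma prob_regular_arrivals:
  fixes lam h d :: real and R w :: nat
  assumes lam: "lam > 0" and h: "h > 0" and d: "d > 0" and w: "h * real w \<le> d / 2"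
  defines "P \<equiv> poisson_process (lam * h)"
  defines "G \<equiv> {\<kappa>\<in>space P. (\<forall>i<R * w. \<kappa> i \<le> 1) \<and>
      (\<forall>r\<le>R. \<bar>real (arrivals \<kappa> (r * w)) / lam - h * real (r * w)\<bar> \<le> d / 2)}"
  shows "G \<in> sets P" "measure P G \<ge> 1 - (real R * d * (lam\<^sup>2 * h) + 2 * real (R + 1) * real R / d / lam)"
proof -
  interpret prob_space P
    unfolding P_def by (rule prob_space_PiM) (rule measure_pmf.prob_space_axioms)
  have a: "lam * h > 0" using lam h by simp
  define B where "B i = {\<kappa>\<in>space P. \<kappa> i \<ge> 2}" for i
  define C where "C r = {\<kappa>\<in>space P. \<bar>real (arrivals \<kappa> (r * w)) - real (r * w) * (lam * h)\<bar> \<ge> lam * d / 2}" for r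
  have mB: "B i \<in> sets P" for i
    unfolding B_def P_def by (rule measurable_sets_Collect[OF measurable_component_count]) simp
  have mC: "C r \<in> sets P" for r
    unfolding C_def P_def by (rule measurable_sets_Collect[OF measurable_arrivals]) simp
  show "G \<in> sets P"
  proof -
    have "{\<kappa>\<in>space P. \<kappa> i \<le> 1} \<in> sets P" for i
      unfolding P_def by (rule measurable_sets_Collect[OF measurable_component_count]) simp
    moreover have "{\<kappa>\<in>space P. \<bar>real (arrivals \<kappa> n) / lam - h * real n\<bar> \<le> d / 2} \<in> sets P" for n
      unfolding P_def by (rule measurable_sets_Collect[OF measurable_arrivals]) simp
    ultimately show ?thesis unfolding G_def
      by (intro sets.sets_Collect_conj sets.sets_Collect_countable_All sets.sets_Collect_imp) (auto simp del: of_nat_mult)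
  qed
  have sub: "space P - G \<subseteq> (\<Union>i<R * w. B i) \<union> (\<Union>r\<le>R. C r)"
  proof
    fix \<kappa> assume \<kappa>: "\<kappa> \<in> space P - G"
    hence "(\<exists>i<R * w. \<not> \<kappa> i \<le> 1) \<or> (\<exists>r\<le>R. \<not> \<bar>real (arrivals \<kappa> (r * w)) / lam - h * real (r * w)\<bar> \<le> d / 2)"
      by (auto simp: G_def)
    thus "\<kappa> \<in> (\<Union>i<R * w. B i) \<union> (\<Union>r\<le>R. C r)"
    proof
      assume "\<exists>i<R * w. \<not> \<kappa> i \<le> 1"
      then obtain i where "i < R * w" "\<kappa> i \<ge> 2" by auto
      thus ?thesis using \<kappa> by (auto simp: B_def)
    next
      assume "\<exists>r\<le>R. \<not> \<bar>real (arrivals \<kappa> (r * w)) / lam - h * real (r * w)\<bar> \<le> d / 2"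
      then obtain r where r: "r \<le> R" "d / 2 < \<bar>real (arrivals \<kappa> (r * w)) / lam - h * real (r * w)\<bar>" by auto
      have "real (arrivals \<kappa> (r * w)) - real (r * w) * (lam * h) = lam * (real (arrivals \<kappa> (r * w)) / lam - h * real (r * w))"
        using lam by (simp add: field_simps)
      hence "\<bar>real (arrivals \<kappa> (r * w)) - real (r * w) * (lam * h)\<bar> = lam * \<bar>real (arrivals \<kappa> (r * w)) / lam - h * real (r * w)\<bar>"
        using lam by (simp only: abs_mult)
      moreover have "lam * (d / 2) \<le> lam * \<bar>real (arrivals \<kappa> (r * w)) / lam - h * real (r * w)\<bar>"
        using r lam by (intro mult_left_mono) auto
      ultimately have "\<kappa> \<in> C r" using \<kappa> by (simp add: C_def)
      thus ?thesis using r by auto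
    qed
  qed
  have "1 - prob G = prob (space P - G)" using \<open>G \<in> sets P\<close> by (simp add: prob_compl)
  also have "\<dots> \<le> prob ((\<Union>i<R * w. B i) \<union> (\<Union>r\<le>R. C r))"
    by (rule finite_measure_mono[OF sub]) (use mB mC in auto)
  also have "\<dots> \<le> prob (\<Union>i<R * w. B i) + prob (\<Union>r\<le>R. C r)"
    by (rule measure_Un_le) (use mB mC in auto)
  also have "\<dots> \<le> (\<Sum>i<R * w. prob (B i)) + (\<Sum>r\<le>R. prob (C r))"
    by (intro add_mono finite_measure_subadditive_finite) (use mB mC in auto)
  also have "\<dots> \<le> (\<Sum>i<R * w. (lam * h)\<^sup>2) + (\<Sum>r\<le>R. 2 * real R / d / lam)"
  proof (intro add_mono sum_mono)
    show "prob (B i) \<le> (lam * h)\<^sup>2" for i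
      using prob_single_arrivals[OF a, of i] by (simp add: B_def P_def)
    fix r assume r: "r \<in> {..R}"
    have "prob (C r) \<le> real (r * w) * (lam * h) / (lam * d / 2)\<^sup>2"
      using arrivals_chebyshev[OF a, of "lam * d / 2" "r * w"] lam d unfolding C_def P_def by simp
    also have "\<dots> = 4 * real r * (h * real w) / (lam * d\<^sup>2)"
      using lam d by (simp add: power2_eq_square field_simps)
    also have "\<dots> \<le> 4 * real R * (d / 2) / (lam * d\<^sup>2)"
      using r lam d w h by (intro divide_right_mono mult_mono) auto
    also have "\<dots> = 2 * real R / d / lam" using lam d by (simp add: power2_eq_square field_simps)
    finally show "prob (C r) \<le> 2 * real R / d / lam" .
  qed
  also have "(\<Sum>i<R * w. (lam * h)\<^sup>2) = real R * (h * real w) * (lam\<^sup>2 * h)"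
    by (simp add: power2_eq_square algebra_simps)
  also have "\<dots> \<le> real R * d * (lam\<^sup>2 * h)"
    using w d h by (intro mult_right_mono mult_left_mono) auto
  finally show "measure P G \<ge> 1 - (real R * d * (lam\<^sup>2 * h) + 2 * real (R + 1) * real R / d / lam)"
    by (simp add: algebra_simps)
qed

section \<open>The walk and its Poissonisation are close\<close>

text \<open>
  As the counter \<open>c\<close> never jumps by more than \<open>1\<close>, the path on the grid visits \<open>s 0, s 1, \<dots>\<close> in order. It
  sits at \<open>s j\<close> during \<open>[a j, a (Suc j))\<close>, where \<open>a j\<close> is the time at which \<open>c\<close> reaches \<open>j\<close>, and the path
  that runs with constant speed sits there during \<open>[j / lam, (j + 1) / lam)\<close>. The time change that matches
  these intervals makes the paths equal, for any sequence of points \<open>s\<close>.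
\<close>

lemma time_changed_walk_close:
  fixes s :: "nat \<Rightarrow> 'a::metric_space" and c :: "nat \<Rightarrow> nat"
  assumes lam: "lam > 0" and h: "h > 0"
    and c0: "c 0 = 0" and mono: "mono c" and unit: "\<And>i. i < I \<Longrightarrow> c (Suc i) \<le> Suc (c i)"
    and close: "\<And>i. i \<le> I \<Longrightarrow> \<bar>real (c i) / lam - h * real i\<bar> \<le> d"
    and de: "d < e" and T: "T < h * real I - 2 * d"
  shows "skorokhod_of (\<lambda>t. s (nat \<lfloor>lam * t\<rfloor>))
    \<in> skorokhod_nbhd (skorokhod_of (\<lambda>t. s (c (nat \<lfloor>t / h\<rfloor>)))) T e"
proof -
  define n where "n = c I"
  \<comment> \<open>The first index at which the counter reaches \<open>j\<close>.\<close>
  define i where "i j = (LEAST r. j \<le> c r)" for j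
  have hit: "c (i j) = j" "i j \<le> I" if "j \<le> n" for j
  proof -
    have ge: "j \<le> c (i j)" unfolding i_def by (rule LeastI[of "\<lambda>r. j \<le> c r" I]) (use that in \<open>simp add: n_def\<close>)
    show I: "i j \<le> I" unfolding i_def by (rule Least_le) (use that in \<open>simp add: n_def\<close>)
    show "c (i j) = j"
    proof (cases "i j")
      case (Suc r)
      have "\<not> j \<le> c r" using not_less_Least[of r "\<lambda>r. j \<le> c r"] Suc by (simp add: i_def)
      moreover have "c (Suc r) \<le> Suc (c r)" using I Suc by (intro unit) simp
      ultimately show ?thesis using ge Suc by simp
    qed (use ge c0 in simp)
  qed
  have below: "c r < j" if "r < i j" for r j
    using not_less_Least[of r "\<lambda>r. j \<le> c r"] that by (simp add: i_def)
  define a where "a j = h * real (i j)" for j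
  define b where "b j = real j / lam" for j :: nat
  show ?thesis
  proof (rule skorokhod_nbhd_of_partitions[where a = a and b = b and n = n and d = d])
    have "cadlag (\<lambda>t. (\<lambda>r. s (c r)) (nat \<lfloor>1 / h * t\<rfloor>))"
      by (rule cadlag_step_function) (use h in simp)
    thus "cadlag (\<lambda>t. s (c (nat \<lfloor>t / h\<rfloor>)))" by simp
    show "cadlag (\<lambda>t. s (nat \<lfloor>lam * t\<rfloor>))"
      by (rule cadlag_step_function) (use lam in simp)
    show "a 0 = 0" by (simp add: a_def i_def)
    show "b 0 = 0" by (simp add: b_def)
    show "d < e" by (rule de)
    fix j assume j: "j < n"
    show "b j < b (Suc j)" using lam by (simp add: b_def divide_strict_right_mono)
    have "i j < i (Suc j)"
    proof (rule ccontr)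
      assume "\<not> i j < i (Suc j)"
      hence "c (i (Suc j)) \<le> c (i j)" using mono by (simp add: monoD)
      thus False using hit[of j] hit[of "Suc j"] j by simp
    qed
    thus "a j < a (Suc j)" using h by (simp add: a_def)
  next
    fix j assume j: "j \<le> n"
    show "\<bar>b j - a j\<bar> \<le> d" using close[OF hit(2)[OF j]] by (simp add: a_def b_def hit(1)[OF j])
  next
    have "real (c I) / lam \<ge> h * real I - d" using close[of I] by simp
    moreover have "\<bar>real n / lam - a n\<bar> \<le> d" using close[OF hit(2)[of n]] hit(1)[of n] by (simp add: a_def)
    ultimately show "T < a n" using T unfolding n_def by linarith
  next
    fix j u v
    assume j: "j < n" and u: "a j \<le> u" "u < a (Suc j)" and v: "b j \<le> v" "v < b (Suc j)"
    have u0: "u \<ge> 0" using u(1) h by (smt (verit) a_def mult_nonneg_nonneg of_nat_0_le_iff)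
    define r where "r = nat \<lfloor>u / h\<rfloor>"
    note ru = grid_floor_bounds[OF h u0, folded r_def]
    have "h * real (i j) < h * (real r + 1)" using u(1) ru(2) by (simp add: a_def)
    hence 1: "i j \<le> r" using h by simp
    have "h * real r < h * real (i (Suc j))" using u(2) ru(1) by (simp add: a_def)
    hence 2: "r < i (Suc j)" using h by simp
    have "j \<le> c r" using monoD[OF mono 1] hit(1)[of j] j by simp
    moreover have "c r < Suc j" by (rule below[OF 2])
    ultimately have "c r = j" by simp
    moreover have "real j \<le> lam * v" "lam * v < real j + 1"
      using v lam by (simp_all add: b_def field_simps)
    hence "nat \<lfloor>lam * v\<rfloor> = j" by linarith
    ultimately show "dist (s (nat \<lfloor>lam * v\<rfloor>)) (s (c (nat \<lfloor>u / h\<rfloor>))) < e"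
      using de close[of 0] c0 by (simp flip: r_def)
  qed
qed

text \<open>
  A monotone counter that is close to a linear function at the points of a coarse grid is close to it
  everywhere. This reduces a maximal inequality to finitely many applications of Chebyshev's inequality.
\<close>

lemma mono_close_of_checkpoints:
  fixes c :: "nat \<Rightarrow> nat"
  assumes lam: "lam > 0" and h: "h > 0" and w: "w > 0" and mono: "mono c" and hw: "h * real w \<le> d / 2"
    and check: "\<And>r. r \<le> R \<Longrightarrow> \<bar>real (c (r * w)) / lam - h * real (r * w)\<bar> \<le> d / 2"
    and i: "i \<le> R * w"
  shows "\<bar>real (c i) / lam - h * real i\<bar> \<le> d"
proof (cases "i = R * w")
  case False
  define r where "r = i div w"
  have r: "r * w \<le> i" "i < Suc r * w"
    using div_mult_mod_eq[of i w] mod_less_divisor[OF w, of i] unfolding r_def mult_Suc by linarith+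
  have "r * w < R * w" using r(1) i False by linarith
  hence "r < R" by simp
  have "real (c (r * w)) / lam \<le> real (c i) / lam"
    using monoD[OF mono r(1)] lam by (simp add: divide_right_mono)
  moreover have "real (c i) / lam \<le> real (c (Suc r * w)) / lam"
    using monoD[OF mono, of i "Suc r * w"] r(2) lam by (intro divide_right_mono) auto
  moreover have "h * real (r * w) \<le> h * real i" "h * real i \<le> h * real (Suc r * w)"
    by (intro mult_left_mono of_nat_mono r(1) less_imp_le[OF r(2)] less_imp_le[OF h])+
  moreover have "h * real (Suc r * w) = h * real (r * w) + h * real w" by (simp add: algebra_simps)
  ultimately show ?thesis using check[of r] check[of "Suc r"] \<open>r < R\<close> hw by linarith
next
  case True
  have "h * real w > 0" using h w by simp
  thus ?thesis using check[of R] True hw by simp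
qed

lemma tendsto_0_of_square_mult:
  fixes lam h :: "nat \<Rightarrow> real"
  assumes lam: "filterlim lam at_top sequentially" and h0: "\<And>m. h m > 0"
    and lh: "(\<lambda>m. (lam m)\<^sup>2 * h m) \<longlonglongrightarrow> 0"
  shows "h \<longlonglongrightarrow> 0"
proof (rule tendsto_sandwich[OF _ _ tendsto_const lh])
  have "\<forall>\<^sub>F m in sequentially. 1 \<le> lam m" using lam by (simp add: filterlim_at_top)
  thus "\<forall>\<^sub>F m in sequentially. h m \<le> (lam m)\<^sup>2 * h m"
  proof eventually_elim
    case (elim m)
    have "1 \<le> (lam m)\<^sup>2" using elim by simp
    thus ?case using h0[of m] by simp
  qed
qed (use h0 in \<open>simp add: less_imp_le\<close>)

text \<open>
  The number \<open>R\<close> of checkpoints is fixed by \<open>T\<close> and \<open>e\<close>, and only the number \<open>w\<close> of cells between two of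
  them grows with \<open>m\<close>. So the deviation probabilities, each of order \<open>1 / lam m\<close>, add up to a null
  sequence.
\<close>

lemma poissonised_walk_close:
  fixes lam h :: "nat \<Rightarrow> real"
  assumes lam0: "\<And>m. lam m > 0" and h0: "\<And>m. h m > 0"
    and lam: "filterlim lam at_top sequentially" and lh: "(\<lambda>m. (lam m)\<^sup>2 * h m) \<longlonglongrightarrow> 0"
    and e: "e > 0" and eta: "\<eta> > 0"
  shows "\<forall>\<^sub>F m in sequentially. \<exists>G\<in>sets (poisson_process (lam m * h m)).
     measure (poisson_process (lam m * h m)) G \<ge> 1 - \<eta> \<and>
     (\<forall>\<kappa>\<in>G. \<forall>s :: nat \<Rightarrow> 'a::metric_space. skorokhod_of (\<lambda>t. s (nat \<lfloor>lam m * t\<rfloor>))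
        \<in> skorokhod_nbhd (skorokhod_of (\<lambda>t. s (arrivals \<kappa> (nat \<lfloor>t / h m\<rfloor>)))) T e)"
proof -
  define d where "d = e / 2"
  have d: "d > 0" "d < e" using e by (simp_all add: d_def)
  define R where "R = nat \<lceil>(\<bar>T\<bar> + 2 * d + 1) * 4 / d\<rceil>"
  have R: "(\<bar>T\<bar> + 2 * d + 1) * 4 / d \<le> real R" unfolding R_def by linarith
  have hlim: "h \<longlonglongrightarrow> 0" by (rule tendsto_0_of_square_mult[OF lam h0 lh])
  have "(\<lambda>m. real R * d * ((lam m)\<^sup>2 * h m) + 2 * real (R + 1) * real R / d * inverse (lam m))
     \<longlonglongrightarrow> real R * d * 0 + 2 * real (R + 1) * real R / d * 0"
    by (intro tendsto_intros lh tendsto_inverse_0_at_top lam)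
  hence "\<forall>\<^sub>F m in sequentially. real R * d * ((lam m)\<^sup>2 * h m) + 2 * real (R + 1) * real R / d * inverse (lam m) < \<eta>"
    using eta by (intro order_tendstoD) auto
  moreover have "\<forall>\<^sub>F m in sequentially. h m < d / 4"
    using d by (intro order_tendstoD(2)[OF hlim]) simp
  ultimately show ?thesis
  proof eventually_elim
    case (elim m)
    \<comment> \<open>The largest \<open>w\<close> with \<open>h m * w \<le> d / 2\<close>; the \<open>R\<close> blocks of \<open>w\<close> cells then reach beyond \<open>T + 2 * d\<close>.\<close>
    define w where "w = nat \<lfloor>d / (2 * h m)\<rfloor>"
    have "real w \<le> d / (2 * h m)" "d / (2 * h m) < real w + 1"
      using divide_nonneg_pos[of d "2 * h m"] d h0[of m] unfolding w_def by linarith+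
    hence w: "h m * real w \<le> d / 2" "d / 2 < h m * real w + h m"
      using h0[of m] by (simp_all add: field_simps)
    hence w4: "d / 4 \<le> h m * real w" using elim(2) by simp
    hence w0: "w > 0" using d by (cases w) auto
    let ?P = "poisson_process (lam m * h m)"
    let ?G = "{\<kappa>\<in>space ?P. (\<forall>i<R * w. \<kappa> i \<le> 1) \<and>
      (\<forall>r\<le>R. \<bar>real (arrivals \<kappa> (r * w)) / lam m - h m * real (r * w)\<bar> \<le> d / 2)}"
    note G = prob_regular_arrivals[OF lam0[of m] h0[of m] d(1) w(1), of R]
    show ?case
    proof (intro bexI[of _ ?G] conjI ballI allI)
      show "?G \<in> sets ?P" by (rule G(1))
      show "measure ?P ?G \<ge> 1 - \<eta>" using G(2) elim(1)[folded divide_inverse] by linarith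
      fix \<kappa> and s :: "nat \<Rightarrow> 'a" assume \<kappa>: "\<kappa> \<in> ?G"
      show "skorokhod_of (\<lambda>t. s (nat \<lfloor>lam m * t\<rfloor>))
        \<in> skorokhod_nbhd (skorokhod_of (\<lambda>t. s (arrivals \<kappa> (nat \<lfloor>t / h m\<rfloor>)))) T e"
      proof (rule time_changed_walk_close[where d = d and I = "R * w"])
        show "arrivals \<kappa> (Suc i) \<le> Suc (arrivals \<kappa> i)" if "i < R * w" for i using \<kappa> that by simp
        show "\<bar>real (arrivals \<kappa> i) / lam m - h m * real i\<bar> \<le> d" if "i \<le> R * w" for i
          by (rule mono_close_of_checkpoints[OF lam0 h0 w0 arrivals_mono w(1) _ that]) (use \<kappa> in simp)
        have "\<bar>T\<bar> + 2 * d + 1 = (\<bar>T\<bar> + 2 * d + 1) * 4 / d * (d / 4)" using d by simp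
        also have "\<dots> \<le> real R * (h m * real w)" using R w4 d by (intro mult_mono) auto
        finally show "T < h m * real (R * w) - 2 * d" by (simp add: mult_ac)
      qed (use lam0 h0 d arrivals_mono in auto)
    qed
  qed
qed

section \<open>Convergence to \<open>p\<close>-adic Brownian motion\<close>

theorem theorem3p3:
  fixes b P\<^sub>0 D \<alpha> \<sigma> :: real and lam :: "nat \<Rightarrow> real"
    and M :: "'v measure" and X :: "nat \<Rightarrow> 'v \<Rightarrow> 'p::prime_card padic_quot"
    and N :: "'w measure" and Y :: "real \<Rightarrow> 'w \<Rightarrow> 'p padic"
  assumes "b > 0" and "0 < P\<^sub>0" and "P\<^sub>0 < 1" and "D > 0"
    and "\<alpha> = (1 - P\<^sub>0) * (real CARD('p) powr (b + 1) - 1) / (real CARD('p) powr b * (real CARD('p) - 1))"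
    and "\<And>m. lam m = D * real CARD('p) powr (real m * b)"
    and "padic_walk_increments b P\<^sub>0 M X"
    and "\<sigma> = D * \<alpha>"
    and "padic_brownian_motion b \<sigma> N Y"
  shows "converges_weakly
     (\<lambda>m. skorokhod_law M (\<lambda>t \<omega>. padic_embed m (random_walk X (nat \<lfloor>lam m * t\<rfloor>) \<omega>)))
     (skorokhod_law N Y)"
proof -
  have p1: "real CARD('p) > 1" by (rule padic_CARD_gt_1)
  have M: "prob_space M" and indep: "prob_space.indep_vars M (\<lambda>_. count_space UNIV) X {1..}"
    using assms(7) by (simp_all add: padic_walk_increments_def)
  have N: "prob_space N" and Ym: "\<And>t. t \<ge> 0 \<Longrightarrow> Y t \<in> borel_measurable N"
    and Yc: "\<And>\<omega>. \<omega> \<in> space N \<Longrightarrow> cadlag (\<lambda>t. Y t \<omega>)" and Y0: "\<And>\<omega>. \<omega> \<in> space N \<Longrightarrow> Y 0 \<omega> = 0"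
    using assms(9) by (simp_all add: padic_brownian_motion_def)
  interpret M: prob_space M by (rule M)
  interpret N: prob_space N by (rule N)
  obtain q where q: "is_step_pmf b P\<^sub>0 q"
    and law: "\<And>i. i \<ge> 1 \<Longrightarrow> distr M (count_space UNIV) (X i) = measure_pmf q"
    using walk_increments_law[OF assms(7)] by metis
  have lam0: "lam m > 0" for m using assms(4,6) p1 by simp
  have lam_lim: "filterlim lam at_top sequentially"
  proof -
    have lam: "lam = (\<lambda>m. D * (real CARD('p) powr b) ^ m)"
      using p1 by (simp add: fun_eq_iff assms(6) powr_realpow[symmetric] powr_powr mult.commute)
    have "filterlim (\<lambda>m. (real CARD('p) powr b) ^ m) at_top sequentially"
      using p1 assms(1)
      by (intro filterlim_at_infinity_imp_filterlim_at_top[OF filterlim_realpow_sequentially_gt1]) auto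
    thus ?thesis
      unfolding lam by (rule filterlim_tendsto_pos_mult_at_top[OF tendsto_const assms(4)])
  qed
  \<comment> \<open>Any positive mesh with \<open>lam m ^ 2 * h m\<close> tending to \<open>0\<close> would do.\<close>
  define h where "h m = inverse (real (Suc m)) / (lam m)\<^sup>2" for m
  have h0: "h m > 0" for m using lam0[of m] by (simp add: h_def)
  have lh: "(\<lambda>m. (lam m)\<^sup>2 * h m) \<longlonglongrightarrow> 0"
  proof -
    have "(lam m)\<^sup>2 * h m = inverse (real (Suc m))" for m using lam0[of m] by (simp add: h_def)
    thus ?thesis using LIMSEQ_inverse_real_of_nat by simp
  qed
  have h: "h \<longlonglongrightarrow> 0" by (rule tendsto_0_of_square_mult[OF lam_lim h0 lh])
  define K where "K m = M \<Otimes>\<^sub>M poisson_process (lam m * h m)" for m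
  define c where "c m = compound_poisson_pmf (lam m * h m) q" for m
  have Kp: "prob_space (K m)" for m
  proof -
    interpret R: prob_space "poisson_process (lam m * h m)"
      by (rule prob_space_PiM) (rule measure_pmf.prob_space_axioms)
    interpret MR: pair_prob_space M "poisson_process (lam m * h m)" ..
    show ?thesis unfolding K_def by (rule MR.prob_space_axioms)
  qed
  \<comment> \<open>The exact identity: \<open>lam m * \<bar>p ^ m * y\<bar> powr b = D * \<bar>y\<bar> powr b\<close>.\<close>
  have fourier: "fourier_pmf (c m) (of_nat CARD('p) ^ m * y) = of_real (exp (- \<sigma> * h m * padic_abs y powr b))"
    if y: "padic_abs y \<le> real CARD('p) ^ m" for m and y :: "'p padic"
  proof -
    let ?u = "of_nat CARD('p) ^ m * y"
    have au: "padic_abs ?u = padic_abs y / real CARD('p) ^ m"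
      by (simp add: padic_abs_mult padic_abs_power padic_abs_p power_one_over)
    have u1: "padic_abs ?u \<le> 1" using y p1 by (simp add: au)
    have "lam m * padic_abs ?u powr b = D * padic_abs y powr b"
      using p1 by (simp add: au assms(6) powr_divide powr_powr flip: powr_realpow)
    hence exponent: "lam m * h m * (1 - \<alpha> * padic_abs ?u powr b - 1) = - \<sigma> * h m * padic_abs y powr b"
      by (simp add: assms(8) algebra_simps)
    have "fourier_pmf (c m) ?u = exp (of_real (lam m * h m) * (of_real (1 - \<alpha> * padic_abs ?u powr b) - 1))"
      unfolding c_def fourier_compound_poisson[OF u1 mult_pos_pos[OF lam0[of m] h0[of m]]]
        fourier_step_pmf[OF q assms(1) u1 assms(5)] ..
    also have "of_real (lam m * h m) * (of_real (1 - \<alpha> * padic_abs ?u powr b) - 1)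
        = (of_real (lam m * h m * (1 - \<alpha> * padic_abs ?u powr b - 1)) :: complex)" by simp
    finally show ?thesis by (simp only: exponent exp_of_real)
  qed
  let ?L = "\<lambda>m. skorokhod_law M (\<lambda>t \<omega>. padic_embed m (random_walk X (nat \<lfloor>lam m * t\<rfloor>) \<omega>))"
  let ?Z = "\<lambda>m \<omega>. skorokhod_of (\<lambda>t. padic_embed m (random_walk X (nat \<lfloor>lam m * t\<rfloor>) \<omega>))"
  let ?W = "\<lambda>\<omega>. skorokhod_of (\<lambda>t. Y t \<omega>)"
  define P where "P m z = grid_path (h m) m (\<lambda>i. block_sum X i z)" for m and z :: "'v \<times> (nat \<Rightarrow> nat)"
  define Q where "Q m \<omega> = grid_path (h m) m (\<lambda>i. padic_scaled_class m (Y (h m * real (Suc i)) \<omega> - Y (h m * real i) \<omega>))" for m \<omega>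
  have Xm: "X i \<in> measurable M (count_space UNIV)" if "i \<ge> 1" for i
    using indep that by (simp add: M.indep_vars_def)
  have Zm: "?Z m \<in> borel_measurable M" for m
  proof (rule measurable_skorokhod_of)
    show "(\<lambda>\<omega>. padic_embed m (random_walk X (nat \<lfloor>lam m * t\<rfloor>) \<omega>)) \<in> borel_measurable M" for t
    proof -
      have "random_walk X n \<in> measurable M (count_space UNIV)" for n
        unfolding random_walk_def[abs_def] by (rule measurable_quot_sum) (rule Xm, simp)
      thus ?thesis by (rule measurable_compose) simp
    qed
    show "cadlag (\<lambda>t. padic_embed m (random_walk X (nat \<lfloor>lam m * t\<rfloor>) \<omega>))" for \<omega>
      by (rule cadlag_step_function[where s = "\<lambda>n. padic_embed m (random_walk X n \<omega>)"]) (simp add: lam0 less_imp_le)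
  qed
  have Wm: "?W \<in> borel_measurable N" by (rule measurable_skorokhod_of[OF Ym Yc])
  have block_m: "(\<lambda>z i. block_sum X i z) \<in> measurable (K m) (PiM UNIV (\<lambda>_. count_space UNIV))" for m
    unfolding K_def by (rule measurable_sequence[OF distr_block_sums(1)[OF M indep law]])
  have Pm: "P m \<in> borel_measurable (K m)" for m
    unfolding P_def by (rule measurable_compose[OF block_m measurable_grid_path[OF h0]])
  have distP: "distr (K m) borel (P m) = distr (PiM UNIV (\<lambda>_. measure_pmf (c m))) borel (grid_path (h m) m)" for m
    using distr_distr[OF measurable_grid_path[OF h0[of m], of m] block_m[of m]]
      distr_block_sums(2)[OF M indep law, of "lam m * h m"]
    by (simp add: K_def c_def P_def[abs_def] o_def)
  note increments = distr_brownian_increments[OF assms(9) h0 fourier]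
  have incr_m: "(\<lambda>\<omega> i. padic_scaled_class m (Y (h m * real (Suc i)) \<omega> - Y (h m * real i) \<omega>))
      \<in> measurable N (PiM UNIV (\<lambda>_. count_space UNIV))" for m
    by (rule measurable_sequence[OF increments(1)])
  have Qm: "Q m \<in> borel_measurable N" for m
    unfolding Q_def by (rule measurable_compose[OF incr_m measurable_grid_path[OF h0]])
  have distQ: "distr N borel (Q m) = distr (PiM UNIV (\<lambda>_. measure_pmf (c m))) borel (grid_path (h m) m)" for m
    using distr_distr[OF measurable_grid_path[OF h0[of m], of m] incr_m[of m]]
      increments(2)[of m]
    by (simp add: Q_def[abs_def] o_def)
  have lim: "(\<lambda>m. Q m \<omega>) \<longlonglongrightarrow> ?W \<omega>" if \<omega>: "\<omega> \<in> space N" for \<omega>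
    using sampled_path_LIMSEQ[OF Yc[OF \<omega>] h0 h] grid_path_sampled[of "\<lambda>t. Y t \<omega>", OF Y0[OF \<omega>]]
    by (simp add: Q_def)
  have fst_K: "distr (K m) M fst = M" for m
    unfolding K_def
    by (rule prob_space.distr_pair_fst, rule prob_space_PiM, rule measure_pmf.prob_space_axioms)
  have close: "\<forall>\<^sub>F m in sequentially. \<exists>G\<in>sets (K m). measure (K m) G \<ge> 1 - \<eta> \<and>
       (\<forall>z\<in>G. ?Z m (fst z) \<in> skorokhod_nbhd (P m z) T e)" if "e > 0" "\<eta> > 0" for T e \<eta>
    using poissonised_walk_close[where 'a = "'p padic", OF lam0 h0 lam_lim lh that, of T]
  proof eventually_elim
    case (elim m)
    then obtain G where G: "G \<in> sets (poisson_process (lam m * h m))" "measure (poisson_process (lam m * h m)) G \<ge> 1 - \<eta>"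
      and near: "\<forall>\<kappa>\<in>G. \<forall>s :: nat \<Rightarrow> 'p padic. skorokhod_of (\<lambda>t. s (nat \<lfloor>lam m * t\<rfloor>))
        \<in> skorokhod_nbhd (skorokhod_of (\<lambda>t. s (arrivals \<kappa> (nat \<lfloor>t / h m\<rfloor>)))) T e"
      by blast
    interpret P: prob_space "poisson_process (lam m * h m)"
      by (rule prob_space_PiM) (rule measure_pmf.prob_space_axioms)
    show ?case
    proof (intro bexI[of _ "space M \<times> G"] conjI ballI)
      show "space M \<times> G \<in> sets (K m)" unfolding K_def using G(1) by auto
      show "measure (K m) (space M \<times> G) \<ge> 1 - \<eta>"
        using G(1,2) P.emeasure_pair_measure_Times[of "space M" M G]
        by (simp add: K_def measure_def M.emeasure_space_1)
      fix z assume "z \<in> space M \<times> G"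
      thus "?Z m (fst z) \<in> skorokhod_nbhd (P m z) T e"
        using bspec[OF near, of "snd z", THEN spec, of "\<lambda>n. padic_embed m (random_walk X n (fst z))"]
          grid_path_block_sum[of "h m" m X "fst z" "snd z"] by (auto simp: P_def)
    qed
  qed
  show ?thesis
    unfolding converges_weakly_def
  proof (intro conjI allI impI)
    show "prob_space (?L m)" for m
      unfolding skorokhod_law_def by (rule M.prob_space_distr[OF Zm])
    show "prob_space (skorokhod_law N Y)"
      unfolding skorokhod_law_def by (rule N.prob_space_distr[OF Wm])
    fix f :: "'p padic skorokhod \<Rightarrow> real"
    assume "continuous_on UNIV f \<and> bounded (range f)"
    hence f: "continuous_on UNIV f" and "bounded (range f)" by auto
    then obtain B where B: "\<And>x. \<bar>f x\<bar> \<le> B" by (auto simp: bounded_iff)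
    have fm: "f \<in> borel_measurable borel" using f by (rule borel_measurable_continuous_onI)
    have "(\<lambda>m. LINT z|K m. f (?Z m (fst z))) \<longlonglongrightarrow> (LINT \<omega>|N. f (?W \<omega>))"
    proof (rule weak_limit_by_coupling[OF Kp N _ Pm Qm Wm _ lim close f B])
      show "(\<lambda>z. ?Z m (fst z)) \<in> borel_measurable (K m)" for m
        unfolding K_def by (rule measurable_compose[OF measurable_fst Zm])
      show "distr (K m) borel (P m) = distr N borel (Q m)" for m by (simp only: distP distQ)
    qed
    moreover have "(LINT z|K m. f (?Z m (fst z))) = integral\<^sup>L (?L m) f" for m
    proof -
      have "fst \<in> measurable (K m) M" by (simp add: K_def)
      from integral_distr[OF this measurable_compose[OF Zm fm], of m]
      have "(LINT z|K m. f (?Z m (fst z))) = (LINT \<omega>|M. f (?Z m \<omega>))" by (simp add: fst_K)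
      also have "\<dots> = integral\<^sup>L (?L m) f"
        unfolding skorokhod_law_def by (rule integral_distr[OF Zm fm, symmetric])
      finally show ?thesis .
    qed
    moreover have "(LINT \<omega>|N. f (?W \<omega>)) = integral\<^sup>L (skorokhod_law N Y) f"
      unfolding skorokhod_law_def by (rule integral_distr[OF Wm fm, symmetric])
    ultimately show "(\<lambda>m. integral\<^sup>L (?L m) f)
        \<longlonglongrightarrow> integral\<^sup>L (skorokhod_law N Y) f" by simp
  qed (simp_all add: skorokhod_law_def)
qed

end
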